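(* Let $V^{[*]}$ be a dg vertex operator algebra. There is a natural transformation $\psi:\eta_{F^\bullet}\circ R^{[*]}(-)\to\operatorname{gr}^{[*]}A(-)$ of functors from the category of weak dg $V^{[*]}$-modules to the category of graded $\operatorname{gr}^{[*]}A(V^{[*]})$-modules such that, for any weak dg $V^{[*]}$-module $M^{[*]}$, the morphism $$\psi_{M^{[*]}}:\eta_{F^\bullet}(R^{[*]}(M^{[*]}))\to\operatorname{gr}^{[*]}A(M^{[*]}),$$ $$m+C_2^{[|m|]}(M^{[*]})+\left((\operatorname{Ker}\eta_{F^\bullet})R^{[*]}(M^{[*]})\right)^{[|m|]}\mapsto m+O(M^{[*]})+\bigoplus_{p<|m|}M^{[p]}$$ (for $m$ dg homogeneous) is a surjective morphism of dg Poisson $\operatorname{gr}^{[*]}A(V^{[*]})$-modules.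
   Context: All vector spaces are over $\mathbb C$. A (cochain) complex $V^{[*]}=\bigoplus_{p\in\mathbb Z}V^{[p]}$ has a differential $d_V$ of degree $+1$ with $d_V^2=0$; $|v|=p$ for $v\in V^{[p]}$ (dg homogeneous elements). $\operatorname{End}^{[*]}(V^{[*]})=\bigoplus_p\operatorname{End}^{[p]}(V^{[*]})$, where $\operatorname{End}^{[p]}$ is the space of linear maps of degree $p$. A dg vertex algebra $(V^{[*]},d_V,Y(\cdot,x),\mathbf 1)$ is a complex with a linear map $v\mapsto Y(v,x)=\sum_{n\in\mathbb Z}v_nx^{-n-1}\in\operatorname{End}^{[*]}(V^{[*]})[[x,x^{-1}]]$ such that for $v\in V^{[p]}$ one has $v_n\in\operatorname{End}^{[p-2n-2]}(V^{[*]})$ and $(d_Vv)_n=d_V\circ v_n-(-1)^{p}v_n\circ d_V$, and a vector $\mathbf 1\in V^{[0]}$ with $d_V\mathbf 1=0$, such that: $u_nv=0$ for $n$ sufficiently large; $Y(\mathbf 1,x)=\operatorname{id}$; $Y(v,x)\mathbf 1\in V^{[*]}[[x]]$ with constant term $v$; and (Jacobi identity) for homogeneous $u,v$ and all $l,m,n\in\mathbb Z$, $$\sum_{i\ge0}(-1)^i\binom li\left(u_{m+l-i}v_{n+i}-(-1)^{l}(-1)^{|u||v|}v_{n+l-i}u_{m+i}\right)=\sum_{i\ge0}\binom mi(u_{l+i}v)_{m+n-i}.$$ A dg vertex operator algebra is a dg vertex algebra with $\omega\in V^{[4]}$, $d_V\omega=0$, such that, writing $Y(\omega,x)=\sum_nL(n)x^{-n-2}$: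 $[L(m),L(n)]=(m-n)L(m+n)+\frac1{12}(m^3-m)\delta_{m+n,0}c_V$ for some $c_V\in\mathbb C$; $L(0)$ is semisimple with $V^{[*]}=\bigoplus_{n\in\frac12\mathbb Z}V_n^{[*]}$, $V_n^{[*]}$ the eigenspace of eigenvalue (weight) $n$, $\omega\in V_2^{[*]}$, $\dim V_n^{[*]}<\infty$, $V_n^{[*]}=0$ for $n\ll0$; and $L(-1)v=v_{-2}\mathbf 1$. Write $\operatorname{wt}(u)=n$ for $u\in V_n^{[*]}$. A weak dg module over $V^{[*]}$ is a complex $(M^{[*]},d_M)$ with a linear map $v\mapsto Y_M(v,x)=\sum_nv_nx^{-n-1}\in\operatorname{End}^{[*]}(M^{[*]})[[x,x^{-1}]]$ such that for $v\in V^{[p]}$, $v_n\in\operatorname{End}^{[p-2n-2]}(M^{[*]})$ and $(d_Vv)_n=d_M\circ v_n-(-1)^pv_n\circ d_M$; $v_nm=0$ for $n$ sufficiently large; $Y_M(\mathbf 1,x)=\operatorname{id}$; and the displayed Jacobi identity holds for operators on $M^{[*]}$. Morphisms are chain maps $f$ with $f(v_nm)=v_nf(m)$. $C_2$-algebra: $C_2^{[*]}(V^{[*]})=\operatorname{Span}\{u_{-2}v\}$, $C_2^{[*]}(M^{[*]})=\operatorname{Span}\{v_{-2}m\}$ (graded subcomplexes), $R^{[*]}(V^{[*]})=V^{[*]}/C_2^{[*]}(V^{[*]})$, $R^{[*]}(M^{[*]})=M^{[*]}/C_2^{[*]}(M^{[*]})$. $R^{[*]}(V^{[*]})$ is a graded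 commutative dg Poisson algebra with $\overline u\cdot\overline v=\overline{u_{-1}v}$, $\{\overline u,\overline v\}=\overline{u_0v}$, and $R^{[*]}(M^{[*]})$ is a dg Poisson module over it with $\overline v\cdot\overline m=\overline{v_{-1}m}$, $\{\overline v,\overline m\}=\overline{v_0m}$. Zhu algebra: for $u\in V^{[*]}$ weight homogeneous and $m$ in $V^{[*]}$ or $M^{[*]}$, put $u\ast_lm=\sum_{n\ge0}\binom{\operatorname{wt}(u)}{n}u_{n-1}m$, $u\circ m=\sum_{n\ge0}\binom{\operatorname{wt}(u)}{n}u_{n-2}m$, and, for $u,m$ also dg homogeneous, $m\ast_ru=(-1)^{|u||m|}\sum_{n\ge0}\binom{\operatorname{wt}(u)-1}{n}u_{n-1}m$ (extended linearly). $O(V^{[*]})$, $O(M^{[*]})$ are the spans of all $u\circ v$, resp. $u\circ m$; $A(V^{[*]})=V^{[*]}/O(V^{[*]})$ is an associative algebra under $\ast=\ast_l$, $A(M^{[*]})=M^{[*]}/O(M^{[*]})$ an $A(V^{[*]})$-bimodule; $[\cdot]$ denotes classes. $F^p$ is the image of the part of cohomological degree $\le p$, $\operatorname{gr}^{[p]}=F^p/F^{p-1}$, $\operatorname{gr}^{[*]}=\bigoplus_p\operatorname{gr}^{[p]}$. $\operatorname{gr}^{[*]}A(V^{[*]})$ is a graded commutative dg Poisson algebra with product induced by $\ast$, differential by $d_V$, and bracket of the classes of $u\in V^{[p]},v\in V^{[q]}$ equal to $[u]\ast[v]-(-1)^{pq}[v]\ast[u]\bmod F^{p+q-3}A(V^{[*]})$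 in $\operatorname{gr}^{[p+q-2]}$; $\operatorname{gr}^{[*]}A(M^{[*]})$ is a dg Poisson module over it with action induced by $\ast_l$, differential by $d_M$, and bracket of the classes of $u\in V^{[p]},m\in M^{[q]}$ equal to $[u]\ast_l[m]-(-1)^{pq}[m]\ast_r[u]\bmod F^{p+q-3}A(M^{[*]})$ in $\operatorname{gr}^{[p+q-2]}A(M^{[*]})$. $\eta_{F^\bullet}:R^{[*]}(V^{[*]})\to\operatorname{gr}^{[*]}A(V^{[*]})$ is the surjective morphism of dg Poisson algebras sending the class of $u\in V^{[p]}$ to the class of $[u]$ in $\operatorname{gr}^{[p]}A(V^{[*]})$. For a dg Poisson $R^{[*]}(V^{[*]})$-module $W$, $\eta_{F^\bullet}(W)=\operatorname{gr}^{[*]}A(V^{[*]})\otimes_{R^{[*]}(V^{[*]})}W\cong W/((\operatorname{Ker}\eta_{F^\bullet})W)$. On $\eta_{F^\bullet}(R^{[*]}(M^{[*]}))$, with $\widehat m$ denoting the class of $m$, the differential is $\widehat m\mapsto\widehat{d_Mm}$, the action of the class of $v\in V^{[*]}$ is $\widehat v\cdot\widehat m=\widehat{v_{-1}m}$, and the bracket, induced from that of $R^{[*]}(M^{[*]})$, is $\{\widehat v,\widehat m\}=\widehat{v_0m}$. A dg Poisson module over a graded commutative dg Poisson algebra $R^{[*]}$ with bracket of even degree (here $-2$) is a left dg $R^{[*]}$-module with a bracket satisfying $\{\{a,b\},m\}=\{a,\{b,m\}\}-(-1)^{|a||b|}\{b,\{a,m\}\}$, $d\{a,m\}=\{da,m\}+(-1)^{|a|}\{a,dm\}$,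 $\{a,bm\}=\{a,b\}m+(-1)^{|a||b|}b\{a,m\}$, $\{ab,m\}=a\{b,m\}+(-1)^{|a||b|}b\{a,m\}$. Morphisms are degree-$0$ chain maps compatible with action and bracket.
   Formalization: The bracket on η(R(M)) over gr A(V) is not always well defined: ψ_M is always shown to be a surjective morphism of dg gr A(V)-modules and of dg Poisson R(V)-modules, and of dg Poisson gr A(V)-modules exactly when {Ker η, R(M)} lies in (Ker η)R(M). *)

theory Defs
  imports
    Complex_Main
    "HOL-Library.Groups_Big_Fun"
    "HOL-Algebra.AbelCoset"
    "HOL-Algebra.Module"
begin

section \<open>Direct sums and complexes of vector spaces\<close>

text \<open>Ambient vector spaces are types of class \<^class>\<open>ab_group_add\<close> with an explicit complex
  scalar multiplication \<open>s\<close>.  \<^const>\<open>Sum_any\<close> is the sum over the finite support of a function.\<close>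

definition decomposition :: "'i set \<Rightarrow> ('i \<Rightarrow> 'a::ab_group_add set) \<Rightarrow> 'a \<Rightarrow> ('i \<Rightarrow> 'a) \<Rightarrow> bool"
  where "decomposition I W x f \<longleftrightarrow>
    (\<forall>i\<in>I. f i \<in> W i) \<and> (\<forall>i. i \<notin> I \<longrightarrow> f i = 0) \<and> finite {i. f i \<noteq> 0} \<and> x = Sum_any f"

definition direct_sum ::
    "(complex \<Rightarrow> 'a::ab_group_add \<Rightarrow> 'a) \<Rightarrow> 'i set \<Rightarrow> ('i \<Rightarrow> 'a set) \<Rightarrow> bool"
  where "direct_sum s I W \<longleftrightarrow>
    (\<forall>i\<in>I. module.subspace s (W i)) \<and> (\<forall>x. \<exists>!f. decomposition I W x f)"

definition component :: "'i set \<Rightarrow> ('i \<Rightarrow> 'a::ab_group_add set) \<Rightarrow> 'i \<Rightarrow> 'a \<Rightarrow> 'a"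
  where "component I W i x = (THE f. decomposition I W x f) i"

text \<open>The data of a complex together with operators \<open>mode M v n\<close> (that is, \<open>v\<^sub>n\<close>) for \<open>v\<close> in \<open>'v\<close>.
  A vertex operator algebra is regarded as a module over itself (\<open>'m = 'v\<close>) with two
  distinguished vectors.\<close>

record ('v, 'm) vmod =
  scl :: "complex \<Rightarrow> 'm \<Rightarrow> 'm"
  deg :: "int \<Rightarrow> 'm set"
  dif :: "'m \<Rightarrow> 'm"
  mode :: "'v \<Rightarrow> int \<Rightarrow> 'm \<Rightarrow> 'm"

record 'v voa = "('v, 'v) vmod" +
  vac :: 'v
  conf :: 'v

definition is_complex :: "('v, 'm::ab_group_add, 'z) vmod_scheme \<Rightarrow> bool"
  where "is_complex M \<longleftrightarrow>
    vector_space (scl M) \<and>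
    direct_sum (scl M) UNIV (deg M) \<and>
    Vector_Spaces.linear (scl M) (scl M) (dif M) \<and>
    (\<forall>p. \<forall>m\<in>deg M p. dif M m \<in> deg M (p + 1)) \<and>
    (\<forall>m. dif M (dif M m) = 0)"


section \<open>Dg vertex operator algebras and weak dg modules\<close>

definition jacobi_identity ::
    "('v::ab_group_add) voa \<Rightarrow> ('v, 'm::ab_group_add, 'z) vmod_scheme \<Rightarrow> bool"
  where "jacobi_identity V M \<longleftrightarrow>
    (\<forall>p q. \<forall>u\<in>deg V p. \<forall>v\<in>deg V q. \<forall>l m n w.
      Sum_any (\<lambda>i::nat. scl M ((-1) ^ i * ((of_int l :: complex) gchoose i))
        (mode M u (m + l - int i) (mode M v (n + int i) w)
          - scl M ((-1) powi l * (-1) powi (p * q))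
              (mode M v (n + l - int i) (mode M u (m + int i) w))))
      = Sum_any (\<lambda>i::nat. scl M ((of_int m :: complex) gchoose i)
          (mode M (mode V u (l + int i) v) (m + n - int i) w)))"

definition weak_dg_module ::
    "('v::ab_group_add) voa \<Rightarrow> ('v, 'm::ab_group_add, 'z) vmod_scheme \<Rightarrow> bool"
  where "weak_dg_module V M \<longleftrightarrow>
    is_complex M \<and>
    (\<forall>n m. Vector_Spaces.linear (scl V) (scl M) (\<lambda>v. mode M v n m)) \<and>
    (\<forall>v n. Vector_Spaces.linear (scl M) (scl M) (mode M v n)) \<and>
    (\<forall>p q n. \<forall>v\<in>deg V p. \<forall>m\<in>deg M q. mode M v n m \<in> deg M (q + (p - 2 * n - 2))) \<and>
    (\<forall>p n m. \<forall>v\<in>deg V p.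
      mode M (dif V v) n m
        = dif M (mode M v n m) - scl M ((-1) powi p) (mode M v n (dif M m))) \<and>
    (\<forall>v m. \<exists>N. \<forall>n\<ge>N. mode M v n m = 0) \<and>
    (\<forall>n m. mode M (vac V) n m = (if n = -1 then m else 0)) \<and>
    jacobi_identity V M"

definition dg_vertex_algebra :: "('v::ab_group_add) voa \<Rightarrow> bool"
  where "dg_vertex_algebra V \<longleftrightarrow>
    weak_dg_module V V \<and>
    vac V \<in> deg V 0 \<and> dif V (vac V) = 0 \<and>
    (\<forall>v n. n \<ge> 0 \<longrightarrow> mode V v n (vac V) = 0) \<and>
    (\<forall>v. mode V v (-1) (vac V) = v)"

definition vir :: "'v voa \<Rightarrow> int \<Rightarrow> 'v \<Rightarrow> 'v"
  where "vir V n = mode V (conf V) (n + 1)"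

definition wt_space :: "'v voa \<Rightarrow> real \<Rightarrow> 'v set"
  where "wt_space V r = {v. vir V 0 v = scl V (of_real r) v}"

definition half_ints :: "real set"
  where "half_ints = {r. 2 * r \<in> \<int>}"

definition dg_vertex_operator_algebra :: "('v::ab_group_add) voa \<Rightarrow> bool"
  where "dg_vertex_operator_algebra V \<longleftrightarrow>
    dg_vertex_algebra V \<and>
    conf V \<in> deg V 4 \<and> dif V (conf V) = 0 \<and>
    (\<exists>c::complex. \<forall>m n v.
      vir V m (vir V n v) - vir V n (vir V m v)
        = scl V (of_int (m - n)) (vir V (m + n) v)
          + (if m + n = 0 then scl V (of_int (m ^ 3 - m) / 12 * c) v else 0)) \<and>
    direct_sum (scl V) half_ints (wt_space V) \<and>
    conf V \<in> wt_space V 2 \<and>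
    (\<forall>r\<in>half_ints. \<exists>B. finite B \<and> module.span (scl V) B = wt_space V r) \<and>
    (\<exists>N. \<forall>r\<in>half_ints. r < N \<longrightarrow> wt_space V r = {0}) \<and>
    (\<forall>v. vir V (-1) v = mode V v (-2) (vac V))"

definition weak_dg_module_hom :: "('v, 'm::ab_group_add) vmod \<Rightarrow> ('v, 'n::ab_group_add) vmod \<Rightarrow>
    ('m \<Rightarrow> 'n) \<Rightarrow> bool"
  where "weak_dg_module_hom M N f \<longleftrightarrow>
    Vector_Spaces.linear (scl M) (scl N) f \<and>
    (\<forall>p. \<forall>m\<in>deg M p. f m \<in> deg N p) \<and>
    (\<forall>m. f (dif M m) = dif N (f m)) \<and>
    (\<forall>v n m. f (mode M v n m) = mode N v n (f m))"


section \<open>Dg Poisson algebras and their modules\<close>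

definition CC :: "complex ring"
  where "CC = \<lparr>carrier = UNIV, mult = (*), one = 1, zero = 0, add = (+)\<rparr>"

text \<open>Vector spaces with a carrier are HOL-Algebra modules over \<^const>\<open>CC\<close>; the ring
  multiplication and unit that the record type provides are not used.\<close>

definition lin_map :: "(complex, 'a) module \<Rightarrow> (complex, 'b) module \<Rightarrow> ('a \<Rightarrow> 'b) \<Rightarrow> bool"
  where "lin_map A B f \<longleftrightarrow>
    f \<in> carrier A \<rightarrow> carrier B \<and>
    (\<forall>x\<in>carrier A. \<forall>y\<in>carrier A. f (x \<oplus>\<^bsub>A\<^esub> y) = f x \<oplus>\<^bsub>B\<^esub> f y) \<and>
    (\<forall>c. \<forall>x\<in>carrier A. f (c \<odot>\<^bsub>A\<^esub> x) = c \<odot>\<^bsub>B\<^esub> f x)"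

definition bilin_map :: "(complex, 'a) module \<Rightarrow> (complex, 'b) module \<Rightarrow> (complex, 'c) module \<Rightarrow>
    ('a \<Rightarrow> 'b \<Rightarrow> 'c) \<Rightarrow> bool"
  where "bilin_map A B C h \<longleftrightarrow>
    (\<forall>a\<in>carrier A. lin_map B C (h a)) \<and> (\<forall>b\<in>carrier B. lin_map A C (\<lambda>a. h a b))"

text \<open>A graded space is the family of its homogeneous components.  Since components of different
  degrees may share elements (as sets), every operation carries the degrees of its arguments:
  \<open>gact W p q a w\<close> and \<open>gbrk W p q a w\<close> are \<open>a \<cdot> w\<close> and \<open>{a, w}\<close> for \<open>|a| = p\<close>, \<open>|w| = q\<close>.
  An algebra is a module over itself with a unit.\<close>

record ('a, 'w) pmod =
  gcomp :: "int \<Rightarrow> (complex, 'w) module"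
  gdiff :: "int \<Rightarrow> 'w \<Rightarrow> 'w"
  gact :: "int \<Rightarrow> int \<Rightarrow> 'a \<Rightarrow> 'w \<Rightarrow> 'w"
  gbrk :: "int \<Rightarrow> int \<Rightarrow> 'a \<Rightarrow> 'w \<Rightarrow> 'w"

record 'a palg = "('a, 'a) pmod" +
  gunit :: 'a

definition graded_module_axioms :: "'a palg \<Rightarrow> ('a, 'w, 'z) pmod_scheme \<Rightarrow> bool"
  where "graded_module_axioms A W \<longleftrightarrow>
    (\<forall>p. module CC (gcomp W p)) \<and>
    (\<forall>p q. bilin_map (gcomp A p) (gcomp W q) (gcomp W (p + q)) (gact W p q)) \<and>
    (\<forall>p. \<forall>w\<in>carrier (gcomp W p). gact W 0 p (gunit A) w = w) \<and>
    (\<forall>p q r. \<forall>a\<in>carrier (gcomp A p). \<forall>b\<in>carrier (gcomp A q). \<forall>w\<in>carrier (gcomp W r).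
      gact W (p + q) r (gact A p q a b) w = gact W p (q + r) a (gact W q r b w))"

definition graded_comm_algebra :: "'a palg \<Rightarrow> bool"
  where "graded_comm_algebra A \<longleftrightarrow>
    gunit A \<in> carrier (gcomp A 0) \<and>
    graded_module_axioms A A \<and>
    (\<forall>p q. \<forall>a\<in>carrier (gcomp A p). \<forall>b\<in>carrier (gcomp A q).
      gact A p q a b = ((-1) powi (p * q)) \<odot>\<^bsub>gcomp A (p + q)\<^esub> gact A q p b a)"

definition dg_axioms :: "'a palg \<Rightarrow> ('a, 'w, 'z) pmod_scheme \<Rightarrow> bool"
  where "dg_axioms A W \<longleftrightarrow>
    (\<forall>p. lin_map (gcomp W p) (gcomp W (p + 1)) (gdiff W p)) \<and>
    (\<forall>p. \<forall>w\<in>carrier (gcomp W p). gdiff W (p + 1) (gdiff W p w) = \<zero>\<^bsub>gcomp W (p + 2)\<^esub>) \<and>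
    (\<forall>p q. \<forall>a\<in>carrier (gcomp A p). \<forall>w\<in>carrier (gcomp W q).
      gdiff W (p + q) (gact W p q a w)
        = gact W (p + 1) q (gdiff A p a) w
          \<oplus>\<^bsub>gcomp W (p + q + 1)\<^esub>
          ((-1) powi p) \<odot>\<^bsub>gcomp W (p + q + 1)\<^esub> gact W p (q + 1) a (gdiff W q w))"

definition poisson_axioms :: "'a palg \<Rightarrow> ('a, 'w, 'z) pmod_scheme \<Rightarrow> bool"
  where "poisson_axioms A W \<longleftrightarrow>
    (\<forall>p q. bilin_map (gcomp A p) (gcomp W q) (gcomp W (p + q - 2)) (gbrk W p q)) \<and>
    (\<forall>p q r. \<forall>a\<in>carrier (gcomp A p). \<forall>b\<in>carrier (gcomp A q). \<forall>w\<in>carrier (gcomp W r).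
      gbrk W (p + q - 2) r (gbrk A p q a b) w
        = gbrk W p (q + r - 2) a (gbrk W q r b w)
          \<ominus>\<^bsub>gcomp W (p + q + r - 4)\<^esub>
          ((-1) powi (p * q)) \<odot>\<^bsub>gcomp W (p + q + r - 4)\<^esub>
            gbrk W q (p + r - 2) b (gbrk W p r a w)) \<and>
    (\<forall>p q. \<forall>a\<in>carrier (gcomp A p). \<forall>w\<in>carrier (gcomp W q).
      gdiff W (p + q - 2) (gbrk W p q a w)
        = gbrk W (p + 1) q (gdiff A p a) w
          \<oplus>\<^bsub>gcomp W (p + q - 1)\<^esub>
          ((-1) powi p) \<odot>\<^bsub>gcomp W (p + q - 1)\<^esub> gbrk W p (q + 1) a (gdiff W q w)) \<and>
    (\<forall>p q r. \<forall>a\<in>carrier (gcomp A p). \<forall>b\<in>carrier (gcomp A q). \<forall>w\<in>carrier (gcomp W r).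
      gbrk W p (q + r) a (gact W q r b w)
        = gact W (p + q - 2) r (gbrk A p q a b) w
          \<oplus>\<^bsub>gcomp W (p + q + r - 2)\<^esub>
          ((-1) powi (p * q)) \<odot>\<^bsub>gcomp W (p + q + r - 2)\<^esub>
            gact W q (p + r - 2) b (gbrk W p r a w)) \<and>
    (\<forall>p q r. \<forall>a\<in>carrier (gcomp A p). \<forall>b\<in>carrier (gcomp A q). \<forall>w\<in>carrier (gcomp W r).
      gbrk W (p + q) r (gact A p q a b) w
        = gact W p (q + r - 2) a (gbrk W q r b w)
          \<oplus>\<^bsub>gcomp W (p + q + r - 2)\<^esub>
          ((-1) powi (p * q)) \<odot>\<^bsub>gcomp W (p + q + r - 2)\<^esub>
            gact W q (p + r - 2) b (gbrk W p r a w))"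

definition dg_poisson_algebra :: "'a palg \<Rightarrow> bool"
  where "dg_poisson_algebra A \<longleftrightarrow>
    graded_comm_algebra A \<and> dg_axioms A A \<and> poisson_axioms A A \<and>
    (\<forall>p q. \<forall>a\<in>carrier (gcomp A p). \<forall>b\<in>carrier (gcomp A q).
      gbrk A p q a b = (- ((-1) powi (p * q))) \<odot>\<^bsub>gcomp A (p + q - 2)\<^esub> gbrk A q p b a)"

definition graded_module :: "'a palg \<Rightarrow> ('a, 'w) pmod \<Rightarrow> bool"
  where "graded_module A W \<longleftrightarrow> graded_comm_algebra A \<and> graded_module_axioms A W"

definition dg_module :: "'a palg \<Rightarrow> ('a, 'w) pmod \<Rightarrow> bool"
  where "dg_module A W \<longleftrightarrow> graded_module A W \<and> dg_axioms A A \<and> dg_axioms A W"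

definition dg_poisson_module :: "'a palg \<Rightarrow> ('a, 'w) pmod \<Rightarrow> bool"
  where "dg_poisson_module A W \<longleftrightarrow>
    dg_poisson_algebra A \<and> dg_module A W \<and> poisson_axioms A W"

definition graded_module_hom ::
    "'a palg \<Rightarrow> ('a, 'w) pmod \<Rightarrow> ('a, 'x) pmod \<Rightarrow> (int \<Rightarrow> 'w \<Rightarrow> 'x) \<Rightarrow> bool"
  where "graded_module_hom A W X \<phi> \<longleftrightarrow>
    (\<forall>p. lin_map (gcomp W p) (gcomp X p) (\<phi> p)) \<and>
    (\<forall>p q. \<forall>a\<in>carrier (gcomp A p). \<forall>w\<in>carrier (gcomp W q).
      \<phi> (p + q) (gact W p q a w) = gact X p q a (\<phi> q w))"

definition dg_module_hom ::
    "'a palg \<Rightarrow> ('a, 'w) pmod \<Rightarrow> ('a, 'x) pmod \<Rightarrow> (int \<Rightarrow> 'w \<Rightarrow> 'x) \<Rightarrow> bool"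
  where "dg_module_hom A W X \<phi> \<longleftrightarrow>
    graded_module_hom A W X \<phi> \<and>
    (\<forall>p. \<forall>w\<in>carrier (gcomp W p). \<phi> (p + 1) (gdiff W p w) = gdiff X p (\<phi> p w))"

definition dg_poisson_module_hom ::
    "'a palg \<Rightarrow> ('a, 'w) pmod \<Rightarrow> ('a, 'x) pmod \<Rightarrow> (int \<Rightarrow> 'w \<Rightarrow> 'x) \<Rightarrow> bool"
  where "dg_poisson_module_hom A W X \<phi> \<longleftrightarrow>
    dg_module_hom A W X \<phi> \<and>
    (\<forall>p q. \<forall>a\<in>carrier (gcomp A p). \<forall>w\<in>carrier (gcomp W q).
      \<phi> (p + q - 2) (gbrk W p q a w) = gbrk X p q a (\<phi> q w))"

definition graded_surjective :: "('a, 'w) pmod \<Rightarrow> ('a, 'x) pmod \<Rightarrow> (int \<Rightarrow> 'w \<Rightarrow> 'x) \<Rightarrow> bool"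
  where "graded_surjective W X \<phi> \<longleftrightarrow>
    (\<forall>p. \<phi> p ` carrier (gcomp W p) = carrier (gcomp X p))"


section \<open>Quotients and induced maps\<close>

definition subspace_mod ::
    "(complex \<Rightarrow> 'a::ab_group_add \<Rightarrow> 'a) \<Rightarrow> 'a set \<Rightarrow> (complex, 'a) module"
  where "subspace_mod s U =
    \<lparr>carrier = U, mult = undefined, one = undefined, zero = 0, add = (+), smult = s\<rparr>"

definition quot_mod :: "(complex, 'a) module \<Rightarrow> 'a set \<Rightarrow> (complex, 'a set) module"
  where "quot_mod A S =
    \<lparr>carrier = a_rcosets\<^bsub>A\<^esub> S, mult = undefined, one = undefined, zero = S,
     add = (\<lambda>X Y. X <+>\<^bsub>A\<^esub> Y), smult = (\<lambda>c X. \<Union>x\<in>X. S +>\<^bsub>A\<^esub> (c \<odot>\<^bsub>A\<^esub> x))\<rparr>"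

definition mod_span :: "(complex, 'a) module \<Rightarrow> 'a set \<Rightarrow> 'a set"
  where "mod_span A S = \<Inter>{U. submodule U CC A \<and> S \<subseteq> U}"

text \<open>\<open>descend S c h\<close> is the map induced by \<open>h\<close> on the classes \<open>c s\<close> of the representatives
  \<open>s \<in> S\<close>; its value is meaningful only where \<open>h\<close> does not depend on the representative.\<close>

definition descend :: "'s set \<Rightarrow> ('s \<Rightarrow> 'x) \<Rightarrow> ('s \<Rightarrow> 'y) \<Rightarrow> 'x \<Rightarrow> 'y"
  where "descend S c h x = (THE y. \<forall>s\<in>S. c s = x \<longrightarrow> y = h s)"

definition descend2 :: "'s set \<Rightarrow> ('s \<Rightarrow> 'x) \<Rightarrow> 't set \<Rightarrow> ('t \<Rightarrow> 'z) \<Rightarrow> ('s \<Rightarrow> 't \<Rightarrow> 'y) \<Rightarrow>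
    'x \<Rightarrow> 'z \<Rightarrow> 'y"
  where "descend2 S c T e h x z = (THE y. \<forall>s\<in>S. \<forall>t\<in>T. c s = x \<longrightarrow> e t = z \<longrightarrow> y = h s t)"


section \<open>The \<open>C\<^sub>2\<close>-algebra and its modules\<close>

definition C2 :: "('v, 'm::ab_group_add, 'z) vmod_scheme \<Rightarrow> 'm set"
  where "C2 M = module.span (scl M) {mode M v (-2) m | v m. True}"

definition R_comp :: "('v, 'm::ab_group_add, 'z) vmod_scheme \<Rightarrow> int \<Rightarrow> (complex, 'm set) module"
  where "R_comp M p = quot_mod (subspace_mod (scl M) (deg M p)) (C2 M \<inter> deg M p)"

definition R_class :: "('v, 'm::ab_group_add, 'z) vmod_scheme \<Rightarrow> int \<Rightarrow> 'm \<Rightarrow> 'm set"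
  where "R_class M p m = (C2 M \<inter> deg M p) +>\<^bsub>subspace_mod (scl M) (deg M p)\<^esub> m"

definition R_mod :: "('v::ab_group_add) voa \<Rightarrow> ('v, 'm::ab_group_add, 'z) vmod_scheme \<Rightarrow>
    ('v set, 'm set) pmod"
  where "R_mod V M =
    \<lparr>gcomp = R_comp M,
     gdiff = (\<lambda>p. descend (deg M p) (R_class M p) (\<lambda>m. R_class M (p + 1) (dif M m))),
     gact = (\<lambda>p q. descend2 (deg V p) (R_class V p) (deg M q) (R_class M q)
       (\<lambda>v m. R_class M (p + q) (mode M v (-1) m))),
     gbrk = (\<lambda>p q. descend2 (deg V p) (R_class V p) (deg M q) (R_class M q)
       (\<lambda>v m. R_class M (p + q - 2) (mode M v 0 m)))\<rparr>"

definition R_alg :: "('v::ab_group_add) voa \<Rightarrow> 'v set palg"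
  where "R_alg V = pmod.extend (R_mod V V) (palg.fields (R_class V 0 (vac V)))"

definition R_map :: "('v, 'm::ab_group_add) vmod \<Rightarrow> ('v, 'n::ab_group_add) vmod \<Rightarrow> ('m \<Rightarrow> 'n) \<Rightarrow>
    int \<Rightarrow> 'm set \<Rightarrow> 'n set"
  where "R_map M N f p = descend (deg M p) (R_class M p) (\<lambda>m. R_class N p (f m))"


section \<open>The Zhu algebra, its bimodules, and their associated graded objects\<close>

text \<open>In the next three definitions \<open>u\<close> is homogeneous of weight \<open>r\<close>, and in \<open>star_r_hom\<close> also of
  degree \<open>p\<close>, with \<open>m\<close> of degree \<open>q\<close>.\<close>

definition star_l_hom ::
    "('v, 'm::ab_group_add, 'z) vmod_scheme \<Rightarrow> real \<Rightarrow> 'v \<Rightarrow> 'm \<Rightarrow> 'm"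
  where "star_l_hom M r u m =
    Sum_any (\<lambda>n::nat. scl M (complex_of_real r gchoose n) (mode M u (int n - 1) m))"

definition circ_hom ::
    "('v, 'm::ab_group_add, 'z) vmod_scheme \<Rightarrow> real \<Rightarrow> 'v \<Rightarrow> 'm \<Rightarrow> 'm"
  where "circ_hom M r u m =
    Sum_any (\<lambda>n::nat. scl M (complex_of_real r gchoose n) (mode M u (int n - 2) m))"

definition star_r_hom ::
    "('v, 'm::ab_group_add, 'z) vmod_scheme \<Rightarrow> real \<Rightarrow> int \<Rightarrow> int \<Rightarrow> 'm \<Rightarrow> 'v \<Rightarrow> 'm"
  where "star_r_hom M r p q m u = scl M ((-1) powi (p * q))
    (Sum_any (\<lambda>n::nat. scl M ((complex_of_real r - 1) gchoose n) (mode M u (int n - 1) m)))"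

definition wt_part :: "('v::ab_group_add) voa \<Rightarrow> real \<Rightarrow> 'v \<Rightarrow> 'v"
  where "wt_part V = component half_ints (wt_space V)"

definition deg_part :: "('v, 'm::ab_group_add, 'z) vmod_scheme \<Rightarrow> int \<Rightarrow> 'm \<Rightarrow> 'm"
  where "deg_part M = component UNIV (deg M)"

definition star_l ::
    "('v::ab_group_add) voa \<Rightarrow> ('v, 'm::ab_group_add, 'z) vmod_scheme \<Rightarrow> 'v \<Rightarrow> 'm \<Rightarrow> 'm"
  where "star_l V M u m = Sum_any (\<lambda>r. star_l_hom M r (wt_part V r u) m)"

definition star_r ::
    "('v::ab_group_add) voa \<Rightarrow> ('v, 'm::ab_group_add, 'z) vmod_scheme \<Rightarrow> 'm \<Rightarrow> 'v \<Rightarrow> 'm"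
  where "star_r V M m u = Sum_any (\<lambda>r. Sum_any (\<lambda>p. Sum_any (\<lambda>q.
    star_r_hom M r p q (deg_part M q m) (deg_part V p (wt_part V r u)))))"

definition zhu_O ::
    "('v::ab_group_add) voa \<Rightarrow> ('v, 'm::ab_group_add, 'z) vmod_scheme \<Rightarrow> 'm set"
  where "zhu_O V M = module.span (scl M)
    {circ_hom M r u m | r u m. r \<in> half_ints \<and> u \<in> wt_space V r}"

definition zhu_A ::
    "('v::ab_group_add) voa \<Rightarrow> ('v, 'm::ab_group_add, 'z) vmod_scheme \<Rightarrow> (complex, 'm set) module"
  where "zhu_A V M = quot_mod (subspace_mod (scl M) UNIV) (zhu_O V M)"

definition zhu_class ::
    "('v::ab_group_add) voa \<Rightarrow> ('v, 'm::ab_group_add, 'z) vmod_scheme \<Rightarrow> 'm \<Rightarrow> 'm set"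
  where "zhu_class V M m = zhu_O V M +>\<^bsub>subspace_mod (scl M) UNIV\<^esub> m"

definition zhu_F ::
    "('v::ab_group_add) voa \<Rightarrow> ('v, 'm::ab_group_add, 'z) vmod_scheme \<Rightarrow> int \<Rightarrow> 'm set set"
  where "zhu_F V M p = zhu_class V M ` module.span (scl M) (\<Union>q\<in>{..p}. deg M q)"

definition gr_comp :: "('v::ab_group_add) voa \<Rightarrow> ('v, 'm::ab_group_add, 'z) vmod_scheme \<Rightarrow> int \<Rightarrow>
    (complex, 'm set set) module"
  where "gr_comp V M p = quot_mod ((zhu_A V M)\<lparr>carrier := zhu_F V M p\<rparr>) (zhu_F V M (p - 1))"

text \<open>The class in \<open>gr\<^sup>p\<close> of a vector whose class in the Zhu algebra or bimodule lies in \<open>F\<^sup>p\<close>.\<close>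

definition gr_class :: "('v::ab_group_add) voa \<Rightarrow> ('v, 'm::ab_group_add, 'z) vmod_scheme \<Rightarrow> int \<Rightarrow>
    'm \<Rightarrow> 'm set set"
  where "gr_class V M p m = zhu_F V M (p - 1) +>\<^bsub>zhu_A V M\<^esub> zhu_class V M m"

text \<open>The brackets have to be computed on representatives in \<open>V\<^sup>p\<close> and \<open>M\<^sup>q\<close> (not in the whole of
  \<open>F\<^sup>p\<close> and \<open>F\<^sup>q\<close>): the sign \<open>(-1)\<^sup>p\<^sup>q\<close> is wrong for lower terms of the other parity.\<close>

definition gr_mod :: "('v::ab_group_add) voa \<Rightarrow> ('v, 'm::ab_group_add) vmod \<Rightarrow>
    ('v set set, 'm set set) pmod"
  where "gr_mod V M =
    \<lparr>gcomp = gr_comp V M,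
     gdiff = (\<lambda>p. descend (deg M p) (gr_class V M p) (\<lambda>m. gr_class V M (p + 1) (dif M m))),
     gact = (\<lambda>p q. descend2 (deg V p) (gr_class V V p) (deg M q) (gr_class V M q)
       (\<lambda>u m. gr_class V M (p + q) (star_l V M u m))),
     gbrk = (\<lambda>p q. descend2 (deg V p) (gr_class V V p) (deg M q) (gr_class V M q)
       (\<lambda>u m. gr_class V M (p + q - 2)
         (star_l V M u m - scl M ((-1) powi (p * q)) (star_r V M m u))))\<rparr>"

definition gr_alg :: "('v::ab_group_add) voa \<Rightarrow> 'v set set palg"
  where "gr_alg V =
    \<lparr>gcomp = gr_comp V V,
     gdiff = (\<lambda>p. descend (deg V p) (gr_class V V p) (\<lambda>v. gr_class V V (p + 1) (dif V v))),
     gact = (\<lambda>p q. descend2 (deg V p) (gr_class V V p) (deg V q) (gr_class V V q)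
       (\<lambda>u v. gr_class V V (p + q) (star_l V V u v))),
     gbrk = (\<lambda>p q. descend2 (deg V p) (gr_class V V p) (deg V q) (gr_class V V q)
       (\<lambda>u v. gr_class V V (p + q - 2)
         (star_l V V u v - scl V ((-1) powi (p * q)) (star_l V V v u)))),
     gunit = gr_class V V 0 (vac V)\<rparr>"

definition gr_map :: "('v::ab_group_add) voa \<Rightarrow> ('v, 'm::ab_group_add) vmod \<Rightarrow>
    ('v, 'n::ab_group_add) vmod \<Rightarrow> ('m \<Rightarrow> 'n) \<Rightarrow> int \<Rightarrow> 'm set set \<Rightarrow> 'n set set"
  where "gr_map V M N f p = descend (deg M p) (gr_class V M p) (\<lambda>m. gr_class V N p (f m))"


section \<open>The functor \<open>\<eta>\<^sub>F\<close> and the transformation \<open>\<psi>\<close>\<close>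

definition eta :: "('v::ab_group_add) voa \<Rightarrow> int \<Rightarrow> 'v set \<Rightarrow> 'v set set"
  where "eta V p = descend (deg V p) (R_class V p) (gr_class V V p)"

definition ker_eta :: "('v::ab_group_add) voa \<Rightarrow> int \<Rightarrow> 'v set set"
  where "ker_eta V p = {a \<in> carrier (R_comp V p). eta V p a = \<zero>\<^bsub>gr_comp V V p\<^esub>}"

definition ker_eta_mult ::
    "('v::ab_group_add) voa \<Rightarrow> ('v set, 'w) pmod \<Rightarrow> int \<Rightarrow> 'w set"
  where "ker_eta_mult V W p = mod_span (gcomp W p)
    {gact W q (p - q) a w | q a w. a \<in> ker_eta V q \<and> w \<in> carrier (gcomp W (p - q))}"

definition eta_class :: "('v::ab_group_add) voa \<Rightarrow> ('v set, 'w) pmod \<Rightarrow> int \<Rightarrow> 'w \<Rightarrow> 'w set"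
  where "eta_class V W p w = ker_eta_mult V W p +>\<^bsub>gcomp W p\<^esub> w"

text \<open>\<open>W / (Ker \<eta>)W\<close> as a dg Poisson module over \<open>R(V)\<close>.\<close>

definition eta_quot :: "('v::ab_group_add) voa \<Rightarrow> ('v set, 'w) pmod \<Rightarrow> ('v set, 'w set) pmod"
  where "eta_quot V W =
    \<lparr>gcomp = (\<lambda>p. quot_mod (gcomp W p) (ker_eta_mult V W p)),
     gdiff = (\<lambda>p. descend (carrier (gcomp W p)) (eta_class V W p)
       (\<lambda>w. eta_class V W (p + 1) (gdiff W p w))),
     gact = (\<lambda>p q a. descend (carrier (gcomp W q)) (eta_class V W q)
       (\<lambda>w. eta_class V W (p + q) (gact W p q a w))),
     gbrk = (\<lambda>p q a. descend (carrier (gcomp W q)) (eta_class V W q)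
       (\<lambda>w. eta_class V W (p + q - 2) (gbrk W p q a w)))\<rparr>"

text \<open>\<open>W / (Ker \<eta>)W\<close> over the graded algebra of the Zhu algebra, both operations being descended
  along the surjection \<open>\<eta>\<close>.  The action always descends, because \<open>Ker \<eta>\<close> acts by zero.  The
  bracket descends exactly if \<open>Ker \<eta>\<close> has zero bracket with \<open>W / (Ker \<eta>)W\<close>, which is the
  condition \<open>bracket_descends\<close>; in general \<open>\<eta>\<close>-equal elements of \<open>R(V)\<close> can have different
  brackets, and the bracket is then only available over \<open>R(V)\<close>.\<close>

definition eta_fun :: "('v::ab_group_add) voa \<Rightarrow> ('v set, 'w) pmod \<Rightarrow> ('v set set, 'w set) pmod"
  where "eta_fun V W =
    \<lparr>gcomp = gcomp (eta_quot V W),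
     gdiff = gdiff (eta_quot V W),
     gact = (\<lambda>p q b y. descend (carrier (R_comp V p)) (eta V p)
       (\<lambda>a. gact (eta_quot V W) p q a y) b),
     gbrk = (\<lambda>p q b y. descend (carrier (R_comp V p)) (eta V p)
       (\<lambda>a. gbrk (eta_quot V W) p q a y) b)\<rparr>"

definition bracket_descends :: "('v::ab_group_add) voa \<Rightarrow> ('v set, 'w) pmod \<Rightarrow> bool"
  where "bracket_descends V W \<longleftrightarrow>
    (\<forall>p q. \<forall>a\<in>ker_eta V p. \<forall>y\<in>carrier (gcomp (eta_quot V W) q).
      gbrk (eta_quot V W) p q a y = \<zero>\<^bsub>gcomp (eta_quot V W) (p + q - 2)\<^esub>)"

definition eta_fun_map :: "('v::ab_group_add) voa \<Rightarrow> ('v set, 'w) pmod \<Rightarrow> ('v set, 'x) pmod \<Rightarrow>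
    (int \<Rightarrow> 'w \<Rightarrow> 'x) \<Rightarrow> int \<Rightarrow> 'w set \<Rightarrow> 'x set"
  where "eta_fun_map V W X g p =
    descend (carrier (gcomp W p)) (eta_class V W p) (\<lambda>w. eta_class V X p (g p w))"

definition restrict_eta ::
    "('v::ab_group_add) voa \<Rightarrow> ('v set set, 'w) pmod \<Rightarrow> ('v set, 'w) pmod"
  where "restrict_eta V W =
    \<lparr>gcomp = gcomp W, gdiff = gdiff W,
     gact = (\<lambda>p q a. gact W p q (eta V p a)), gbrk = (\<lambda>p q a. gbrk W p q (eta V p a))\<rparr>"

definition etaR :: "('v::ab_group_add) voa \<Rightarrow> ('v, 'm::ab_group_add) vmod \<Rightarrow>
    ('v set set, 'm set set) pmod"
  where "etaR V M = eta_fun V (R_mod V M)"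

definition etaR_map :: "('v::ab_group_add) voa \<Rightarrow> ('v, 'm::ab_group_add) vmod \<Rightarrow>
    ('v, 'n::ab_group_add) vmod \<Rightarrow> ('m \<Rightarrow> 'n) \<Rightarrow> int \<Rightarrow> 'm set set \<Rightarrow> 'n set set"
  where "etaR_map V M N f = eta_fun_map V (R_mod V M) (R_mod V N) (R_map M N f)"

definition etaR_class :: "('v::ab_group_add) voa \<Rightarrow> ('v, 'm::ab_group_add) vmod \<Rightarrow> int \<Rightarrow> 'm \<Rightarrow>
    'm set set"
  where "etaR_class V M p m = eta_class V (R_mod V M) p (R_class M p m)"

definition psi :: "('v::ab_group_add) voa \<Rightarrow> ('v, 'm::ab_group_add) vmod \<Rightarrow> int \<Rightarrow>
    'm set set \<Rightarrow> 'm set set"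
  where "psi V M p = descend (deg M p) (etaR_class V M p) (gr_class V M p)"

end

theory Submission
  imports Defs "HOL-Computational_Algebra.Formal_Power_Series"
begin

text \<open>All spaces in the theorem are spaces of classes of vectors of \<open>M\<close>: the component of degree \<open>p\<close>
of \<open>R(M)\<close>, of \<open>gr A(M)\<close> and of \<open>R(M) / (Ker \<eta>) R(M)\<close> is \<open>M\<^sup>p\<close> modulo a subspace, which is
\<open>C\<^sub>2(M) \<inter> M\<^sup>p\<close>, respectively \<open>gr_kernel p\<close> (the vectors of \<open>M\<^sup>p\<close> in \<open>O(M)\<close> plus lower degrees),
respectively \<open>eta_kernel p\<close>.  In each of them the differential, the action and the bracket of the
classes of \<open>u\<close> and \<open>m\<close> are the classes of \<open>d m\<close>, \<open>u\<^sub>-\<^sub>1 m\<close> and \<open>u\<^sub>0 m\<close>: the degree of \<open>u\<^sub>n m\<close> falls by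
two when \<open>n\<close> grows by one, so in \<open>u *\<^sub>l m\<close> and in the Zhu commutator only the first term survives
in the associated graded space.  Therefore \<open>\<psi>\<close> is induced by the identity of \<open>M\<close>, and it is a
surjective morphism as soon as everything is well defined and \<open>eta_kernel p \<subseteq> gr_kernel p\<close>.

The axioms of a dg Poisson algebra and of its dg Poisson modules are congruences modulo
\<open>C\<^sub>2\<close> between \<open>u\<^sub>-\<^sub>1\<close>, \<open>u\<^sub>0\<close> and \<open>d\<close>, which follow from the Jacobi identity and skew-symmetry
(\<open>iterate_mod_C2\<close>, \<open>commutator_zero_mode\<close>, \<open>skew_C2\<close>).  All the kernels contain \<open>C\<^sub>2\<close>, so the
axioms are proved once, in the locales \<open>realization\<close> and \<open>poisson_realization\<close>, for an arbitrary
algebra and module of classes, and then hold in all the cases at hand.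

The deep part is that the operations descend to \<open>gr A(M)\<close>.  A vector of \<open>V\<^sup>p\<close> whose class vanishes
there differs from an inhomogeneous element of \<open>O(V)\<close> by lower terms, so this needs the full
theorems of Zhu and of Frenkel and Zhu: \<open>O(V) * M\<close>, \<open>V * O(M)\<close> and the corresponding commutators
lie in \<open>O(M)\<close> (\<open>wser_O_left\<close>, \<open>wser_O_right\<close>).  These four inclusions are instances of the
single identity \<open>binomial_jacobi\<close>, the Jacobi identity multiplied by the coefficients of
\<open>(1 + x)\<^sup>s (1 + y)\<^sup>t\<close> and summed, together with the fact that residues of
\<open>x\<^sup>-\<^sup>2\<^sup>-\<^sup>j (1 + x)\<^sup>r Y(u, x) m\<close> lie in \<open>O(M)\<close> if \<open>u\<close> has weight \<open>r\<close> (\<open>ser_mem_O\<close>).  For the bracket of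
\<open>gr A(V)\<close>, which is written with left multiplications only, \<open>star_l_commutator\<close> shows
that \<open>u * v - (-1)\<^sup>p\<^sup>q v * u\<close> still has the class of \<open>u\<^sub>0 v\<close>.\<close>

section \<open>Sums of finite support\<close>

lemma Sum_any_additive:
  fixes h :: "'a::comm_monoid_add \<Rightarrow> 'b::comm_monoid_add"
  assumes "h 0 = 0" "\<And>x y. h (x + y) = h x + h y" "finite {i. f i \<noteq> 0}"
  shows "h (Sum_any f) = Sum_any (\<lambda>i. h (f i))"
proof -
  have "h (sum f A) = sum (\<lambda>i. h (f i)) A" if "finite A" for A
    using that by (induction A) (auto simp: assms)
  moreover have "Sum_any (\<lambda>i. h (f i)) = sum (\<lambda>i. h (f i)) {i. f i \<noteq> 0}"
    by (rule Sum_any.expand_superset) (use assms in auto)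
  ultimately show ?thesis
    using assms(3) by (simp add: Sum_any.expand_set)
qed

lemma Sum_any_mem:
  assumes "0 \<in> U" "\<And>x y. x \<in> U \<Longrightarrow> y \<in> U \<Longrightarrow> x + y \<in> U" "\<And>i. f i \<in> U"
  shows "Sum_any f \<in> (U :: 'a::comm_monoid_add set)"
proof -
  have "sum f A \<in> U" if "finite A" for A
    using that by (induction A) (auto simp: assms)
  then show ?thesis
    by (cases "finite {i. f i \<noteq> 0}") (auto simp: Sum_any.expand_set assms(1))
qed

lemma Sum_any_single:
  assumes "\<And>i. i \<noteq> j \<Longrightarrow> f i = 0"
  shows "Sum_any f = f j"
proof -
  have "Sum_any f = sum f {j}"
    by (rule Sum_any.expand_superset) (use assms in auto)
  then show ?thesis by simp
qed

lemma Sum_any_nat_Suc: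
  fixes f :: "nat \<Rightarrow> 'a::comm_monoid_add"
  assumes "finite {n. f n \<noteq> 0}"
  shows "Sum_any f = f 0 + Sum_any (\<lambda>n. f (Suc n))"
proof -
  obtain N where N: "{n. f n \<noteq> 0} \<subseteq> {..N}"
    using assms unfolding finite_nat_set_iff_bounded_le by auto
  have "Sum_any f = sum f {..Suc N}"
    by (rule Sum_any.expand_superset) (use N in auto)
  also have "\<dots> = f 0 + (\<Sum>n\<le>N. f (Suc n))"
    by (rule sum.atMost_Suc_shift)
  also have "(\<Sum>n\<le>N. f (Suc n)) = Sum_any (\<lambda>n. f (Suc n))"
    by (rule sym, rule Sum_any.expand_superset) (use N in auto)
  finally show ?thesis .
qed

lemma finite_nat_support:
  assumes "\<And>n. n \<ge> N \<Longrightarrow> f n = 0"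
  shows "finite {n::nat. f n \<noteq> 0}"
  by (rule finite_subset[of _ "{..<N}"]) (use assms not_less in auto)


section \<open>Components in a direct sum\<close>

locale complex_space = vector_space s for s :: "complex \<Rightarrow> 'b::ab_group_add \<Rightarrow> 'b"
begin

lemma decomposition_component:
  assumes "direct_sum s I W"
  shows "decomposition I W x (\<lambda>i. component I W i x)"
proof -
  have "\<exists>!f. decomposition I W x f"
    using assms by (simp add: direct_sum_def)
  then show ?thesis
    unfolding component_def by (rule theI')
qed

lemma component_unique:
  assumes "direct_sum s I W" "decomposition I W x f"
  shows "component I W i x = f i"
proof -
  have "\<exists>!f. decomposition I W x f"
    using assms by (simp add: direct_sum_def)
  with assms(2) decomposition_component[OF assms(1)] have "(\<lambda>i. component I W i x) = f"
    by blast
  then show ?thesis by meson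
qed

lemma component_mem: "direct_sum s I W \<Longrightarrow> i \<in> I \<Longrightarrow> component I W i x \<in> W i"
  using decomposition_component by (fastforce simp: decomposition_def)

lemma component_outside: "direct_sum s I W \<Longrightarrow> i \<notin> I \<Longrightarrow> component I W i x = 0"
  using decomposition_component by (fastforce simp: decomposition_def)

lemma component_finite: "direct_sum s I W \<Longrightarrow> finite {i. component I W i x \<noteq> 0}"
  using decomposition_component by (fastforce simp: decomposition_def)

lemma component_sum: "direct_sum s I W \<Longrightarrow> Sum_any (\<lambda>i. component I W i x) = x"
  using decomposition_component by (fastforce simp: decomposition_def)

lemma component_homogeneous:
  assumes "direct_sum s I W" "i \<in> I" "x \<in> W i"
  shows "component I W j x = (if j = i then x else 0)"
proof (rule component_unique[OF assms(1)])
  have "finite {j. (if j = i then x else 0) \<noteq> 0}"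
    by (rule finite_subset[of _ "{i}"]) auto
  moreover have "\<forall>j\<in>I. 0 \<in> W j"
    using assms(1) by (simp add: direct_sum_def subspace_0)
  ultimately show "decomposition I W x (\<lambda>j. if j = i then x else 0)"
    using assms by (auto simp: decomposition_def)
qed

lemma component_additive_map:
  assumes ds: "direct_sum s I W"
    and h: "\<And>x y. h (x + y) = h x + h y" "\<And>i x. i \<in> I \<Longrightarrow> x \<in> W i \<Longrightarrow> h x \<in> W i"
  shows "component I W i (h x) = h (component I W i x)"
proof (rule component_unique[OF ds])
  have h0: "h 0 = 0"
    using h(1)[of 0 0] by simp
  have fin: "finite {i. component I W i x \<noteq> 0}"
    by (rule component_finite[OF ds])
  have "h x = Sum_any (\<lambda>i. h (component I W i x))"
    using Sum_any_additive[of h, OF h0 h(1) fin] by (simp add: component_sum[OF ds])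
  moreover have "finite {i. h (component I W i x) \<noteq> 0}"
    by (rule finite_subset[OF _ fin]) (auto simp: h0)
  ultimately show "decomposition I W (h x) (\<lambda>i. h (component I W i x))"
    by (auto simp: decomposition_def h h0 component_mem[OF ds] component_outside[OF ds])
qed

lemma component_add:
  assumes ds: "direct_sum s I W"
  shows "component I W i (x + y) = component I W i x + component I W i y"
proof (rule component_unique[OF ds])
  have fin: "finite {i. component I W i x \<noteq> 0}" "finite {i. component I W i y \<noteq> 0}"
    by (rule component_finite[OF ds])+
  have "finite {i. component I W i x + component I W i y \<noteq> 0}"
    by (rule finite_subset[OF _ finite_UnI[OF fin]]) auto
  moreover have "x + y = Sum_any (\<lambda>i. component I W i x + component I W i y)"
    using fin by (simp add: Sum_any.distrib component_sum[OF ds])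
  moreover have "\<forall>i\<in>I. component I W i x + component I W i y \<in> W i"
    using ds component_mem[OF ds] by (simp add: direct_sum_def subspace_add)
  ultimately show "decomposition I W (x + y) (\<lambda>i. component I W i x + component I W i y)"
    by (auto simp: decomposition_def component_outside[OF ds])
qed

lemma component_scale:
  assumes ds: "direct_sum s I W"
  shows "component I W i (s a x) = s a (component I W i x)"
  by (rule component_additive_map[OF ds])
    (use ds in \<open>auto simp: scale_right_distrib direct_sum_def subspace_scale\<close>)

lemma direct_sum_induct:
  assumes ds: "direct_sum s I W" and U: "subspace U" and "\<And>i. i \<in> I \<Longrightarrow> W i \<subseteq> U"
  shows "x \<in> U"
proof -
  have "component I W i x \<in> U" for i
    by (cases "i \<in> I") (use assms component_mem[OF ds] component_outside[OF ds] subspace_0 in auto)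
  then have "Sum_any (\<lambda>i. component I W i x) \<in> U"
    by (intro Sum_any_mem) (use U subspace_0 subspace_add in auto)
  then show ?thesis
    by (simp add: component_sum[OF ds])
qed

end


section \<open>Presentations of quotient spaces\<close>

text \<open>The classes that occur are cosets, cosets of cosets, and cosets of images.  To treat them alike, a
space \<open>X\<close> is described by the map \<open>c\<close> from representatives in \<open>U\<close> to classes, and by the kernel
\<open>K\<close> of this map.\<close>

definition presents ::
    "(complex \<Rightarrow> 'a::ab_group_add \<Rightarrow> 'a) \<Rightarrow> 'a set \<Rightarrow> 'a set \<Rightarrow> (complex, 'x) module \<Rightarrow>
      ('a \<Rightarrow> 'x) \<Rightarrow> bool"
  where "presents s U K X c \<longleftrightarrow>
    vector_space s \<and> module.subspace s U \<and> K \<subseteq> U \<and> module CC X \<and> carrier X = c ` U \<and>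
    (\<forall>x\<in>U. \<forall>y\<in>U. c x \<oplus>\<^bsub>X\<^esub> c y = c (x + y)) \<and>
    (\<forall>a. \<forall>x\<in>U. a \<odot>\<^bsub>X\<^esub> c x = c (s a x)) \<and>
    (\<forall>x\<in>U. c x = \<zero>\<^bsub>X\<^esub> \<longleftrightarrow> x \<in> K)"

lemma cring_CC: "cring CC"
proof (rule cringI)
  show "abelian_group CC"
  proof (rule abelian_groupI)
    show "\<exists>y\<in>carrier CC. y \<oplus>\<^bsub>CC\<^esub> x = \<zero>\<^bsub>CC\<^esub>" for x
      by (rule bexI[of _ "- x"]) (simp_all add: CC_def)
  qed (simp_all add: CC_def)
  show "comm_monoid CC"
    by (rule comm_monoidI) (simp_all add: CC_def)
qed (simp add: CC_def distrib_right)

lemma presentsI: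
  assumes vs: "vector_space s" and U: "module.subspace s U" and "K \<subseteq> U"
    and car: "carrier X = c ` U"
    and add: "\<And>x y. x \<in> U \<Longrightarrow> y \<in> U \<Longrightarrow> c x \<oplus>\<^bsub>X\<^esub> c y = c (x + y)"
    and smult: "\<And>a x. x \<in> U \<Longrightarrow> a \<odot>\<^bsub>X\<^esub> c x = c (s a x)"
    and zero: "\<zero>\<^bsub>X\<^esub> = c 0"
    and ker: "\<And>x. x \<in> U \<Longrightarrow> c x = c 0 \<longleftrightarrow> x \<in> K"
  shows "presents s U K X c"
proof -
  interpret vs: vector_space s by (rule vs)
  note U' = vs.subspace_0[OF U] vs.subspace_add[OF U] vs.subspace_scale[OF U] vs.subspace_neg[OF U]
  have ab: "abelian_group X"
  proof (rule abelian_groupI)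
    show "\<exists>y\<in>carrier X. y \<oplus>\<^bsub>X\<^esub> x = \<zero>\<^bsub>X\<^esub>" if "x \<in> carrier X" for x
    proof -
      from that obtain u where u: "u \<in> U" "x = c u"
        unfolding car by auto
      have "c (- u) \<oplus>\<^bsub>X\<^esub> x = \<zero>\<^bsub>X\<^esub>"
        using add[of "- u" u] u U' by (simp add: zero)
      then show ?thesis
        using u U' unfolding car by blast
    qed
    show "x \<oplus>\<^bsub>X\<^esub> y \<oplus>\<^bsub>X\<^esub> z = x \<oplus>\<^bsub>X\<^esub> (y \<oplus>\<^bsub>X\<^esub> z)"
      if "x \<in> carrier X" "y \<in> carrier X" "z \<in> carrier X" for x y z
      using that by (auto simp: car add U' add.assoc)
    show "x \<oplus>\<^bsub>X\<^esub> y = y \<oplus>\<^bsub>X\<^esub> x" if "x \<in> carrier X" "y \<in> carrier X" for x y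
      using that by (auto simp: car add add.commute)
  qed (auto simp: car add zero U')
  have "module CC X"
    by (rule moduleI[OF cring_CC ab])
      (auto simp: car smult add U' CC_def vs.scale_left_distrib vs.scale_right_distrib)
  then show ?thesis
    using assms by (auto simp: presents_def)
qed

lemma presents_module: "presents s U K X c \<Longrightarrow> module CC X"
  by (simp add: presents_def)

lemma presents_carrier: "presents s U K X c \<Longrightarrow> carrier X = c ` U"
  by (simp add: presents_def)

lemma presents_add:
  "presents s U K X c \<Longrightarrow> x \<in> U \<Longrightarrow> y \<in> U \<Longrightarrow> c x \<oplus>\<^bsub>X\<^esub> c y = c (x + y)"
  by (simp add: presents_def)

lemma presents_scale: "presents s U K X c \<Longrightarrow> x \<in> U \<Longrightarrow> a \<odot>\<^bsub>X\<^esub> c x = c (s a x)"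
  by (simp add: presents_def)

lemma presents_ker: "presents s U K X c \<Longrightarrow> x \<in> U \<Longrightarrow> c x = \<zero>\<^bsub>X\<^esub> \<longleftrightarrow> x \<in> K"
  by (simp add: presents_def)

lemma presents_zero:
  assumes P: "presents s U K X c"
  shows "c 0 = \<zero>\<^bsub>X\<^esub>"
proof -
  interpret vs: vector_space s using P by (simp add: presents_def)
  interpret M: module CC X by (rule presents_module[OF P])
  have U: "0 \<in> U" using P by (simp add: presents_def vs.subspace_0)
  have "\<zero>\<^bsub>CC\<^esub> \<odot>\<^bsub>X\<^esub> c 0 = \<zero>\<^bsub>X\<^esub>"
    using U presents_carrier[OF P] by (intro M.smult_l_null) auto
  then show ?thesis
    using presents_scale[OF P U] by (simp add: CC_def)
qed

lemma presents_minus: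
  assumes P: "presents s U K X c" and x: "x \<in> U" "y \<in> U"
  shows "c x \<ominus>\<^bsub>X\<^esub> c y = c (x - y)"
proof -
  interpret vs: vector_space s using P by (simp add: presents_def)
  interpret M: module CC X by (rule presents_module[OF P])
  have U: "vs.subspace U" using P by (simp add: presents_def)
  have m: "- y \<in> U" using x(2) by (rule vs.subspace_neg[OF U])
  have "c (- y) \<oplus>\<^bsub>X\<^esub> c y = \<zero>\<^bsub>X\<^esub>"
    using presents_add[OF P m x(2)] presents_zero[OF P] by simp
  then have "\<ominus>\<^bsub>X\<^esub> c y = c (- y)"
    using M.minus_equality presents_carrier[OF P] x m by blast
  then show ?thesis
    using presents_add[OF P x(1) m] by (simp add: a_minus_def)
qed

lemma presents_eq:
  assumes P: "presents s U K X c" and x: "x \<in> U" "y \<in> U"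
  shows "c x = c y \<longleftrightarrow> x - y \<in> K"
proof -
  interpret vs: vector_space s using P by (simp add: presents_def)
  interpret M: module CC X by (rule presents_module[OF P])
  have d: "x - y \<in> U"
    using P x by (simp add: presents_def vs.subspace_diff)
  have "c x = c (x - y) \<oplus>\<^bsub>X\<^esub> c y"
    using presents_add[OF P d x(2)] by simp
  then have "c x = c y \<longleftrightarrow> c (x - y) = \<zero>\<^bsub>X\<^esub>"
    using x d presents_carrier[OF P] M.add.r_cancel_one[of "c y" "c (x - y)"] by auto
  then show ?thesis
    using presents_ker[OF P d] by simp
qed

lemma presents_kernel_subspace:
  assumes P: "presents s U K X c"
  shows "module.subspace s K"
proof -
  interpret vs: vector_space s using P by (simp add: presents_def)
  interpret M: module CC X by (rule presents_module[OF P])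
  have U: "vs.subspace U" and KU: "K \<subseteq> U" using P by (auto simp: presents_def)
  have ker: "x \<in> K \<longleftrightarrow> x \<in> U \<and> c x = \<zero>\<^bsub>X\<^esub>" for x
    using KU presents_ker[OF P] by blast
  show ?thesis
  proof (rule vs.subspaceI)
    show "0 \<in> K"
      by (simp add: ker vs.subspace_0[OF U] presents_zero[OF P])
    show "x + y \<in> K" if "x \<in> K" "y \<in> K" for x y
      using that by (simp add: ker vs.subspace_add[OF U] flip: presents_add[OF P])
    show "s a x \<in> K" if "x \<in> K" for a x
      using that M.smult_r_null[of a] by (simp add: ker vs.subspace_scale[OF U] CC_def
        flip: presents_scale[OF P])
  qed
qed

lemma presents_subspace:
  assumes "vector_space s" "module.subspace s U"
  shows "presents s U {0} (subspace_mod s U) (\<lambda>x. x)"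
proof -
  interpret vs: vector_space s by fact
  show ?thesis
    using assms by (intro presentsI) (auto simp: subspace_mod_def vs.subspace_0)
qed

text \<open>Forming a further quotient only enlarges the kernel: the coset of \<open>c x\<close> is the set of the classes
of all vectors of \<open>x + L\<close>, so the operations on cosets can be computed on representatives.\<close>

lemma presents_quot:
  assumes P: "presents s U K X c" and L: "module.subspace s L" "K \<subseteq> L" "L \<subseteq> U" and S: "S = c ` L"
  shows "presents s U L (quot_mod X S) (\<lambda>x. S +>\<^bsub>X\<^esub> c x)"
proof -
  interpret vs: vector_space s using P by (simp add: presents_def)
  have U: "vs.subspace U" using P by (simp add: presents_def)
  note U' = vs.subspace_0[OF U] vs.subspace_add[OF U] vs.subspace_scale[OF U] vs.subspace_diff[OF U]
  note L' = vs.subspace_0[OF L(1)] vs.subspace_add[OF L(1)] vs.subspace_scale[OF L(1)]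
    vs.subspace_diff[OF L(1)]
  have coset: "S +>\<^bsub>X\<^esub> c x = c ` {y \<in> U. y - x \<in> L}" if x: "x \<in> U" for x
  proof -
    have "S +>\<^bsub>X\<^esub> c x = (\<lambda>l. c (l + x)) ` L"
      using x L(3) by (auto simp: a_r_coset_def r_coset_def S presents_add[OF P] subset_iff)
    also have "\<dots> = c ` (\<lambda>l. l + x) ` L"
      by (simp add: image_image)
    also have "(\<lambda>l. l + x) ` L = {y \<in> U. y - x \<in> L}"
    proof (intro equalityI subsetI)
      fix y assume "y \<in> {y \<in> U. y - x \<in> L}"
      then show "y \<in> (\<lambda>l. l + x) ` L"
        by (intro image_eqI[of _ _ "y - x"]) auto
    qed (use x L(3) U' in auto)
    finally show ?thesis .
  qed
  have cos_eq: "S +>\<^bsub>X\<^esub> c x = S +>\<^bsub>X\<^esub> c y \<longleftrightarrow> x - y \<in> L" if x: "x \<in> U" "y \<in> U" for x y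
  proof
    assume "S +>\<^bsub>X\<^esub> c x = S +>\<^bsub>X\<^esub> c y"
    moreover have "c x \<in> S +>\<^bsub>X\<^esub> c x"
      using x L' by (auto simp: coset)
    ultimately obtain z where z: "z \<in> U" "z - y \<in> L" "c x = c z"
      using x by (auto simp: coset)
    then have "x - z \<in> L"
      using presents_eq[OF P x(1) z(1)] L(2) by blast
    then show "x - y \<in> L"
      using L'(2)[OF _ z(2)] by fastforce
  next
    assume xy: "x - y \<in> L"
    have "z - x \<in> L \<longleftrightarrow> z - y \<in> L" for z
      using L'(2)[OF _ xy, of "z - x"] L'(4)[OF _ xy, of "z - y"] by auto
    then show "S +>\<^bsub>X\<^esub> c x = S +>\<^bsub>X\<^esub> c y"
      using x by (simp add: coset)
  qed
  show ?thesis
  proof (rule presentsI)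
    show "carrier (quot_mod X S) = (\<lambda>x. S +>\<^bsub>X\<^esub> c x) ` U"
      by (auto simp: quot_mod_def A_RCOSETS_def RCOSETS_def a_r_coset_def presents_carrier[OF P])
    show "(S +>\<^bsub>X\<^esub> c x) \<oplus>\<^bsub>quot_mod X S\<^esub> (S +>\<^bsub>X\<^esub> c y) = S +>\<^bsub>X\<^esub> c (x + y)"
      if x: "x \<in> U" "y \<in> U" for x y
    proof -
      have "(S +>\<^bsub>X\<^esub> c x) \<oplus>\<^bsub>quot_mod X S\<^esub> (S +>\<^bsub>X\<^esub> c y)
          = {a \<oplus>\<^bsub>X\<^esub> b | a b. a \<in> S +>\<^bsub>X\<^esub> c x \<and> b \<in> S +>\<^bsub>X\<^esub> c y}"
        by (auto simp: quot_mod_def set_add_def set_mult_def)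
      also have "\<dots> = {c a \<oplus>\<^bsub>X\<^esub> c b | a b. a \<in> U \<and> b \<in> U \<and> a - x \<in> L \<and> b - y \<in> L}"
        unfolding coset[OF x(1)] coset[OF x(2)] by blast
      also have "\<dots> = {c (a + b) | a b. a \<in> U \<and> b \<in> U \<and> a - x \<in> L \<and> b - y \<in> L}"
        using presents_add[OF P] by (intro Collect_cong) metis
      also have "\<dots> = c ` {z \<in> U. z - (x + y) \<in> L}"
      proof (intro equalityI subsetI)
        fix w assume "w \<in> {c (a + b) | a b. a \<in> U \<and> b \<in> U \<and> a - x \<in> L \<and> b - y \<in> L}"
        then obtain a b where ab: "w = c (a + b)" "a \<in> U" "b \<in> U" "a - x \<in> L" "b - y \<in> L"
          by auto
        then have "(a + b) - (x + y) \<in> L"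
          using L'(2)[OF ab(4,5)] by (simp add: algebra_simps)
        then show "w \<in> c ` {z \<in> U. z - (x + y) \<in> L}"
          using ab U' by blast
      next
        fix w assume "w \<in> c ` {z \<in> U. z - (x + y) \<in> L}"
        then obtain z where z: "w = c z" "z \<in> U" "z - (x + y) \<in> L" by auto
        have "w = c ((z - y) + y)" "z - y \<in> U" "(z - y) - x \<in> L" "y - y \<in> L"
          using z x U' L' by (auto simp: algebra_simps)
        then show "w \<in> {c (a + b) | a b. a \<in> U \<and> b \<in> U \<and> a - x \<in> L \<and> b - y \<in> L}"
          using x by blast
      qed
      finally show ?thesis
        using x U' by (simp add: coset)
    qed
    show "a \<odot>\<^bsub>quot_mod X S\<^esub> (S +>\<^bsub>X\<^esub> c x) = S +>\<^bsub>X\<^esub> c (s a x)" if x: "x \<in> U" for a x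
    proof -
      have "a \<odot>\<^bsub>quot_mod X S\<^esub> (S +>\<^bsub>X\<^esub> c x) = (\<Union>y\<in>{y \<in> U. y - x \<in> L}. S +>\<^bsub>X\<^esub> c (s a y))"
        using x by (simp add: quot_mod_def coset presents_scale[OF P])
      also have "\<dots> = (\<Union>y\<in>{y \<in> U. y - x \<in> L}. S +>\<^bsub>X\<^esub> c (s a x))"
        using x U' L'(3)
        by (intro SUP_cong refl) (auto simp: cos_eq simp flip: vs.scale_right_diff_distrib)
      also have "\<dots> = S +>\<^bsub>X\<^esub> c (s a x)"
        using x L' by auto
      finally show ?thesis .
    qed
    show "\<zero>\<^bsub>quot_mod X S\<^esub> = S +>\<^bsub>X\<^esub> c 0"
    proof -
      have "{y \<in> U. y - 0 \<in> L} = L"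
        using L(3) by auto
      then have "S +>\<^bsub>X\<^esub> c 0 = S"
        by (subst coset[OF U'(1)]) (simp only: S)
      then show ?thesis
        by (simp add: quot_mod_def)
    qed
  qed (use U L U' cos_eq vs.vector_space_axioms in auto)
qed

lemma presents_subspace_of_carrier:
  assumes P: "presents s U K X c" and U': "module.subspace s U'" "U' \<subseteq> U"
  shows "presents s U' (K \<inter> U') (X\<lparr>carrier := c ` U'\<rparr>) c"
proof -
  interpret vs: vector_space s using P by (simp add: presents_def)
  show ?thesis
    using U' vs.subspace_0[OF U'(1)] presents_ker[OF P]
      presents_add[OF P] presents_scale[OF P]
    by (intro presentsI) (auto simp: vs.vector_space_axioms presents_zero[OF P] subset_iff)
qed

text \<open>A class in \<open>F\<^sup>p / F\<^sup>p\<^sup>-\<^sup>1\<close> comes from a vector of degree at most \<open>p\<close>, but its component of degree \<open>p\<close>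
represents it as well.\<close>

lemma presents_fewer_representatives:
  assumes P: "presents s U K X c" and U': "module.subspace s U'" "U' \<subseteq> U"
    and ex: "\<And>x. x \<in> U \<Longrightarrow> \<exists>y\<in>U'. x - y \<in> K"
  shows "presents s U' (K \<inter> U') X c"
proof -
  have "c ` U = c ` U'"
    using ex U' presents_eq[OF P] by (fastforce simp: image_iff subset_iff)
  then show ?thesis
    using P U' by (auto simp: presents_def subset_iff)
qed

lemma descend_eq:
  assumes "x \<in> S" "\<And>y. y \<in> S \<Longrightarrow> c y = c x \<Longrightarrow> h y = h x"
  shows "descend S c h (c x) = h x"
  unfolding descend_def by (rule the_equality) (use assms in metis)+

lemma descend2_eq:
  assumes "x \<in> S" "y \<in> T"
    "\<And>x' y'. x' \<in> S \<Longrightarrow> y' \<in> T \<Longrightarrow> c x' = c x \<Longrightarrow> e y' = e y \<Longrightarrow> h x' y' = h x y"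
  shows "descend2 S c T e h (c x) (e y) = h x y"
  unfolding descend2_def by (rule the_equality) (use assms in metis)+


section \<open>Modes of a weak dg module\<close>

locale dgvoa =
  fixes V :: "('v::ab_group_add) voa"
  assumes voa: "dg_vertex_operator_algebra V"

locale dgvoa_module = dgvoa V
  for V :: "('v::ab_group_add) voa" +
  fixes M :: "('v, 'm::ab_group_add, 'z) vmod_scheme"
  assumes weak: "weak_dg_module V M"

lemma (in dgvoa) weak_self: "weak_dg_module V V"
  using voa by (simp add: dg_vertex_operator_algebra_def dg_vertex_algebra_def)

sublocale dgvoa \<subseteq> V: complex_space "scl V"
  using weak_self by (simp add: weak_dg_module_def is_complex_def complex_space_def)

sublocale dgvoa_module \<subseteq> M: complex_space "scl M"
  using weak by (simp add: weak_dg_module_def is_complex_def complex_space_def)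

sublocale dgvoa \<subseteq> self: dgvoa_module V V
  by (unfold_locales) (rule weak_self)

context dgvoa_module
begin

lemma deg_sum: "direct_sum (scl M) UNIV (deg M)"
  using weak by (simp add: weak_dg_module_def is_complex_def)

lemma deg_subspace: "M.subspace (deg M p)"
  using deg_sum by (simp add: direct_sum_def)

lemma dif_linear: "Vector_Spaces.linear (scl M) (scl M) (dif M)"
  using weak by (simp add: weak_dg_module_def is_complex_def)

lemma dif_add: "dif M (x + y) = dif M x + dif M y"
  and dif_scale: "dif M (scl M a x) = scl M a (dif M x)"
  using dif_linear by (simp_all add: Vector_Spaces.linear_iff)

lemma dif_deg: "m \<in> deg M p \<Longrightarrow> dif M m \<in> deg M (p + 1)"
  using weak by (simp add: weak_dg_module_def is_complex_def)

lemma dif_dif: "dif M (dif M m) = 0"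
  using weak by (simp add: weak_dg_module_def is_complex_def)

lemma mode_add_left: "mode M (u + v) n m = mode M u n m + mode M v n m"
  and mode_scale_left: "mode M (scl V a u) n m = scl M a (mode M u n m)"
  using weak by (simp_all add: weak_dg_module_def Vector_Spaces.linear_iff)

lemma mode_add_right: "mode M u n (x + y) = mode M u n x + mode M u n y"
  and mode_scale_right: "mode M u n (scl M a x) = scl M a (mode M u n x)"
  using weak by (simp_all add: weak_dg_module_def Vector_Spaces.linear_iff)

lemma mode_zero_left [simp]: "mode M 0 n m = 0"
  using mode_add_left[of 0 0 n m] by simp

lemma mode_zero_right [simp]: "mode M u n 0 = 0"
  using mode_add_right[of u n 0 0] by simp

lemma mode_diff_left: "mode M (u - v) n m = mode M u n m - mode M v n m"
  using mode_add_left[of "u - v" v n m] by (simp add: algebra_simps)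

lemma mode_diff_right: "mode M u n (x - y) = mode M u n x - mode M u n y"
  using mode_add_right[of u n "x - y" y] by (simp add: algebra_simps)

lemma mode_deg: "u \<in> deg V p \<Longrightarrow> m \<in> deg M q \<Longrightarrow> mode M u n m \<in> deg M (q + (p - 2 * n - 2))"
  using weak by (simp add: weak_dg_module_def)

lemma dif_mode:
  assumes "u \<in> deg V p"
  shows "dif M (mode M u n m)
    = mode M (dif V u) n m + scl M ((-1) powi p) (mode M u n (dif M m))"
proof -
  have "mode M (dif V u) n m
      = dif M (mode M u n m) - scl M ((-1) powi p) (mode M u n (dif M m))"
    using weak assms by (simp add: weak_dg_module_def)
  then show ?thesis by simp
qed

text \<open>Every operator sum below is finite because of this; the shift \<open>k\<close> and the natural index are
the form in which the sums are written.\<close>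

lemma mode_bounded:
  obtains N :: nat where "\<And>n. n \<ge> N \<Longrightarrow> mode M u (k + int n) m = 0"
proof -
  obtain N where N: "\<forall>n\<ge>N. mode M u n m = 0"
    using weak by (fastforce simp: weak_dg_module_def)
  show thesis
    by (rule that[of "nat (N - k)"]) (use N in auto)
qed

lemma vac_mode: "mode M (vac V) n m = (if n = -1 then m else 0)"
  using weak by (simp add: weak_dg_module_def)

lemma jacobi:
  assumes "u \<in> deg V p" "v \<in> deg V q"
  shows "Sum_any (\<lambda>i::nat. scl M ((-1) ^ i * ((of_int l :: complex) gchoose i))
        (mode M u (m + l - int i) (mode M v (n + int i) w)
          - scl M ((-1) powi l * (-1) powi (p * q))
              (mode M v (n + l - int i) (mode M u (m + int i) w))))
      = Sum_any (\<lambda>i::nat. scl M ((of_int m :: complex) gchoose i)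
          (mode M (mode V u (l + int i) v) (m + n - int i) w))"
  using weak assms by (simp add: weak_dg_module_def jacobi_identity_def)

text \<open>The case \<open>l = 0\<close> of the Jacobi identity.\<close>

lemma commutator:
  assumes "u \<in> deg V p" "v \<in> deg V q"
  shows "mode M u m (mode M v n w)
      - scl M ((-1) powi (p * q)) (mode M v n (mode M u m w))
    = Sum_any (\<lambda>i::nat. scl M ((of_int m :: complex) gchoose i)
          (mode M (mode V u (int i) v) (m + n - int i) w))"
proof -
  have "(0::complex) gchoose i = 0" if "i \<noteq> 0" for i
    using that by (cases i) auto
  then show ?thesis
    using jacobi[OF assms, of 0 m n w] by (subst (asm) Sum_any_single[of 0]) auto
qed

text \<open>The case \<open>m = 0\<close> of the Jacobi identity.\<close>

lemma iterate:
  assumes "u \<in> deg V p" "v \<in> deg V q"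
  shows "mode M (mode V u l v) n w
    = Sum_any (\<lambda>i::nat. scl M ((-1) ^ i * ((of_int l :: complex) gchoose i))
        (mode M u (l - int i) (mode M v (n + int i) w)
          - scl M ((-1) powi l * (-1) powi (p * q))
              (mode M v (n + l - int i) (mode M u (int i) w))))"
proof -
  have "(0::complex) gchoose i = 0" if "i \<noteq> 0" for i
    using that by (cases i) auto
  then show ?thesis
    using jacobi[OF assms, of l 0 n w] by (subst (asm) (2) Sum_any_single[of 0]) auto
qed

end


section \<open>Residues against binomial series\<close>

text \<open>\<open>ser s k u m\<close> is the residue of \<open>x\<^sup>k (1 + x)\<^sup>s Y(u, x) m\<close>.\<close>

definition ser :: "('v, 'm::ab_group_add, 'z) vmod_scheme \<Rightarrow> complex \<Rightarrow> int \<Rightarrow> 'v \<Rightarrow> 'm \<Rightarrow> 'm"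
  where "ser M s k u m = Sum_any (\<lambda>n::nat. scl M (s gchoose n) (mode M u (k + int n) m))"

lemma Sum_any_box:
  fixes F :: "nat \<Rightarrow> 'a::comm_monoid_add"
  assumes "\<And>i. N \<le> i \<Longrightarrow> F i = 0"
  shows "Sum_any F = sum F {..<N}"
  by (rule Sum_any.expand_superset) (use assms not_le in auto)

text \<open>Sums over finite supports may be exchanged if one box contains the supports of all the
iterated sums.\<close>

lemma Sum_any_rotate:
  fixes F :: "nat \<Rightarrow> nat \<Rightarrow> nat \<Rightarrow> 'a::comm_monoid_add"
  assumes "\<And>i n m. N \<le> i \<or> N \<le> n \<or> N \<le> m \<Longrightarrow> F i n m = 0"
  shows "Sum_any (\<lambda>m. Sum_any (\<lambda>n. Sum_any (\<lambda>i. F i n m)))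
    = Sum_any (\<lambda>i. Sum_any (\<lambda>n. Sum_any (\<lambda>m. F i n m)))"
proof -
  have "Sum_any (\<lambda>m. Sum_any (\<lambda>n. Sum_any (\<lambda>i. F i n m)))
      = (\<Sum>m<N. \<Sum>n<N. \<Sum>i<N. F i n m)"
    using assms by (simp add: Sum_any_box[of N])
  also have "\<dots> = (\<Sum>m<N. \<Sum>i<N. \<Sum>n<N. F i n m)"
    by (rule sum.cong[OF refl], rule sum.swap)
  also have "\<dots> = (\<Sum>i<N. \<Sum>m<N. \<Sum>n<N. F i n m)"
    by (rule sum.swap)
  also have "\<dots> = (\<Sum>i<N. \<Sum>n<N. \<Sum>m<N. F i n m)"
    by (rule sum.cong[OF refl], rule sum.swap)
  also have "\<dots> = Sum_any (\<lambda>i. Sum_any (\<lambda>n. Sum_any (\<lambda>m. F i n m)))"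
    using assms by (simp add: Sum_any_box[of N])
  finally show ?thesis .
qed

text \<open>Each side of the Jacobi identity vanishes for large indices only with a bound that depends on the
indices chosen before, which is still enough to find a common box.\<close>

lemma box_bound:
  assumes "\<And>i n m. I \<le> i \<Longrightarrow> F i n m = 0" "\<And>i. \<exists>N. \<forall>n\<ge>N. \<forall>m. F i n m = 0"
    "\<And>i n. \<exists>N. \<forall>m\<ge>N. F i n m = 0"
  obtains N :: nat
  where "\<And>i n m::nat. N \<le> i \<or> N \<le> n \<or> N \<le> m \<Longrightarrow> F i n m = (0::'a::zero)"
proof -
  obtain B where B: "\<And>i n m. n \<ge> B i \<Longrightarrow> F i n m = 0"
    using assms(2) by metis
  obtain C where C: "\<And>i n m. m \<ge> C i n \<Longrightarrow> F i n m = 0"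
    using assms(3) by metis
  \<comment> \<open>The bounds that can occur inside the support; there are only finitely many of them.\<close>
  define S where "S = {I} \<union> B ` {..<I} \<union> (\<Union>i<I. C i ` {..<B i})"
  have fin: "finite S"
    by (auto simp: S_def)
  show thesis
  proof (rule that[of "Max S"])
    fix i n m assume *: "Max S \<le> i \<or> Max S \<le> n \<or> Max S \<le> m"
    show "F i n m = 0"
    proof (rule ccontr)
      assume nz: "F i n m \<noteq> 0"
      then have "i < I" "n < B i" "m < C i n"
        using assms(1) B C by (meson not_le)+
      moreover from this have "I \<in> S" "B i \<in> S" "C i n \<in> S"
        by (auto simp: S_def)
      ultimately show False
        using * Max_ge[OF fin] by (meson leD le_less_trans less_le_trans)
    qed
  qed
qed

context dgvoa_module
begin

lemma M_Sum_any_scale: "scl M a (Sum_any f) = Sum_any (\<lambda>i. scl M a (f i))"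
proof (cases "a = 0 \<or> infinite {i. f i \<noteq> 0}")
  case True
  then show ?thesis
    by (cases "a = 0") simp_all
next
  case False
  then show ?thesis
    by (intro Sum_any_additive) (auto simp: M.scale_right_distrib)
qed

lemma ser_support: "finite {n. scl M (c n) (mode M u (k + int n) m) \<noteq> 0}"
proof -
  obtain N :: nat where "\<And>n. n \<ge> N \<Longrightarrow> mode M u (k + int n) m = 0"
    using mode_bounded[of u k m] by metis
  then show ?thesis
    by (intro finite_nat_support) auto
qed

lemma ser_add_left: "ser M s k (u + v) m = ser M s k u m + ser M s k v m"
  using Sum_any.distrib[OF ser_support ser_support, of _ u k m _ v k m]
  by (simp add: ser_def mode_add_left M.scale_right_distrib)

lemma ser_add_right: "ser M s k u (x + y) = ser M s k u x + ser M s k u y"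
  using Sum_any.distrib[OF ser_support ser_support, of _ u k x _ u k y]
  by (simp add: ser_def mode_add_right M.scale_right_distrib)

lemma ser_scale_left: "ser M s k (scl V a u) m = scl M a (ser M s k u m)"
  by (simp add: ser_def mode_scale_left M_Sum_any_scale mult.commute)

lemma ser_scale_right: "ser M s k u (scl M a m) = scl M a (ser M s k u m)"
  by (simp add: ser_def mode_scale_right M_Sum_any_scale mult.commute)

lemma ser_zero_left [simp]: "ser M s k 0 m = 0"
  using ser_add_left[of s k 0 0 m] by simp

lemma ser_zero_right [simp]: "ser M s k u 0 = 0"
  using ser_add_right[of s k u 0 0] by simp

lemma ser_Sum_any_left:
  "finite {i. f i \<noteq> 0} \<Longrightarrow> ser M s k (Sum_any f) m = Sum_any (\<lambda>i. ser M s k (f i) m)"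
  by (rule Sum_any_additive) (auto simp: ser_add_left)

lemma ser_Sum_any_right:
  "finite {i. f i \<noteq> 0} \<Longrightarrow> ser M s k u (Sum_any f) = Sum_any (\<lambda>i. ser M s k u (f i))"
  by (rule Sum_any_additive) (auto simp: ser_add_right)

text \<open>The first term has the highest cohomological degree; this is why only it matters in the
associated graded spaces.\<close>

lemma ser_eq_leading:
  "ser M s k u m = mode M u k m + Sum_any (\<lambda>n. scl M (s gchoose Suc n) (mode M u (k + 1 + int n) m))"
  unfolding ser_def by (subst Sum_any_nat_Suc[OF ser_support]) (simp add: add.assoc)

text \<open>The identity \<open>(1 + x)\<^sup>s\<^sup>+\<^sup>1 = (1 + x)\<^sup>s + x (1 + x)\<^sup>s\<close>, under the residue.\<close>

lemma ser_pascal: "ser M (s + 1) k u m = ser M s k u m + ser M s (k + 1) u m"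
proof -
  have "ser M (s + 1) k u m = mode M u k m
      + Sum_any (\<lambda>n. scl M (s gchoose n) (mode M u (k + 1 + int n) m)
          + scl M (s gchoose Suc n) (mode M u (k + 1 + int n) m))"
    by (simp add: ser_eq_leading gbinomial_Suc_Suc M.scale_left_distrib)
  also have "\<dots> = ser M s k u m + ser M s (k + 1) u m"
    by (subst Sum_any.distrib[OF ser_support ser_support])
      (simp add: ser_eq_leading[of s k] ser_def[of M s "k + 1"])
  finally show ?thesis .
qed

text \<open>The product of binomial series \<open>(1 + x)\<^sup>s (1 + x)\<^sup>t = (1 + x)\<^sup>s\<^sup>+\<^sup>t\<close>, under the residue.\<close>

lemma ser_vandermonde:
  "Sum_any (\<lambda>n::nat. scl M (t gchoose n) (ser M s (k + int n) u m)) = ser M (s + t) k u m"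
proof -
  obtain N :: nat where N: "\<And>n. n \<ge> N \<Longrightarrow> mode M u (k + int n) m = 0"
    using mode_bounded[of u k m] by metis
  define f where "f n j = scl M ((t gchoose n) * (s gchoose j)) (mode M u (k + int (n + j)) m)"
    for n j :: nat
  have f0: "f n j = 0" if "N \<le> n + j" for n j
    using N[OF that] by (simp add: f_def)
  have inner: "scl M (t gchoose n) (ser M s (k + int n) u m) = (\<Sum>j<N. f n j)" for n
  proof -
    have "scl M (t gchoose n) (ser M s (k + int n) u m)
        = Sum_any (\<lambda>j. scl M (t gchoose n) (scl M (s gchoose j) (mode M u (k + int n + int j) m)))"
      unfolding ser_def by (rule M_Sum_any_scale)
    also have "\<dots> = Sum_any (f n)"
      by (simp add: f_def add.assoc)
    finally have "scl M (t gchoose n) (ser M s (k + int n) u m) = Sum_any (f n)" .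
    then show ?thesis
      using f0 by (simp add: Sum_any_box[of N])
  qed
  have "Sum_any (\<lambda>n::nat. scl M (t gchoose n) (ser M s (k + int n) u m)) = (\<Sum>n<N. \<Sum>j<N. f n j)"
    unfolding inner by (rule Sum_any_box) (simp add: f0)
  also have "\<dots> = (\<Sum>(n, j)\<in>{..<N} \<times> {..<N}. f n j)"
    by (rule sum.cartesian_product)
  also have "\<dots> = (\<Sum>(n, j)\<in>{(n, j). n + j < N}. f n j)"
    by (rule sum.mono_neutral_right) (use f0 in \<open>auto simp: not_less\<close>, (meson f0 not_le)?)
  also have "\<dots> = (\<Sum>r<N. \<Sum>n\<le>r. f n (r - n))"
    by (rule sum.triangle_reindex)
  also have "\<dots> = (\<Sum>r<N. scl M ((s + t) gchoose r) (mode M u (k + int r) m))"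
  proof (rule sum.cong[OF refl])
    fix r
    have "(\<Sum>n\<le>r. f n (r - n))
        = scl M (\<Sum>n\<le>r. (t gchoose n) * (s gchoose (r - n))) (mode M u (k + int r) m)"
      by (simp add: M.scale_sum_left f_def)
    also have "(\<Sum>n\<le>r. (t gchoose n) * (s gchoose (r - n))) = (s + t) gchoose r"
      using gbinomial_Vandermonde[of t s r] by (simp add: atLeast0AtMost add.commute)
    finally show "(\<Sum>n\<le>r. f n (r - n)) = scl M ((s + t) gchoose r) (mode M u (k + int r) m)" .
  qed
  also have "\<dots> = ser M (s + t) k u m"
    unfolding ser_def by (rule sym, rule Sum_any_box) (simp add: N)
  finally show ?thesis .
qed

text \<open>The divided derivative \<open>(d/dx)\<^sup>i / i!\<close> of \<open>(1 + x)\<^sup>s\<close> is \<open>C(s, i) (1 + x)\<^sup>s\<^sup>-\<^sup>i\<close>.  It arises from expanding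
\<open>(1 + y + z)\<^sup>s\<close> in powers of \<open>z\<close>.\<close>

lemma ser_divided_derivative:
  "Sum_any (\<lambda>m::nat. scl M ((s gchoose m) * (of_nat m gchoose i)) (mode M u (k + int m - int i) w))
    = scl M (s gchoose i) (ser M (s - of_nat i) k u w)"
proof -
  define g where
    "g m = scl M ((s gchoose m) * (of_nat m gchoose i)) (mode M u (k + int m - int i) w)" for m
  obtain N :: nat where N: "\<And>n. n \<ge> N \<Longrightarrow> mode M u (k - int i + int n) w = 0"
    using mode_bounded[of u "k - int i" w] by metis
  have g0: "g m = 0" if "m < i \<or> N + i \<le> m" for m
    using that
  proof
    assume "m < i"
    then have "(of_nat m :: complex) gchoose i = 0"
      by (simp flip: binomial_gbinomial)
    then show ?thesis by (simp add: g_def)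
  next
    assume "N + i \<le> m"
    then show ?thesis
      using N[of m] by (simp add: g_def algebra_simps)
  qed
  have "Sum_any g = sum g {i..<N + i}"
    by (rule Sum_any.expand_superset) (auto, (meson g0 not_le)+)
  also have "\<dots> = (\<Sum>n<N. g (n + i))"
    using sum.shift_bounds_nat_ivl[of g 0 i N] by (simp add: atLeast0LessThan)
  also have "\<dots> = (\<Sum>n<N. scl M (s gchoose i) (scl M ((s - of_nat i) gchoose n) (mode M u (k + int n) w)))"
  proof (rule sum.cong[OF refl])
    fix n
    have idx: "k + int (n + i) - int i = k + int n"
      by simp
    show "g (n + i)
        = scl M (s gchoose i) (scl M ((s - of_nat i) gchoose n) (mode M u (k + int n) w))"
      unfolding g_def idx using gbinomial_trinomial_revision[of i "n + i" s] by simp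
  qed
  also have "\<dots> = Sum_any (\<lambda>n. scl M (s gchoose i) (scl M ((s - of_nat i) gchoose n) (mode M u (k + int n) w)))"
  proof (rule sym, rule Sum_any_box)
    fix n assume "N \<le> n"
    then have "mode M u (k + int n) w = 0"
      using N[of "n + i"] by (simp add: algebra_simps)
    then show "scl M (s gchoose i) (scl M ((s - of_nat i) gchoose n) (mode M u (k + int n) w)) = 0"
      by simp
  qed
  also have "\<dots> = scl M (s gchoose i) (ser M (s - of_nat i) k u w)"
    unfolding ser_def by (rule M_Sum_any_scale[symmetric])
  finally show ?thesis
    by (simp add: g_def)
qed

lemma nested_modes_box:
  obtains N :: nat where "\<And>i n m. N \<le> i \<or> N \<le> n \<or> N \<le> m \<Longrightarrow>
    mode M u (l - int i + int m) (mode M v (k + int i + int n) w) = 0"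
proof -
  let ?X = "\<lambda>i n m. mode M u (l - int i + int m) (mode M v (k + int i + int n) w)"
  obtain I :: nat where "\<And>i. i \<ge> I \<Longrightarrow> mode M v (k + int i) w = 0"
    using mode_bounded[of v k w] by metis
  from this[of "i + n" for i n] have I: "?X i n m = 0" if "I \<le> i + n" for i n m
    using that by (simp add: add.assoc)
  show thesis
  proof (rule box_bound[of I ?X])
    show "\<exists>N. \<forall>n\<ge>N. \<forall>m. ?X i n m = 0" for i
      using I by (meson trans_le_add2)
    show "\<exists>N. \<forall>m\<ge>N. ?X i n m = 0" for i n
      using mode_bounded[of u "l - int i" "mode M v (k + int i + int n) w"] by metis
  qed (use that I in \<open>auto intro: I\<close>)
qed

text \<open>The Jacobi identity for \<open>m\<close> and \<open>k + n\<close>, multiplied by \<open>C(s, m) C(t, n)\<close> and summed over all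
\<open>m, n \<ge> 0\<close>.  In generating functions it is the residue of the three-term identity for \<open>Y(u, x)\<close>,
\<open>Y(v, y)\<close> against \<open>(x - y)\<^sup>l (1 + x)\<^sup>s y\<^sup>k (1 + y)\<^sup>t\<close>.  On the left \<open>(1 + x)\<^sup>s\<close> with \<open>x = y + z\<close> becomes
a sum of \<open>z\<^sup>i (1 + y)\<^sup>s\<^sup>-\<^sup>i\<close>, so if \<open>s\<close> and \<open>t\<close> are the weights of \<open>u\<close> and \<open>v\<close> up to a constant, then the
exponent there is the weight of \<open>u\<^sub>l\<^sub>+\<^sub>i v\<close> up to a constant.\<close>

proposition binomial_jacobi:
  assumes uv: "u \<in> deg V p" "v \<in> deg V q"
  shows "Sum_any (\<lambda>i::nat. scl M (s gchoose i)
      (ser M (s - of_nat i + t) k (mode V u (l + int i) v) w))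
    = Sum_any (\<lambda>i::nat. scl M ((-1) ^ i * ((of_int l :: complex) gchoose i))
        (ser M s (l - int i) u (ser M t (k + int i) v w)
          - scl M ((-1) powi l * (-1) powi (p * q))
              (ser M t (k + l - int i) v (ser M s (int i) u w))))"
proof -
  define e where "e = ((-1) powi l * (-1) powi (p * q) :: complex)"
  define c where "c i = ((-1) ^ i * ((of_int l :: complex) gchoose i))" for i :: nat
  define T where "T i n m = scl M ((s gchoose m) * (t gchoose n)) (scl M (of_nat m gchoose i)
      (mode M (mode V u (l + int i) v) (k + int n + int m - int i) w))" for i n m :: nat
  define X where "X i n m = scl M ((s gchoose m) * (t gchoose n)) (scl M (c i)
      (mode M u (l - int i + int m) (mode M v (k + int i + int n) w)))" for i n m :: nat
  define Y where "Y i m n = scl M ((s gchoose m) * (t gchoose n)) (scl M (c i * e)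
      (mode M v (k + l - int i + int n) (mode M u (int i + int m) w)))" for i n m :: nat

  obtain NT where NT: "\<And>i n m. NT \<le> i \<or> NT \<le> n \<or> NT \<le> m \<Longrightarrow> T i n m = 0"
  proof -
    obtain I :: nat where I: "\<And>i. i \<ge> I \<Longrightarrow> mode V u (l + int i) v = 0"
      using self.mode_bounded[of u l v] by metis
    have *: "\<exists>N. \<forall>n m. N \<le> n + m \<longrightarrow> T i n m = 0" for i
    proof -
      obtain N where "\<And>n. n \<ge> N \<Longrightarrow> mode M (mode V u (l + int i) v) (k - int i + int n) w = 0"
        using mode_bounded[of "mode V u (l + int i) v" "k - int i" w] by metis
      from this[of "n + m" for n m] have "\<forall>n m. N \<le> n + m \<longrightarrow> T i n m = 0"
        by (simp add: T_def algebra_simps)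
      then show ?thesis ..
    qed
    show thesis
    proof (rule box_bound[of I T])
      show "T i n m = 0" if "I \<le> i" for i n m
        using I[OF that] by (simp add: T_def)
      show "\<exists>N. \<forall>n\<ge>N. \<forall>m. T i n m = 0" for i
        using *[of i] by (meson trans_le_add1)
      show "\<exists>N. \<forall>m\<ge>N. T i n m = 0" for i n
        using *[of i] by (meson trans_le_add2)
    qed (use that in blast)
  qed
  obtain NX :: nat where NX: "\<And>i n m. NX \<le> i \<or> NX \<le> n \<or> NX \<le> m \<Longrightarrow> X i n m = 0"
    using nested_modes_box[of u l v k w] unfolding X_def by (metis M.scale_zero_right)
  obtain NY :: nat where NY: "\<And>i m n. NY \<le> i \<or> NY \<le> m \<or> NY \<le> n \<Longrightarrow> Y i m n = 0"
    using nested_modes_box[of v "k + l" u 0 w] unfolding Y_def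
    by (metis M.scale_zero_right add_0)
  define N where "N = Max {NT, NX, NY}"
  have N: "NT \<le> N" "NX \<le> N" "NY \<le> N"
    by (auto simp: N_def)
  have T0: "T i n m = 0" and X0: "X i n m = 0" and Y0: "Y i m n = 0"
    if "N \<le> i \<or> N \<le> n \<or> N \<le> m" for i n m
    using that N NT[of i n m] NX[of i n m] NY[of i m n] by (meson order_trans)+

  have jac: "Sum_any (\<lambda>i. X i n m - Y i m n) = Sum_any (\<lambda>i. T i n m)" for n m
    using arg_cong[OF jacobi[OF uv, of l "int m" "k + int n" w],
        of "scl M ((s gchoose m) * (t gchoose n))"]
    by (simp add: M_Sum_any_scale X_def Y_def T_def c_def e_def M.scale_right_diff_distrib
        algebra_simps)

  have T: "Sum_any (\<lambda>n. Sum_any (\<lambda>m. T i n m))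
      = scl M (s gchoose i) (ser M (s - of_nat i + t) k (mode V u (l + int i) v) w)" for i
  proof -
    let ?z = "mode V u (l + int i) v"
    have "Sum_any (\<lambda>m. T i n m)
        = scl M (s gchoose i) (scl M (t gchoose n) (ser M (s - of_nat i) (k + int n) ?z w))" for n
    proof -
      have "Sum_any (\<lambda>m. T i n m) = scl M (t gchoose n) (Sum_any (\<lambda>m.
          scl M ((s gchoose m) * (of_nat m gchoose i)) (mode M ?z (k + int n + int m - int i) w)))"
        by (simp add: M_Sum_any_scale T_def ac_simps)
      then show ?thesis
        by (simp add: ser_divided_derivative mult.commute)
    qed
    then show ?thesis
      by (simp add: M_Sum_any_scale flip: ser_vandermonde[of t "s - of_nat i"])
  qed
  have X: "Sum_any (\<lambda>n. Sum_any (\<lambda>m. X i n m))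
      = scl M (c i) (ser M s (l - int i) u (ser M t (k + int i) v w))" for i
  proof -
    have "Sum_any (\<lambda>m. X i n m) = scl M (c i)
        (ser M s (l - int i) u (scl M (t gchoose n) (mode M v (k + int i + int n) w)))" for n
      by (simp add: ser_def M_Sum_any_scale X_def mode_scale_right mult_ac)
    then show ?thesis
      by (simp add: ser_Sum_any_right[OF ser_support] ser_def[of M t] flip: M_Sum_any_scale)
  qed
  have Y: "Sum_any (\<lambda>m. Sum_any (\<lambda>n. Y i m n))
      = scl M (c i * e) (ser M t (k + l - int i) v (ser M s (int i) u w))" for i
  proof -
    have "Sum_any (\<lambda>n. Y i m n) = scl M (c i * e)
        (ser M t (k + l - int i) v (scl M (s gchoose m) (mode M u (int i + int m) w)))" for m
      by (simp add: ser_def M_Sum_any_scale Y_def mode_scale_right mult_ac)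
    then show ?thesis
      by (simp add: ser_Sum_any_right[OF ser_support] ser_def[of M s] flip: M_Sum_any_scale)
  qed

  have "Sum_any (\<lambda>i. scl M (s gchoose i) (ser M (s - of_nat i + t) k (mode V u (l + int i) v) w))
      = Sum_any (\<lambda>m. Sum_any (\<lambda>n. Sum_any (\<lambda>i. T i n m)))"
    unfolding T[symmetric] by (rule Sum_any_rotate[symmetric]) (rule T0)
  also have "\<dots> = Sum_any (\<lambda>i. Sum_any (\<lambda>n. Sum_any (\<lambda>m. X i n m - Y i m n)))"
    unfolding jac[symmetric] by (rule Sum_any_rotate[of N]) (use X0 Y0 in auto)
  also have "\<dots> = Sum_any (\<lambda>i. Sum_any (\<lambda>n. Sum_any (\<lambda>m. X i n m))
      - Sum_any (\<lambda>m. Sum_any (\<lambda>n. Y i m n)))"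
  proof (rule Sum_any.cong)
    fix i
    have "Sum_any (\<lambda>n. Sum_any (\<lambda>m. X i n m - Y i m n)) = (\<Sum>n<N. \<Sum>m<N. X i n m - Y i m n)"
      using X0 Y0 by (simp add: Sum_any_box[of N])
    also have "\<dots> = (\<Sum>n<N. \<Sum>m<N. X i n m) - (\<Sum>m<N. \<Sum>n<N. Y i m n)"
      using sum.swap[of "\<lambda>m n. Y i m n" "{..<N}" "{..<N}"] by (simp add: sum_subtractf)
    also have "\<dots> = Sum_any (\<lambda>n. Sum_any (\<lambda>m. X i n m)) - Sum_any (\<lambda>m. Sum_any (\<lambda>n. Y i m n))"
      using X0 Y0 by (simp add: Sum_any_box[of N])
    finally show "Sum_any (\<lambda>n. Sum_any (\<lambda>m. X i n m - Y i m n))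
      = Sum_any (\<lambda>n. Sum_any (\<lambda>m. X i n m)) - Sum_any (\<lambda>m. Sum_any (\<lambda>n. Y i m n))" .
  qed
  finally show ?thesis
    by (simp add: X Y c_def e_def M.scale_right_diff_distrib)
qed

end


section \<open>Weights\<close>

lemma sign_square [simp]: "((-1) powi n * (-1) powi n :: complex) = 1"
  by (simp add: power_int_minus_left)

lemma (in dgvoa) vac_deg: "vac V \<in> deg V 0"
  using voa by (simp add: dg_vertex_operator_algebra_def dg_vertex_algebra_def)

context dgvoa_module
begin

lemma vac_mode_sum:
  fixes f :: "nat \<Rightarrow> complex"
  shows "Sum_any (\<lambda>i::nat. scl M (f i) (mode M (vac V) (n - int i) (h i)))
    = (if n \<ge> -1 then scl M (f (nat (n + 1))) (h (nat (n + 1))) else 0)"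
proof -
  have "Sum_any (\<lambda>i::nat. scl M (f i) (mode M (vac V) (n - int i) (h i)))
      = Sum_any (\<lambda>i::nat. if i = nat (n + 1) then
          if n \<ge> -1 then scl M (f i) (h i) else 0 else 0)"
    by (rule Sum_any.cong) (auto simp: vac_mode)
  then show ?thesis by simp
qed

text \<open>The operator \<open>L(-1)\<close> acts on fields by differentiation: in the iterate formula for \<open>u\<^sub>-\<^sub>2 1\<close> every mode
of the vacuum but one vanishes.\<close>

lemma translation_mode:
  "mode M (mode V u (-2) (vac V)) n w = scl M (- of_int n) (mode M u (n - 1) w)"
proof -
  have "u \<in> {u. mode M (mode V u (-2) (vac V)) n w = scl M (- of_int n) (mode M u (n - 1) w)}"
  proof (rule V.direct_sum_induct[OF self.deg_sum])
    show "V.subspace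
        {u. mode M (mode V u (-2) (vac V)) n w = scl M (- of_int n) (mode M u (n - 1) w)}"
      by (rule V.subspaceI)
        (auto simp: mode_add_left self.mode_add_left mode_scale_left self.mode_scale_left
          M.scale_right_distrib mult.commute)
  next
    fix p
    show "deg V p
      \<subseteq> {u. mode M (mode V u (-2) (vac V)) n w = scl M (- of_int n) (mode M u (n - 1) w)}"
    proof safe
      fix u assume u: "u \<in> deg V p"
      have c: "(-1) ^ i * ((-2 :: complex) gchoose i) = of_nat (Suc i)" for i
      proof -
        have "(-2 :: complex) gchoose i = (-1) ^ i * ((of_nat i + 1) gchoose i)"
          by (subst gbinomial_negated_upper) simp
        moreover have "(of_nat i + 1 :: complex) gchoose i = of_nat (Suc i)"
          using binomial_gbinomial[of "Suc i" i, where ?'a = complex] by (simp add: add.commute)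
        ultimately show ?thesis
          by (simp flip: power_add mult.assoc mult_2)
      qed
      have it: "mode M (mode V u (-2) (vac V)) n w
        = Sum_any (\<lambda>i::nat. scl M (of_nat (Suc i))
            (mode M u (-2 - int i) (mode M (vac V) (n + int i) w)
              - mode M (vac V) (n - 2 - int i) (mode M u (int i) w)))"
        using iterate[OF u vac_deg, of "-2" n w] unfolding of_int_minus of_int_numeral c
        by (simp add: power_int_minus_left)
      show "mode M (mode V u (-2) (vac V)) n w = scl M (- of_int n) (mode M u (n - 1) w)"
      proof (cases "n \<ge> 0")
        case True
        then have "mode M (vac V) (n + int i) w = 0" for i
          by (simp add: vac_mode)
        then have "mode M (mode V u (-2) (vac V)) n w = Sum_any (\<lambda>i::nat.
            scl M (- of_nat (Suc i)) (mode M (vac V) (n - 2 - int i) (mode M u (int i) w)))"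
          unfolding it
          by (intro Sum_any.cong) (simp add: M.scale_left_diff_distrib M.scale_left_distrib)
        also have "\<dots> = scl M (- of_int n) (mode M u (n - 1) w)"
          unfolding vac_mode_sum using True by auto
        finally show ?thesis .
      next
        case False
        have "mode M (mode V u (-2) (vac V)) n w = Sum_any (\<lambda>i::nat.
            if i = nat (-1 - n) then scl M (- of_int n) (mode M u (n - 1) w) else 0)"
          unfolding it by (rule Sum_any.cong) (use False in \<open>auto simp: vac_mode\<close>)
        then show ?thesis by simp
      qed
    qed
  qed
  then show ?thesis by simp
qed

end

context dgvoa
begin

lemma creation_nonneg: "n \<ge> 0 \<Longrightarrow> mode V v n (vac V) = 0"
  and creation: "mode V v (-1) (vac V) = v"
  using voa by (simp_all add: dg_vertex_operator_algebra_def dg_vertex_algebra_def)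

lemma conf_deg: "conf V \<in> deg V 4" and conf_dif: "dif V (conf V) = 0"
  using voa by (simp_all add: dg_vertex_operator_algebra_def)

lemma wt_sum: "direct_sum (scl V) half_ints (wt_space V)"
  using voa by (simp add: dg_vertex_operator_algebra_def)

lemma translation: "mode V (conf V) 0 v = mode V v (-2) (vac V)"
proof -
  have "vir V (-1) v = mode V v (-2) (vac V)"
    using voa by (simp add: dg_vertex_operator_algebra_def)
  then show ?thesis by (simp add: vir_def)
qed

lemma wt_space_iff: "v \<in> wt_space V r \<longleftrightarrow> mode V (conf V) 1 v = scl V (of_real r) v"
  by (simp add: wt_space_def vir_def)

lemma wt_subspace: "V.subspace (wt_space V r)"
  by (rule V.subspaceI)
    (auto simp: wt_space_iff self.mode_add_right self.mode_scale_right V.scale_right_distrib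
      mult.commute)

lemma wt_translation: "u \<in> wt_space V r \<Longrightarrow> mode V u (-2) (vac V) \<in> wt_space V (r + 1)"
proof -
  assume u: "u \<in> wt_space V r"
  obtain c :: complex where "\<And>m n v. vir V m (vir V n v) - vir V n (vir V m v)
        = scl V (of_int (m - n)) (vir V (m + n) v)
          + (if m + n = 0 then scl V (of_int (m ^ 3 - m) / 12 * c) v else 0)"
    using voa unfolding dg_vertex_operator_algebra_def by blast
  from this[of 0 "-1" u]
  have "mode V (conf V) 1 (mode V (conf V) 0 u) - mode V (conf V) 0 (mode V (conf V) 1 u)
      = mode V (conf V) 0 u"
    by (simp add: vir_def)
  with u show ?thesis
    by (simp add: wt_space_iff self.mode_scale_right translation V.scale_left_distrib
        algebra_simps)
qed

lemma half_ints_add_int: "r \<in> half_ints \<Longrightarrow> r + of_int n \<in> half_ints"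
  by (auto simp: half_ints_def distrib_left)

lemma half_ints_add: "r \<in> half_ints \<Longrightarrow> t \<in> half_ints \<Longrightarrow> r + t \<in> half_ints"
  by (auto simp: half_ints_def distrib_left)

text \<open>The commutator of \<open>L(0) = \<omega>\<^sub>1\<close> with \<open>u\<^sub>n\<close> is \<open>(L(-1) u)\<^sub>n\<^sub>+\<^sub>1 + (L(0) u)\<^sub>n = (r - n - 1) u\<^sub>n\<close>.\<close>

lemma wt_mode:
  assumes u: "u \<in> wt_space V r" "u \<in> deg V p" and v: "v \<in> wt_space V t"
  shows "mode V u n v \<in> wt_space V (r + t - of_int n - 1)"
proof -
  have comm: "mode V (conf V) 1 (mode V u n w) - mode V u n (mode V (conf V) 1 w)
      = mode V (mode V u (-2) (vac V)) (n + 1) w + mode V (mode V (conf V) 1 u) n w"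
    for w
  proof -
    have "(1::complex) gchoose Suc (Suc i) = 0" for i
      using binomial_gbinomial[of 1 "Suc (Suc i)", where ?'a = complex] by simp
    then have "Sum_any (\<lambda>i::nat. scl V ((of_int 1 :: complex) gchoose i)
        (mode V (mode V (conf V) (int i) u) (1 + n - int i) w))
      = (\<Sum>i<2. scl V ((of_int 1 :: complex) gchoose i)
        (mode V (mode V (conf V) (int i) u) (1 + n - int i) w))"
      by (intro Sum_any_box) (auto dest!: le_Suc_ex)
    moreover have "(-1 :: complex) powi (4 * p) = 1"
      by (simp add: power_int_minus_left)
    ultimately show ?thesis
      using self.commutator[OF conf_deg u(2), of 1 n w]
      by (simp add: translation numeral_2_eq_2 add.commute)
  qed
  show ?thesis
    using comm[of v] u v
    by (simp add: wt_space_iff self.mode_scale_right self.mode_scale_left V.scale_left_distrib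
        V.scale_left_diff_distrib self.translation_mode algebra_simps)
qed

lemma wt_dif: "u \<in> wt_space V r \<Longrightarrow> dif V u \<in> wt_space V r"
  using self.dif_mode[OF conf_deg, of 1 u]
  by (simp add: wt_space_iff conf_dif self.dif_scale power_int_minus_left)

text \<open>Since \<open>L(0)\<close> has cohomological degree \<open>4 - 2 - 2 = 0\<close>, weight and degree components commute.\<close>

lemma deg_part_wt: "v \<in> wt_space V r \<Longrightarrow> deg_part V q v \<in> wt_space V r"
proof -
  assume v: "v \<in> wt_space V r"
  have "component UNIV (deg V) q (mode V (conf V) 1 v)
      = mode V (conf V) 1 (component UNIV (deg V) q v)"
    by (rule V.component_additive_map[OF self.deg_sum])
      (use self.mode_deg[OF conf_deg, of _ _ 1] in \<open>auto simp: self.mode_add_right\<close>)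
  with v show ?thesis
    by (simp add: wt_space_iff deg_part_def V.component_scale[OF self.deg_sum])
qed

lemma wt_part_deg:
  assumes "u \<in> deg V p"
  shows "wt_part V r u \<in> deg V p"
proof -
  have "component half_ints (wt_space V) r (deg_part V p u)
      = deg_part V p (component half_ints (wt_space V) r u)"
    by (rule V.component_additive_map[OF wt_sum])
      (auto simp: deg_part_wt, simp add: deg_part_def V.component_add[OF self.deg_sum])
  moreover have "deg_part V p u = u"
    using assms by (simp add: deg_part_def V.component_homogeneous[OF self.deg_sum])
  ultimately have "wt_part V r u = deg_part V p (wt_part V r u)"
    by (simp add: wt_part_def)
  then show ?thesis
    using V.component_mem[OF self.deg_sum, of p] by (metis UNIV_I deg_part_def)
qed

lemma wt_part_finite: "finite {r. wt_part V r u \<noteq> 0}"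
  unfolding wt_part_def by (rule V.component_finite[OF wt_sum])

lemma wt_part_sum: "Sum_any (\<lambda>r. wt_part V r u) = u"
  unfolding wt_part_def by (rule V.component_sum[OF wt_sum])

lemma wt_part_wt: "wt_part V r u \<in> wt_space V r"
  using V.component_mem[OF wt_sum] V.component_outside[OF wt_sum] V.subspace_0[OF wt_subspace]
  unfolding wt_part_def by (cases "r \<in> half_ints") auto

lemma wt_part_half_ints: "wt_part V r u \<noteq> 0 \<Longrightarrow> r \<in> half_ints"
  using V.component_outside[OF wt_sum] unfolding wt_part_def by blast

lemma wt_part_homogeneous:
  "r \<in> half_ints \<Longrightarrow> u \<in> wt_space V r \<Longrightarrow> wt_part V t u = (if t = r then u else 0)"
  unfolding wt_part_def by (rule V.component_homogeneous[OF wt_sum])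

text \<open>Linear statements about a vector of degree \<open>p\<close> need only be checked on vectors of degree \<open>p\<close> that
are also homogeneous for the weight, where the Jacobi identity and the definitions of Zhu both apply.\<close>

lemma wt_induct:
  assumes "V.subspace U" "u \<in> deg V p"
    "\<And>r. r \<in> half_ints \<Longrightarrow> wt_space V r \<inter> deg V p \<subseteq> U"
  shows "u \<in> U"
proof -
  have "wt_part V r u \<in> U" for r
    using assms wt_part_half_ints[of r u] wt_part_wt wt_part_deg V.subspace_0
    by (cases "wt_part V r u = 0") fastforce+
  then have "Sum_any (\<lambda>r. wt_part V r u) \<in> U"
    by (intro Sum_any_mem) (use assms(1) V.subspace_0 V.subspace_add in auto)
  then show ?thesis
    by (simp add: wt_part_sum)
qed

lemma wt_deg_induct:
  assumes "V.subspace U" "\<And>r p. r \<in> half_ints \<Longrightarrow> wt_space V r \<inter> deg V p \<subseteq> U"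
  shows "u \<in> U"
  by (rule V.direct_sum_induct[OF self.deg_sum assms(1)])
    (use wt_induct[OF assms(1)] assms(2) in blast)

end


section \<open>The subspace \<open>O(M)\<close>\<close>

lemma subspace_vimage_additive:
  assumes "vector_space s" "vector_space s'" "module.subspace s' U"
    "\<And>x y. h (x + y) = h x + h y" "\<And>a x. h (s a x) = s' a (h x)"
  shows "module.subspace s {x. h x \<in> U}"
proof -
  interpret s: vector_space s by fact
  interpret s': vector_space s' by fact
  have "h 0 = 0"
    using assms(4)[of 0 0] by simp
  then show ?thesis
    by (intro s.subspaceI)
      (auto simp: assms s'.subspace_0 s'.subspace_add s'.subspace_scale)
qed

context dgvoa_module
begin

lemmas VM_vimage = subspace_vimage_additive[OF V.vector_space_axioms M.vector_space_axioms]
lemmas MM_vimage = subspace_vimage_additive[OF M.vector_space_axioms M.vector_space_axioms]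

abbreviation "OM \<equiv> zhu_O V M"

lemma O_subspace: "M.subspace OM"
  unfolding zhu_O_def by (rule M.subspace_span)

lemma circ_hom_eq: "circ_hom M r u m = ser M (of_real r) (-2) u m"
  unfolding circ_hom_def ser_def by (rule Sum_any.cong) simp

lemma ser_circ_mem: "r \<in> half_ints \<Longrightarrow> u \<in> wt_space V r \<Longrightarrow> ser M (of_real r) (-2) u m \<in> OM"
  unfolding zhu_O_def by (rule M.span_base) (auto simp: circ_hom_eq[symmetric])

text \<open>Integration by parts for the residue of \<open>x\<^sup>k (1 + x)\<^sup>s (d/dx) Y(u, x) m\<close>.\<close>

lemma ser_translation:
  "ser M s k (mode V u (-2) (vac V)) m
    = - (scl M (of_int k) (ser M s (k - 1) u m) + scl M s (ser M (s - 1) k u m))"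
proof -
  let ?x = "\<lambda>n::nat. mode M u (k - 1 + int n) m"
  have "Sum_any (\<lambda>n. scl M (of_nat n * (s gchoose n)) (?x n))
      = Sum_any (\<lambda>n. scl M (of_nat (Suc n) * (s gchoose Suc n)) (?x (Suc n)))"
    by (subst Sum_any_nat_Suc[OF ser_support]) simp
  also have "\<dots> = Sum_any (\<lambda>n. scl M s (scl M ((s - 1) gchoose n) (mode M u (k + int n) m)))"
    unfolding gbinomial_absorption by simp
  also have "\<dots> = scl M s (ser M (s - 1) k u m)"
    by (simp add: ser_def M_Sum_any_scale)
  finally have d: "Sum_any (\<lambda>n. scl M (of_nat n * (s gchoose n)) (?x n))
      = scl M s (ser M (s - 1) k u m)" .
  have "ser M s k (mode V u (-2) (vac V)) m
      = Sum_any (\<lambda>n. scl M (-1) (scl M (of_int k * (s gchoose n)) (?x n)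
          + scl M (of_nat n * (s gchoose n)) (?x n)))"
    unfolding ser_def
    by (rule Sum_any.cong) (simp add: translation_mode algebra_simps M.scale_left_distrib)
  also have "\<dots> = scl M (-1) (Sum_any (\<lambda>n. scl M (of_int k * (s gchoose n)) (?x n))
      + Sum_any (\<lambda>n. scl M (of_nat n * (s gchoose n)) (?x n)))"
    unfolding M_Sum_any_scale[symmetric]
    by (subst Sum_any.distrib[OF ser_support ser_support]) (rule refl)
  also have "Sum_any (\<lambda>n. scl M (of_int k * (s gchoose n)) (?x n))
      = scl M (of_int k) (ser M s (k - 1) u m)"
    by (simp add: ser_def M_Sum_any_scale)
  finally show ?thesis
    by (simp add: d)
qed

text \<open>The poles of order two are the generators of \<open>O(M)\<close>.  Higher poles follow by induction: applied to
\<open>L(-1) u\<close>, of weight \<open>r + 1\<close>, the induction hypothesis and integration by parts express the residue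
with a pole one order higher through elements of \<open>O(M)\<close>.\<close>

lemma ser_mem_O:
  "r \<in> half_ints \<Longrightarrow> u \<in> wt_space V r \<Longrightarrow> ser M (of_real r) (-2 - int j) u m \<in> OM"
proof (induction j arbitrary: r u)
  case 0
  then show ?case by (simp add: ser_circ_mem)
next
  case (Suc j)
  let ?k = "-2 - int j"
  let ?r = "complex_of_real r"
  have r1: "r + 1 \<in> half_ints"
    using half_ints_add_int[OF Suc.prems(1), of 1] by simp
  have "ser M (?r + 1) ?k (mode V u (-2) (vac V)) m \<in> OM"
    using Suc.IH[OF r1 wt_translation[OF Suc.prems(2)]] by simp
  moreover have "ser M ?r ?k u m \<in> OM"
    using Suc.IH Suc.prems by simp
  moreover have "scl M (of_int ?k) (ser M ?r (?k - 1) u m)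
      = - (ser M (?r + 1) ?k (mode V u (-2) (vac V)) m
          + scl M (of_int ?k) (ser M ?r ?k u m) + scl M (?r + 1) (ser M ?r ?k u m))"
    using ser_pascal[of ?r "?k - 1" u m]
    by (simp add: ser_translation M.scale_right_distrib)
  ultimately have "scl M (of_int ?k) (ser M ?r (?k - 1) u m) \<in> OM"
    by (simp only:) (intro M.subspace_neg[OF O_subspace] M.subspace_add[OF O_subspace]
      M.subspace_scale[OF O_subspace])
  then have "scl M (1 / of_int ?k) (scl M (of_int ?k) (ser M ?r (?k - 1) u m)) \<in> OM"
    by (rule M.subspace_scale[OF O_subspace])
  moreover have "(of_int ?k :: complex) \<noteq> 0"
    unfolding of_int_eq_0_iff by simp
  ultimately show ?case
    by (simp add: algebra_simps del: of_int_diff of_int_minus)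
qed

text \<open>A power \<open>(1 + x)\<^sup>j\<close> lowers the order of the pole by at most \<open>j\<close>.\<close>

lemma ser_pole_mem_O:
  assumes "r \<in> half_ints" "u \<in> wt_space V r"
  shows "ser M (of_real r + of_nat j) (-2 - int j - int i) u m \<in> OM"
proof (induction j arbitrary: i)
  case 0
  then show ?case using ser_mem_O[OF assms, of i] by simp
next
  case (Suc j)
  have e: "complex_of_real r + of_nat (Suc j) = of_real r + of_nat j + 1"
    "-2 - int (Suc j) - int i = -2 - int j - int (Suc i)"
    "-2 - int j - int (Suc i) + 1 = -2 - int j - int i"
    by simp_all
  show ?case
    unfolding e(1,2) ser_pascal unfolding e(3) by (rule M.subspace_add[OF O_subspace Suc.IH Suc.IH])
qed

text \<open>The generators of \<open>O(M)\<close> may be taken homogeneous for all gradings, since the degree components of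
a vector of weight \<open>r\<close> have weight \<open>r\<close>.\<close>

lemma O_induct:
  assumes U: "M.subspace U"
    and gen: "\<And>r p q u m. r \<in> half_ints \<Longrightarrow> u \<in> wt_space V r \<Longrightarrow> u \<in> deg V p \<Longrightarrow> m \<in> deg M q
      \<Longrightarrow> ser M (of_real r) (-2) u m \<in> U"
    and x: "x \<in> OM"
  shows "x \<in> U"
proof -
  have 1: "ser M (of_real r) (-2) u m \<in> U"
    if u: "r \<in> half_ints" "u \<in> wt_space V r" "u \<in> deg V p" for r u p m
    using M.direct_sum_induct[OF deg_sum,
        OF MM_vimage[OF U, of "ser M (of_real r) (-2) u", OF ser_add_right ser_scale_right]]
      gen[OF u] by blast
  have 2: "ser M (of_real r) (-2) u m \<in> U" if u: "r \<in> half_ints" "u \<in> wt_space V r" for r u m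
  proof -
    have "ser M (of_real r) (-2) (deg_part V p u) m \<in> U" for p
      using 1[OF u(1) deg_part_wt[OF u(2)], of p p] V.component_mem[OF self.deg_sum, of p]
      by (simp add: deg_part_def)
    then have "Sum_any (\<lambda>p. ser M (of_real r) (-2) (deg_part V p u) m) \<in> U"
      by (intro Sum_any_mem) (use U M.subspace_0 M.subspace_add in auto)
    then show ?thesis
      using V.component_finite[OF self.deg_sum, of u] V.component_sum[OF self.deg_sum, of u]
      by (simp add: deg_part_def flip: ser_Sum_any_left)
  qed
  have "OM \<subseteq> U"
    unfolding zhu_O_def by (rule M.span_minimal[OF _ U]) (auto simp: circ_hom_eq 2)
  with x show ?thesis by blast
qed

lemma ser_bounded:
  obtains N :: nat where "\<And>n. n \<ge> N \<Longrightarrow> ser M s (k + int n) u m = 0"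
proof -
  obtain N :: nat where N: "\<And>n. n \<ge> N \<Longrightarrow> mode M u (k + int n) m = 0"
    using mode_bounded[of u k m] by metis
  have "ser M s (k + int n) u m = 0" if "n \<ge> N" for n
    using N[of "n + j" for j] that by (simp add: ser_def add.assoc)
  then show thesis by (rule that)
qed

lemma Sum_any_mem_O: "(\<And>i. f i \<in> OM) \<Longrightarrow> Sum_any f \<in> OM"
  by (rule Sum_any_mem) (use O_subspace M.subspace_0 M.subspace_add in auto)

text \<open>Used to isolate the product that one wants to control from the other terms of \<open>binomial_jacobi\<close>.\<close>

lemma Sum_any_head_mem_O:
  assumes "finite {i. f i \<noteq> 0}" "Sum_any f \<in> OM" "\<And>i. f (Suc i) \<in> OM"
  shows "f 0 \<in> OM"
proof -
  have "f 0 = Sum_any f - Sum_any (\<lambda>i. f (Suc i))"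
    using Sum_any_nat_Suc[OF assms(1)] by simp
  then show ?thesis
    using assms Sum_any_mem_O[of "\<lambda>i. f (Suc i)"] M.subspace_diff[OF O_subspace] by simp
qed

lemma binomial_jacobi_support:
  "finite {i::nat. scl M (c i) (ser M s (l - int i) u (ser M t (k + int i) v w)
      - scl M e (ser M t (k + l - int i) v (ser M s (int i) u w))) \<noteq> 0}"
proof -
  obtain N1 :: nat where N1: "\<And>n. n \<ge> N1 \<Longrightarrow> ser M t (k + int n) v w = 0"
    using ser_bounded[of t k v w] by metis
  obtain N2 :: nat where "\<And>n. n \<ge> N2 \<Longrightarrow> ser M s (0 + int n) u w = 0"
    using ser_bounded[of s 0 u w] by metis
  with N1 show ?thesis
    by (intro finite_nat_support[of "max N1 N2"]) simp
qed

text \<open>The residue of \<open>x\<^sup>k (1 + x)\<^sup>e Y((1 + x)^L(0) u, x) m\<close>.  Left multiplication by \<open>u\<close> in the sense of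
Zhu is the case \<open>e = 0\<close>, \<open>k = -1\<close>, right multiplication (up to sign) the case \<open>e = -1\<close>, \<open>k = -1\<close>.
Their difference is the case \<open>e = -1\<close>, \<open>k = 0\<close>, because \<open>(1 + x)\<^sup>r - (1 + x)\<^sup>r\<^sup>-\<^sup>1 = x (1 + x)\<^sup>r\<^sup>-\<^sup>1\<close>.\<close>

definition wser :: "complex \<Rightarrow> int \<Rightarrow> 'v \<Rightarrow> 'm \<Rightarrow> 'm"
  where "wser e k u m = Sum_any (\<lambda>r. ser M (of_real r + e) k (wt_part V r u) m)"

lemma wser_support: "finite {r. ser M (f r) k (wt_part V r u) m \<noteq> 0}"
  by (rule finite_subset[OF _ wt_part_finite[of u]]) auto

lemma wser_homogeneous:
  assumes "r \<in> half_ints" "u \<in> wt_space V r"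
  shows "wser e k u m = ser M (of_real r + e) k u m"
  unfolding wser_def by (subst Sum_any_single[of r]) (auto simp: wt_part_homogeneous[OF assms])

lemma wser_add_left: "wser e k (u + v) m = wser e k u m + wser e k v m"
  using Sum_any.distrib[OF wser_support wser_support, of _ k u m _ k v m]
  by (simp add: wser_def wt_part_def V.component_add[OF wt_sum] ser_add_left)

lemma wser_scale_left: "wser e k (scl V a u) m = scl M a (wser e k u m)"
  by (simp add: wser_def wt_part_def V.component_scale[OF wt_sum] ser_scale_left M_Sum_any_scale)

lemma wser_add_right: "wser e k u (x + y) = wser e k u x + wser e k u y"
  using Sum_any.distrib[OF wser_support wser_support, of _ k u x _ k u y]
  by (simp add: wser_def ser_add_right)

lemma wser_scale_right: "wser e k u (scl M a m) = scl M a (wser e k u m)"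
  by (simp add: wser_def ser_scale_right M_Sum_any_scale)

lemma wser_zero_left [simp]: "wser e k 0 m = 0"
  using wser_add_left[of e k 0 0 m] by simp

lemma wser_Sum_any_left:
  "finite {i. f i \<noteq> 0} \<Longrightarrow> wser e k (Sum_any f) m = Sum_any (\<lambda>i. wser e k (f i) m)"
  by (rule Sum_any_additive) (auto simp: wser_add_left)

lemma wser_pascal: "wser (e + 1) k u m = wser e k u m + wser e (k + 1) u m"
  using Sum_any.distrib[OF wser_support wser_support, of _ k u m _ "k + 1" u m]
  by (simp add: wser_def ser_pascal flip: add.assoc)

lemmas wser_vimage_left = VM_vimage[of _ "\<lambda>u. wser e k u m" for e k m, OF _ wser_add_left wser_scale_left]
lemmas wser_vimage_right = MM_vimage[of _ "wser e k u" for e k u, OF _ wser_add_right wser_scale_right]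

end

context dgvoa_module
begin

text \<open>For \<open>x = u \<circ> v\<close> take \<open>l = -2\<close>, \<open>s = wt u\<close> and \<open>t = wt v + 1 + e\<close> in \<open>binomial_jacobi\<close>.  The left side is
then the operator of \<open>u \<circ> v\<close>, and each term on the right has a pole of order at least two in the
variable of the outer field, also after the additional factor \<open>1 + y\<close> in the case \<open>e = 0\<close>, where
\<open>y\<^sup>k\<close> raises the order of the pole to three.\<close>

lemma wser_O_left:
  assumes ek: "e = 0 \<and> k = -1 \<or> e = -1 \<and> k = 0" and x: "x \<in> zhu_O V V"
  shows "wser e k x m \<in> OM"
proof -
  have "x \<in> {x. wser e k x m \<in> OM}"
  proof (rule self.O_induct[OF wser_vimage_left[OF O_subspace] _ x])
    fix r p q u v assume u: "r \<in> half_ints" "u \<in> wt_space V r" "u \<in> deg V p" and v: "v \<in> deg V q"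
    have "v \<in> {v. wser e k (ser V (of_real r) (-2) u v) m \<in> OM}"
    proof (rule wt_induct[OF _ v])
      show "V.subspace {v. wser e k (ser V (of_real r) (-2) u v) m \<in> OM}"
        by (rule VM_vimage[OF O_subspace])
          (simp_all add: self.ser_add_right self.ser_scale_right wser_add_left wser_scale_left)
      fix t assume t: "t \<in> half_ints"
      show "wt_space V t \<inter> deg V q \<subseteq> {v. wser e k (ser V (of_real r) (-2) u v) m \<in> OM}"
      proof safe
        fix v assume v: "v \<in> wt_space V t" "v \<in> deg V q"
        \<comment> \<open>The weight of \<open>u\<^sub>i\<^sub>-\<^sub>2 v\<close> is \<open>r + t + 1 - i\<close>, so the exponent attached to it is the one on the left
          side of \<open>binomial_jacobi\<close>.\<close>
        have w: "wser e k (mode V u (-2 + int i) v) m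
            = ser M (of_real r - of_nat i + (of_real t + 1 + e)) k (mode V u (-2 + int i) v) m" for i
        proof -
          have "mode V u (-2 + int i) v \<in> wt_space V (r + t - of_int (-2 + int i) - 1)"
            by (rule wt_mode[OF u(2,3) v(1)])
          moreover have "r + t - of_int (-2 + int i) - 1 = r + t + of_int (1 - int i)"
            by simp
          moreover have "r + t + of_int (1 - int i) \<in> half_ints"
            by (intro half_ints_add_int half_ints_add u t)
          ultimately have "wser e k (mode V u (-2 + int i) v) m
              = ser M (of_real (r + t + of_int (1 - int i)) + e) k (mode V u (-2 + int i) v) m"
            using wser_homogeneous by metis
          then show ?thesis
            by (simp add: algebra_simps)
        qed
        define R where "R i = scl M ((-1) ^ i * ((of_int (-2) :: complex) gchoose i))
          (ser M (of_real r) (-2 - int i) u (ser M (of_real t + 1 + e) (k + int i) v m)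
            - scl M ((-1) powi (-2) * (-1) powi (p * q))
                (ser M (of_real t + 1 + e) (k + -2 - int i) v (ser M (of_real r) (int i) u m)))"
          for i :: nat
        have "wser e k (ser V (of_real r) (-2) u v) m
          = Sum_any (\<lambda>i. scl M (of_real r gchoose i) (wser e k (mode V u (-2 + int i) v) m))"
          unfolding ser_def by (subst wser_Sum_any_left[OF self.ser_support]) (simp add: wser_scale_left)
        also have "\<dots> = Sum_any R"
          unfolding w R_def by (rule binomial_jacobi[OF u(3) v(2)])
        also have "\<dots> \<in> OM"
        proof (rule Sum_any_mem_O)
          fix i
          have "ser M (of_real t + 1 + e) (k + -2 - int i) v y \<in> OM" for y
            using ek ser_pole_mem_O[OF t v(1), of 1 i y] ser_mem_O[OF t v(1), of i y]
            by auto
          then show "R i \<in> OM"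
            unfolding R_def using ser_mem_O[OF u(1,2), of i]
            by (intro M.subspace_scale[OF O_subspace] M.subspace_diff[OF O_subspace])
        qed
        finally show "wser e k (ser V (of_real r) (-2) u v) m \<in> OM" .
      qed
    qed
    then show "ser V (of_real r) (-2) u v \<in> {x. wser e k x m \<in> OM}"
      by simp
  qed
  then show ?thesis by simp
qed

text \<open>For \<open>x = b \<circ> m\<close> take \<open>l = k\<close>, \<open>s = wt a + e\<close>, \<open>t = wt b\<close> and the pole of order two of \<open>b\<close> in
\<open>binomial_jacobi\<close>.  The left side is a sum of elements \<open>(a\<^sub>k\<^sub>+\<^sub>i b) \<circ> m\<close>.  On the right the term \<open>i = 0\<close>
contains the wanted product; everything else has a pole of order at least two in its outer field, or
vanishes because \<open>k = 0\<close> and \<open>i > 0\<close>.\<close>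

lemma wser_O_right:
  assumes ek: "e = 0 \<and> k = -1 \<or> e = -1 \<and> k = 0" and x: "x \<in> OM"
  shows "wser e k a x \<in> OM"
proof -
  have "a \<in> {a. wser e k a x \<in> OM}"
  proof (rule wt_deg_induct[OF wser_vimage_left[OF O_subspace]])
    fix s p assume s: "s \<in> half_ints"
    show "wt_space V s \<inter> deg V p \<subseteq> {a. wser e k a x \<in> OM}"
    proof safe
      fix a assume a: "a \<in> wt_space V s" "a \<in> deg V p"
      have "x \<in> {x. wser e k a x \<in> OM}"
      proof (rule O_induct[OF wser_vimage_right[OF O_subspace] _ x])
        fix t q q' b m assume b: "t \<in> half_ints" "b \<in> wt_space V t" "b \<in> deg V q"
        define R where "R i = scl M ((-1) ^ i * ((of_int k :: complex) gchoose i))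
          (ser M (of_real s + e) (k - int i) a (ser M (of_real t) (-2 + int i) b m)
            - scl M ((-1) powi k * (-1) powi (p * q))
                (ser M (of_real t) (-2 + k - int i) b (ser M (of_real s + e) (int i) a m)))"
          for i :: nat
        have "Sum_any R \<in> OM"
        proof -
          have "ser M (of_real s + e - of_nat i + of_real t) (-2) (mode V a (k + int i) b) m \<in> OM" for i
          proof -
            have "mode V a (k + int i) b \<in> wt_space V (s + t - of_int (k + int i) - 1)"
              by (rule wt_mode[OF a b(2)])
            moreover have "s + t - of_int (k + int i) - 1 = s + t + of_int (- k - int i - 1)"
              by simp
            moreover have "s + t + of_int (- k - int i - 1) \<in> half_ints"
              by (intro half_ints_add_int half_ints_add s b)
            ultimately have "ser M (of_real (s + t + of_int (- k - int i - 1))) (-2)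
                (mode V a (k + int i) b) m \<in> OM"
              using ser_circ_mem by metis
            moreover have "complex_of_real (s + t + of_int (- k - int i - 1))
                = of_real s + e - of_nat i + of_real t"
              using ek by auto
            ultimately show ?thesis
              by metis
          qed
          then show ?thesis
            unfolding R_def binomial_jacobi[OF a(2) b(3), symmetric]
            by (intro Sum_any_mem_O M.subspace_scale[OF O_subspace])
        qed
        moreover have "R (Suc i) \<in> OM" for i
          using ek
        proof
          assume ek: "e = 0 \<and> k = -1"
          have "k - int (Suc i) = -2 - int i" "-2 + k - int (Suc i) = -2 - int (Suc (Suc i))"
              "of_real s + e = complex_of_real s"
            using ek by simp_all
          then show ?thesis
            unfolding R_def using ser_mem_O[OF s a(1), of i] ser_mem_O[OF b(1,2), of "Suc (Suc i)"]
            by (simp only:) (intro M.subspace_scale[OF O_subspace] M.subspace_diff[OF O_subspace])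
        next
          assume "e = -1 \<and> k = 0"
          then show ?thesis
            by (simp add: R_def M.subspace_0[OF O_subspace])
        qed
        moreover have "finite {i. R i \<noteq> 0}"
          unfolding R_def by (rule binomial_jacobi_support)
        ultimately have "R 0 \<in> OM"
          using Sum_any_head_mem_O[of R] by blast
        moreover have "ser M (of_real t) (-2 + k) b (ser M (of_real s + e) 0 a m) \<in> OM"
          using ek ser_mem_O[OF b(1,2), of 0] ser_mem_O[OF b(1,2), of 1] by auto
        moreover have "ser M (of_real s + e) k a (ser M (of_real t) (-2) b m)
          = R 0 + scl M ((-1) powi k * (-1) powi (p * q))
              (ser M (of_real t) (-2 + k) b (ser M (of_real s + e) 0 a m))"
          by (simp add: R_def)
        ultimately have "ser M (of_real s + e) k a (ser M (of_real t) (-2) b m) \<in> OM"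
          by (simp only:) (intro M.subspace_add[OF O_subspace] M.subspace_scale[OF O_subspace])
        then show "ser M (of_real t) (-2) b m \<in> {x. wser e k a x \<in> OM}"
          by (simp add: wser_homogeneous[OF s a(1)])
      qed
      then show "wser e k a x \<in> OM" by simp
    qed
  qed
  then show ?thesis by simp
qed

end


section \<open>The filtration by cohomological degree\<close>

context dgvoa_module
begin

abbreviation "Fil p \<equiv> M.span (\<Union>q\<in>{..p::int}. deg M q)"

text \<open>The classes of these vectors in \<open>A(M)\<close> form \<open>F\<^sup>p\<close>.\<close>

definition "OFil p = {x + y | x y. x \<in> OM \<and> y \<in> Fil p}"

lemma deg_Fil: "m \<in> deg M q \<Longrightarrow> q \<le> p \<Longrightarrow> m \<in> Fil p"
  by (rule M.span_base) auto

lemma Fil_mono: "p \<le> q \<Longrightarrow> Fil p \<subseteq> Fil q"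
  by (rule M.span_mono) fastforce

lemma Fil_minimal: "M.subspace U \<Longrightarrow> (\<And>q. q \<le> p \<Longrightarrow> deg M q \<subseteq> U) \<Longrightarrow> Fil p \<subseteq> U"
  by (rule M.span_minimal) auto

lemma Sum_any_mem_Fil: "(\<And>i. f i \<in> Fil p) \<Longrightarrow> Sum_any f \<in> Fil p"
  by (rule Sum_any_mem) (auto simp: M.span_add M.span_zero)

lemma OFil_subspace: "M.subspace (OFil p)"
  unfolding OFil_def by (rule M.subspace_sums[OF O_subspace M.subspace_span])

lemma OFil_add: "x \<in> OM \<Longrightarrow> y \<in> Fil p \<Longrightarrow> x + y \<in> OFil p"
  unfolding OFil_def by blast

lemma O_OFil: "x \<in> OM \<Longrightarrow> x \<in> OFil p"
  unfolding OFil_def using M.span_zero by force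

lemma Fil_OFil: "x \<in> Fil p \<Longrightarrow> x \<in> OFil p"
  unfolding OFil_def using M.subspace_0[OF O_subspace] by force

lemma OFil_mono: "p \<le> q \<Longrightarrow> OFil p \<subseteq> OFil q"
  unfolding OFil_def using Fil_mono by blast

lemma Sum_any_mem_OFil: "(\<And>i. f i \<in> OFil p) \<Longrightarrow> Sum_any f \<in> OFil p"
  by (rule Sum_any_mem) (use OFil_subspace M.subspace_0 M.subspace_add in auto)

lemma ser_tail_Fil:
  assumes "u \<in> deg V p" "m \<in> deg M q"
  shows "Sum_any (\<lambda>n. scl M (c n) (mode M u (k + int n) m)) \<in> Fil (p + q - 2 * k - 2)"
proof (rule Sum_any_mem_Fil)
  fix n
  have "mode M u (k + int n) m \<in> Fil (p + q - 2 * k - 2)"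
    by (rule deg_Fil[OF mode_deg[OF assms]]) simp
  then show "scl M (c n) (mode M u (k + int n) m) \<in> Fil (p + q - 2 * k - 2)"
    by (rule M.span_scale)
qed

text \<open>Each further mode has a degree that is lower by two.\<close>

lemma ser_leading:
  assumes "u \<in> deg V p" "m \<in> deg M q"
  shows "ser M s k u m - mode M u k m \<in> Fil (p + q - 2 * k - 4)"
  using ser_tail_Fil[OF assms, of _ "k + 1"] by (simp add: ser_eq_leading algebra_simps)

lemma ser_second:
  assumes "u \<in> deg V p" "m \<in> deg M q"
  shows "ser M s k u m - mode M u k m - scl M s (mode M u (k + 1) m) \<in> Fil (p + q - 2 * k - 6)"
proof -
  have "ser M s k u m - mode M u k m - scl M s (mode M u (k + 1) m)
      = Sum_any (\<lambda>n. scl M (s gchoose Suc (Suc n)) (mode M u (k + 2 + int n) m))"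
    unfolding ser_eq_leading by (subst Sum_any_nat_Suc[OF ser_support]) (simp add: add_ac)
  then show ?thesis
    using ser_tail_Fil[OF assms, of _ "k + 2"] by (simp add: algebra_simps)
qed

lemma wser_leading:
  assumes u: "u \<in> deg V p" and m: "m \<in> deg M q"
  shows "wser e k u m - mode M u k m \<in> Fil (p + q - 2 * k - 4)"
proof -
  have "u \<in> {u. wser e k u m - mode M u k m \<in> Fil (p + q - 2 * k - 4)}"
  proof (rule wt_induct[OF _ u])
    show "V.subspace {u. wser e k u m - mode M u k m \<in> Fil (p + q - 2 * k - 4)}"
      by (rule VM_vimage[OF M.subspace_span])
        (simp_all add: wser_add_left mode_add_left wser_scale_left mode_scale_left
          M.scale_right_diff_distrib)
    show "wt_space V r \<inter> deg V p \<subseteq> {u. wser e k u m - mode M u k m \<in> Fil (p + q - 2 * k - 4)}"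
      if "r \<in> half_ints" for r
      using wser_homogeneous[OF that] ser_leading[OF _ m] by auto
  qed
  then show ?thesis by simp
qed

lemma wser_deg_Fil:
  assumes "u \<in> deg V p" "m \<in> deg M q"
  shows "wser e k u m \<in> Fil (p + q - 2 * k - 2)"
proof -
  have "wser e k u m = (wser e k u m - mode M u k m) + mode M u k m"
    by simp
  moreover have "wser e k u m - mode M u k m \<in> Fil (p + q - 2 * k - 2)"
    using wser_leading[OF assms, of e k]
      Fil_mono[of "p + q - 2 * k - 4" "p + q - 2 * k - 2"] by auto
  moreover have "mode M u k m \<in> Fil (p + q - 2 * k - 2)"
    by (rule deg_Fil[OF mode_deg[OF assms]]) simp
  ultimately show ?thesis
    by (metis M.span_add)
qed

end

context dgvoa_module
begin

lemma wser_Fil_left: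
  assumes "u \<in> self.Fil p" and m: "m \<in> deg M q"
  shows "wser e k u m \<in> Fil (p + q - 2 * k - 2)"
proof -
  have "self.Fil p \<subseteq> {u. wser e k u m \<in> Fil (p + q - 2 * k - 2)}"
  proof (rule self.Fil_minimal[OF wser_vimage_left[OF M.subspace_span]])
    show "deg V q' \<subseteq> {u. wser e k u m \<in> Fil (p + q - 2 * k - 2)}" if "q' \<le> p" for q'
      using wser_deg_Fil[OF _ m, of _ q' e k]
        Fil_mono[of "q' + q - 2 * k - 2" "p + q - 2 * k - 2"] that by auto
  qed
  with assms show ?thesis by blast
qed

lemma wser_Fil_right:
  assumes u: "u \<in> deg V p" and "m \<in> Fil q"
  shows "wser e k u m \<in> Fil (p + q - 2 * k - 2)"
proof -
  have "Fil q \<subseteq> {m. wser e k u m \<in> Fil (p + q - 2 * k - 2)}"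
  proof (rule Fil_minimal[OF wser_vimage_right[OF M.subspace_span]])
    show "deg M q' \<subseteq> {m. wser e k u m \<in> Fil (p + q - 2 * k - 2)}" if "q' \<le> q" for q'
      using wser_deg_Fil[OF u, of _ q' e k]
        Fil_mono[of "p + q' - 2 * k - 2" "p + q - 2 * k - 2"] that by auto
  qed
  with assms show ?thesis by blast
qed

lemma wser_OFil_left:
  assumes "e = 0 \<and> k = -1 \<or> e = -1 \<and> k = 0" and "u \<in> self.OFil p" "m \<in> deg M q"
  shows "wser e k u m \<in> OFil (p + q - 2 * k - 2)"
proof -
  obtain x y where "u = x + y" "x \<in> zhu_O V V" "y \<in> self.Fil p"
    using assms(2) unfolding self.OFil_def by blast
  then show ?thesis
    using wser_O_left[OF assms(1), of x m] wser_Fil_left[OF _ assms(3), of y p e k]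
    by (simp add: wser_add_left OFil_add)
qed

lemma wser_OFil_right:
  assumes "e = 0 \<and> k = -1 \<or> e = -1 \<and> k = 0" and "u \<in> deg V p" "m \<in> OFil q"
  shows "wser e k u m \<in> OFil (p + q - 2 * k - 2)"
proof -
  obtain x y where "m = x + y" "x \<in> OM" "y \<in> Fil q"
    using assms(3) unfolding OFil_def by blast
  then show ?thesis
    using wser_O_right[OF assms(1), of x u] wser_Fil_right[OF assms(2), of y q e k]
    by (simp add: wser_add_right OFil_add)
qed

lemma dif_zero [simp]: "dif M 0 = 0"
  using dif_add[of 0 0] by simp

lemma dif_ser:
  assumes "u \<in> deg V p"
  shows "dif M (ser M s k u m)
    = ser M s k (dif V u) m + scl M ((-1) powi p) (ser M s k u (dif M m))"
proof -
  have "dif M (ser M s k u m) = Sum_any (\<lambda>n. dif M (scl M (s gchoose n) (mode M u (k + int n) m)))"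
    unfolding ser_def by (rule Sum_any_additive[of "dif M", OF dif_zero dif_add ser_support])
  also have "\<dots> = Sum_any (\<lambda>n. scl M (s gchoose n) (mode M (dif V u) (k + int n) m)
      + scl M ((-1) powi p * (s gchoose n)) (mode M u (k + int n) (dif M m)))"
    by (simp add: dif_scale dif_mode[OF assms] M.scale_right_distrib mult.commute)
  also have "\<dots> = ser M s k (dif V u) m + scl M ((-1) powi p) (ser M s k u (dif M m))"
    by (subst Sum_any.distrib[OF ser_support ser_support]) (simp add: ser_def M_Sum_any_scale)
  finally show ?thesis .
qed

lemma dif_O: "x \<in> OM \<Longrightarrow> dif M x \<in> OM"
proof -
  assume x: "x \<in> OM"
  have "x \<in> {x. dif M x \<in> OM}"
    by (rule O_induct[OF MM_vimage[OF O_subspace dif_add dif_scale] _ x])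
      (auto simp: dif_ser intro!: M.subspace_add[OF O_subspace] M.subspace_scale[OF O_subspace]
        ser_circ_mem wt_dif)
  then show ?thesis by simp
qed

lemma dif_OFil: "x \<in> OFil p \<Longrightarrow> dif M x \<in> OFil (p + 1)"
proof -
  assume "x \<in> OFil p"
  then obtain y z where "x = y + z" "y \<in> OM" "z \<in> Fil p"
    unfolding OFil_def by blast
  moreover have "Fil p \<subseteq> {x. dif M x \<in> Fil (p + 1)}"
  proof (rule Fil_minimal[OF MM_vimage[OF M.subspace_span dif_add dif_scale]])
    show "deg M q \<subseteq> {x. dif M x \<in> Fil (p + 1)}" if "q \<le> p" for q
      using deg_Fil[OF dif_deg, of _ q "p + 1"] that by auto
  qed
  ultimately show ?thesis
    using dif_O[of y] by (auto simp: dif_add intro: OFil_add)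
qed

lemma star_l_eq: "star_l V M u m = wser 0 (-1) u m"
  by (simp add: star_l_def star_l_hom_def wser_def ser_def)

lemma star_r_eq:
  assumes u: "u \<in> deg V p" and m: "m \<in> deg M q"
  shows "star_r V M m u = scl M ((-1) powi (p * q)) (wser (-1) (-1) u m)"
proof -
  have dm: "deg_part M q' m = (if q' = q then m else 0)" for q'
    unfolding deg_part_def using M.component_homogeneous[OF deg_sum _ m] by simp
  have du: "deg_part V p' (wt_part V r u) = (if p' = p then wt_part V r u else 0)" for p' r
    unfolding deg_part_def using V.component_homogeneous[OF self.deg_sum _ wt_part_deg[OF u]] by simp
  have hom: "star_r_hom M r p' q' x y
      = scl M ((-1) powi (p' * q')) (ser M (of_real r - 1) (-1) y x)" for r p' q' x y
    by (simp add: star_r_hom_def ser_def)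
  have "Sum_any (\<lambda>p'. Sum_any (\<lambda>q'. star_r_hom M r p' q' (deg_part M q' m) (deg_part V p' (wt_part V r u))))
      = scl M ((-1) powi (p * q)) (ser M (of_real r - 1) (-1) (wt_part V r u) m)" for r
  proof -
    have "Sum_any (\<lambda>q'. star_r_hom M r p' q' (deg_part M q' m) (deg_part V p' (wt_part V r u)))
      = star_r_hom M r p' q m (deg_part V p' (wt_part V r u))" for p'
      by (subst Sum_any_single[of q]) (auto simp: dm hom)
    then show ?thesis
      by (simp, subst Sum_any_single[of p]) (auto simp: du hom)
  qed
  then show ?thesis
    by (simp add: star_r_def wser_def M_Sum_any_scale)
qed

text \<open>The two signs \<open>(-1)\<^sup>p\<^sup>q\<close>, in the bracket and in the right multiplication, cancel, which is what makes the
bracket a linear expression in \<open>u\<close> that can be evaluated on inhomogeneous elements of \<open>O(V)\<close>.\<close>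

lemma star_commutator:
  assumes "u \<in> deg V p" "m \<in> deg M q"
  shows "star_l V M u m - scl M ((-1) powi (p * q)) (star_r V M m u) = wser (-1) 0 u m"
  using wser_pascal[of "-1" "-1" u m] by (simp add: star_l_eq star_r_eq[OF assms])


section \<open>The subspace \<open>C\<^sub>2(M)\<close>\<close>

lemma C2_subspace: "M.subspace (C2 M)"
  unfolding C2_def by (rule M.subspace_span)

text \<open>Up to a nonzero factor \<open>u\<^sub>-\<^sub>3\<^sub>-\<^sub>j\<close> is \<open>(L(-1) u)\<^sub>-\<^sub>2\<^sub>-\<^sub>j\<close>.\<close>

lemma mode_mem_C2: "mode M u (-2 - int j) m \<in> C2 M"
proof (induction j arbitrary: u)
  case 0
  show ?case unfolding C2_def by (rule M.span_base) auto
next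
  case (Suc j)
  have "scl M (- 1 / of_int (-2 - int j)) (mode M (mode V u (-2) (vac V)) (-2 - int j) m) \<in> C2 M"
    by (rule M.subspace_scale[OF C2_subspace Suc.IH])
  moreover have "(of_int (-2 - int j) :: complex) \<noteq> 0"
    unfolding of_int_eq_0_iff by simp
  ultimately show ?case
    by (simp add: translation_mode del: of_int_diff of_int_minus of_int_of_nat_eq)
qed

lemma mode_mem_C2': "k \<le> -2 \<Longrightarrow> mode M u k m \<in> C2 M"
  using mode_mem_C2[of u "nat (-2 - k)" m] by simp

lemma Sum_any_mem_C2: "(\<And>i. f i \<in> C2 M) \<Longrightarrow> Sum_any f \<in> C2 M"
  by (rule Sum_any_mem) (use C2_subspace M.subspace_0 M.subspace_add in auto)

lemma C2_induct:
  assumes U: "M.subspace U"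
    and gen: "\<And>p q u m. u \<in> deg V p \<Longrightarrow> m \<in> deg M q \<Longrightarrow> mode M u (-2) m \<in> U"
    and x: "x \<in> C2 M"
  shows "x \<in> U"
proof -
  have 1: "mode M u (-2) m \<in> U" if "u \<in> deg V p" for u p m
    using M.direct_sum_induct[OF deg_sum,
        OF MM_vimage[OF U, of "mode M u (-2)", OF mode_add_right mode_scale_right]] gen[OF that]
    by blast
  have "mode M u (-2) m \<in> U" for u m
    using V.direct_sum_induct[OF self.deg_sum,
        OF VM_vimage[OF U, of "\<lambda>u. mode M u (-2) m", OF mode_add_left mode_scale_left]] 1
    by blast
  then have "C2 M \<subseteq> U"
    unfolding C2_def by (intro M.span_minimal[OF _ U]) auto
  with x show ?thesis by blast
qed

lemma dif_C2: "x \<in> C2 M \<Longrightarrow> dif M x \<in> C2 M"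
proof -
  assume x: "x \<in> C2 M"
  have "x \<in> {x. dif M x \<in> C2 M}"
    by (rule C2_induct[OF MM_vimage[OF C2_subspace dif_add dif_scale] _ x])
      (auto simp: dif_mode intro!: M.subspace_add[OF C2_subspace] M.subspace_scale[OF C2_subspace]
        mode_mem_C2')
  then show ?thesis by simp
qed

text \<open>Commuting \<open>v\<^sub>k\<close> past \<open>u\<^sub>-\<^sub>2\<close> produces modes of index \<open>k - 2 - i\<close>, which is at most \<open>-2\<close>.\<close>

lemma mode_C2_right:
  assumes "k \<le> 0" "v \<in> deg V p" "x \<in> C2 M"
  shows "mode M v k x \<in> C2 M"
proof -
  have "x \<in> {x. mode M v k x \<in> C2 M}"
  proof (rule C2_induct[OF MM_vimage[OF C2_subspace mode_add_right mode_scale_right] _ assms(3)])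
    fix p' q u m assume u: "u \<in> deg V p'"
    have "mode M v k (mode M u (-2) m) = scl M ((-1) powi (p * p')) (mode M u (-2) (mode M v k m))
      + Sum_any (\<lambda>i::nat. scl M ((of_int k :: complex) gchoose i)
          (mode M (mode V v (int i) u) (k + -2 - int i) m))"
      using commutator[OF assms(2) u, of k "-2" m] by (simp add: algebra_simps)
    also have "\<dots> \<in> C2 M"
      using assms(1) by (intro M.subspace_add[OF C2_subspace] M.subspace_scale[OF C2_subspace]
        Sum_any_mem_C2 mode_mem_C2') simp_all
    finally show "mode M u (-2) m \<in> {x. mode M v k x \<in> C2 M}" by simp
  qed
  then show ?thesis by simp
qed

end

context dgvoa_module
begin

text \<open>In the iterate formula for \<open>(u\<^sub>-\<^sub>2 v)\<^sub>k\<close> the outer modes have index \<open>-2 - i\<close> and \<open>k - 2 - i\<close>.\<close>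

lemma mode_C2_left:
  assumes "k \<le> 0" "x \<in> C2 V"
  shows "mode M x k m \<in> C2 M"
proof -
  have "x \<in> {x. mode M x k m \<in> C2 M}"
  proof (rule self.C2_induct[OF VM_vimage[OF C2_subspace mode_add_left mode_scale_left] _ assms(2)])
    fix p q u v assume "u \<in> deg V p" "v \<in> deg V q"
    from iterate[OF this, of "-2" k m] show "mode V u (-2) v \<in> {x. mode M x k m \<in> C2 M}"
      using assms(1) by (auto intro!: M.subspace_diff[OF C2_subspace]
        M.subspace_scale[OF C2_subspace] Sum_any_mem_C2 mode_mem_C2')
  qed
  then show ?thesis by simp
qed

text \<open>In the iterate formula for \<open>(u\<^sub>-\<^sub>1 v)\<^sub>n\<close> only the terms with \<open>i = 0\<close> have an outer mode of index above \<open>-2\<close>.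
The case \<open>n = -1\<close> gives associativity of the action, the case \<open>n = 0\<close> the Leibniz rule for the
bracket in its first argument.\<close>

lemma iterate_mod_C2:
  assumes uv: "u \<in> deg V p" "v \<in> deg V q" and n: "n = -1 \<or> n = 0"
  shows "mode M (mode V u (-1) v) n m
    - (mode M u (-1) (mode M v n m) + scl M ((-1) powi (p * q)) (mode M v (n - 1) (mode M u 0 m)))
    \<in> C2 M"
proof -
  define f where "f i = scl M ((-1) ^ i * ((of_int (-1) :: complex) gchoose i))
        (mode M u (-1 - int i) (mode M v (n + int i) m)
          - scl M ((-1) powi (-1) * (-1) powi (p * q))
              (mode M v (n + -1 - int i) (mode M u (int i) m)))" for i :: nat
  have fin: "finite {i. f i \<noteq> 0}"
  proof -
    obtain N1 :: nat where N1: "\<And>i. i \<ge> N1 \<Longrightarrow> mode M v (n + int i) m = 0"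
      using mode_bounded[of v n m] by metis
    obtain N2 :: nat where "\<And>i. i \<ge> N2 \<Longrightarrow> mode M u (0 + int i) m = 0"
      using mode_bounded[of u 0 m] by metis
    with N1 show ?thesis
      by (intro finite_nat_support[of "max N1 N2"]) (simp add: f_def)
  qed
  have "mode M (mode V u (-1) v) n m = f 0 + Sum_any (\<lambda>i. f (Suc i))"
    unfolding iterate[OF uv] Sum_any_nat_Suc[OF fin, symmetric] by (simp add: f_def)
  moreover have "f 0 = mode M u (-1) (mode M v n m)
      + scl M ((-1) powi (p * q)) (mode M v (n - 1) (mode M u 0 m))"
    by (simp add: f_def)
  moreover have "f (Suc i) \<in> C2 M" for i
    unfolding f_def using n
    by (intro M.subspace_scale[OF C2_subspace] M.subspace_diff[OF C2_subspace] mode_mem_C2') auto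
  ultimately show ?thesis
    by (simp add: Sum_any_mem_C2)
qed

text \<open>The mode \<open>u\<^sub>0\<close> is a derivation of all modes.  For \<open>n = 0\<close> this is the Jacobi identity of the bracket and for
\<open>n = -1\<close> the Leibniz rule in its second argument.\<close>

lemma commutator_zero_mode:
  assumes "u \<in> deg V p" "v \<in> deg V q"
  shows "mode M u 0 (mode M v n m)
    = mode M (mode V u 0 v) n m + scl M ((-1) powi (p * q)) (mode M v n (mode M u 0 m))"
proof -
  have "(0::complex) gchoose i = 0" if "i \<noteq> 0" for i
    using that by (cases i) auto
  then show ?thesis
    using commutator[OF assms, of 0 n m] by (subst (asm) Sum_any_single[of 0]) (auto simp: algebra_simps)
qed

end


section \<open>Skew-symmetry\<close>

context dgvoa
begin

definition "skew_tail u v n = Sum_any (\<lambda>i::nat. scl V ((of_int (-1) :: complex) gchoose Suc i)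
          (mode V (mode V u (1 + int i) v) (n - 2 - int i) (vac V)))"

text \<open>Skew-symmetry is the commutator of \<open>u\<^sub>-\<^sub>1\<close> and \<open>v\<^sub>n\<close> on the vacuum, where \<open>u\<^sub>-\<^sub>1\<close> creates \<open>u\<close>.  The first
term of the sum is separated, because it is the leading one.\<close>

lemma commutator_vac:
  assumes "u \<in> deg V p" "v \<in> deg V q"
  shows "mode V u (-1) (mode V v n (vac V)) - scl V ((-1) powi (p * q)) (mode V v n u)
    = mode V (mode V u 0 v) (n - 1) (vac V)
      + skew_tail u v n"
proof -
  let ?f = "\<lambda>i::nat. scl V ((of_int (-1) :: complex) gchoose i)
      (mode V (mode V u (int i) v) (-1 + n - int i) (vac V))"
  obtain N :: nat where "\<And>i. i \<ge> N \<Longrightarrow> mode V u (0 + int i) v = 0"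
    using self.mode_bounded[of u 0 v] by metis
  then have fin: "finite {i. ?f i \<noteq> 0}"
    by (intro finite_nat_support[of N]) simp
  show ?thesis
    using self.commutator[OF assms, of "-1" n "vac V"]
    unfolding Sum_any_nat_Suc[OF fin] creation by (simp add: skew_tail_def algebra_simps)
qed

lemma skew_bracket:
  assumes "u \<in> deg V p" "v \<in> deg V q"
  shows "mode V v 0 u + scl V ((-1) powi (p * q)) (mode V u 0 v)
    = scl V (- ((-1) powi (p * q))) (skew_tail u v 0)"
proof -
  define e where "e = ((-1) powi (p * q) :: complex)"
  have "- scl V e (mode V v 0 u) = mode V u 0 v + skew_tail u v 0"
    using commutator_vac[OF assms, of 0] by (simp add: creation creation_nonneg e_def)
  then have "scl V (- e) (- scl V e (mode V v 0 u)) = scl V (- e) (mode V u 0 v + skew_tail u v 0)"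
    by simp
  then have "mode V v 0 u + scl V e (mode V u 0 v) = scl V (- e) (skew_tail u v 0)"
    by (simp add: e_def V.scale_right_distrib)
  then show ?thesis
    by (simp only: e_def)
qed

lemma skew_C2:
  assumes uv: "u \<in> deg V p" "v \<in> deg V q"
  shows "mode V u (-1) v - scl V ((-1) powi (p * q)) (mode V v (-1) u) \<in> C2 V"
    and "mode V v 0 u + scl V ((-1) powi (p * q)) (mode V u 0 v) \<in> C2 V"
proof -
  note sub = self.C2_subspace
  have tail: "skew_tail u v n \<in> C2 V" if "n \<le> 0" for n
    unfolding skew_tail_def using that
    by (intro self.Sum_any_mem_C2 V.subspace_scale[OF sub] self.mode_mem_C2') simp
  show "mode V u (-1) v - scl V ((-1) powi (p * q)) (mode V v (-1) u) \<in> C2 V"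
    using commutator_vac[OF uv, of "-1"]
    by (auto simp: creation intro!: V.subspace_add[OF sub] tail self.mode_mem_C2')
  show "mode V v 0 u + scl V ((-1) powi (p * q)) (mode V u 0 v) \<in> C2 V"
    unfolding skew_bracket[OF uv] by (intro V.subspace_scale[OF sub] tail) simp
qed

text \<open>The vector \<open>a\<^sub>-\<^sub>2\<^sub>-\<^sub>j 1\<close> has degree \<open>d + 2 + 2 j\<close>, but modulo \<open>O(V)\<close> it is of degree at most \<open>d\<close>.  Indeed the
residue of \<open>x\<^sup>-\<^sup>2\<^sup>-\<^sup>j (1 + x)\<^sup>r Y(a, x) 1\<close> lies in \<open>O(V)\<close>, and its terms after the first are multiples of
\<open>a\<^sub>-\<^sub>1\<^sub>-\<^sub>j 1, \<dots>, a\<^sub>-\<^sub>1 1 = a\<close>, to which induction applies.\<close>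

lemma creation_OFil:
  assumes a: "a \<in> deg V d"
  shows "mode V a (-2 - int j) (vac V) \<in> self.OFil d"
proof -
  have "a \<in> {a. mode V a (-2 - int j) (vac V) \<in> self.OFil d}"
  proof (rule wt_induct[OF _ a])
    show "V.subspace {a. mode V a (-2 - int j) (vac V) \<in> self.OFil d}"
      by (rule self.VM_vimage[OF self.OFil_subspace self.mode_add_left self.mode_scale_left])
    fix r assume r: "r \<in> half_ints"
    show "wt_space V r \<inter> deg V d \<subseteq> {a. mode V a (-2 - int j) (vac V) \<in> self.OFil d}"
    proof safe
      fix a assume a: "a \<in> wt_space V r" "a \<in> deg V d"
      show "mode V a (-2 - int j) (vac V) \<in> self.OFil d"
      proof (induction j rule: less_induct)
        case (less j)
        let ?t = "\<lambda>n. scl V (of_real r gchoose Suc n)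
          (mode V a (-2 - int j + 1 + int n) (vac V))"
        have "?t n \<in> self.OFil d" for n
        proof (rule V.subspace_scale[OF self.OFil_subspace])
          consider "n < j" | "n = j" | "n > j" by linarith
          then show "mode V a (-2 - int j + 1 + int n) (vac V) \<in> self.OFil d"
          proof cases
            case 1
            then have "-2 - int j + 1 + int n = -2 - int (j - Suc n)" by simp
            then show ?thesis
              using less.IH[of "j - Suc n"] 1 by (simp only:)
          next
            case 2
            then show ?thesis
              using self.Fil_OFil[OF self.deg_Fil[OF a(2) order_refl]] by (simp add: creation)
          next
            case 3
            then show ?thesis
              using V.subspace_0[OF self.OFil_subspace] by (simp add: creation_nonneg)
          qed
        qed
        then have "Sum_any ?t \<in> self.OFil d"
          by (rule self.Sum_any_mem_OFil)
        moreover have "mode V a (-2 - int j) (vac V)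
            = ser V (of_real r) (-2 - int j) a (vac V) - Sum_any ?t"
          by (simp add: self.ser_eq_leading)
        ultimately show ?case
          using self.O_OFil[OF self.ser_mem_O[OF r a(1), of j "vac V"]]
          by (simp add: V.subspace_diff[OF self.OFil_subspace])
      qed
    qed
  qed
  then show ?thesis by simp
qed

text \<open>The bracket of \<open>gr A(V)\<close> lies two degrees below the products that define it, so both leading terms of
\<open>u * v\<close> and \<open>v * u\<close> enter.  For \<open>u\<close>, \<open>v\<close> of weights \<open>r\<close>, \<open>t\<close> and \<open>a = u\<^sub>0 v\<close>, which has weight
\<open>r + t - 1\<close>, skew-symmetry gives \<open>u\<^sub>-\<^sub>1 v - (\<plusminus>) v\<^sub>-\<^sub>1 u \<equiv> L(-1) a \<equiv> - (r + t - 1) a\<close> modulo \<open>O(V)\<close> and lower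
terms.  The second terms \<open>r u\<^sub>0 v\<close> and \<open>t v\<^sub>0 u\<close> contribute \<open>(r + t) a\<close>, and \<open>a\<close> remains.\<close>

lemma star_l_commutator:
  assumes u: "u \<in> deg V p" and v: "v \<in> deg V q"
  shows "star_l V V u v - scl V ((-1) powi (p * q)) (star_l V V v u) - mode V u 0 v
    \<in> self.OFil (p + q - 4)"
proof -
  define e where "e = ((-1) powi (p * q) :: complex)"
  have ee: "e * e = 1" by (simp add: e_def)
  let ?Z = "self.OFil (p + q - 4)"
  note Z = self.OFil_subspace[of "p + q - 4"]
  define D where "D u v = star_l V V u v - scl V e (star_l V V v u) - mode V u 0 v" for u v
  have hom: "D u v \<in> ?Z"
    if r: "r \<in> half_ints" and u: "u \<in> wt_space V r" "u \<in> deg V p"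
      and t: "t \<in> half_ints" and v: "v \<in> wt_space V t" "v \<in> deg V q" for r t u v
  proof -
    define a where "a = mode V u 0 v"
    have a: "a \<in> deg V (p + q - 2)"
      using self.mode_deg[OF u(2) v(2), of 0] by (simp add: a_def algebra_simps)
    have awt: "a \<in> wt_space V (r + t - 1)"
      using wt_mode[OF u v(1), of 0] by (simp add: a_def)
    have rt: "r + t - 1 \<in> half_ints"
      using half_ints_add_int[OF half_ints_add[OF r t], of "-1"] by simp
    have tail: "skew_tail u v n \<in> ?Z" if "n \<le> 0" for n
      unfolding skew_tail_def
    proof (rule self.Sum_any_mem_OFil, rule V.subspace_scale[OF Z])
      fix i
      have "mode V u (1 + int i) v \<in> deg V (q + (p - 2 * (1 + int i) - 2))"
        by (rule self.mode_deg[OF u(2) v(2)])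
      from creation_OFil[OF this, of "nat (- n) + i"]
      have "mode V (mode V u (1 + int i) v) (n - 2 - int i) (vac V)
          \<in> self.OFil (q + (p - 2 * (1 + int i) - 2))"
        using that by (simp add: algebra_simps)
      then show "mode V (mode V u (1 + int i) v) (n - 2 - int i) (vac V) \<in> ?Z"
        using self.OFil_mono[of "q + (p - 2 * (1 + int i) - 2)" "p + q - 4"] by auto
    qed
    have 1: "mode V u (-1) v - scl V e (mode V v (-1) u) + scl V (of_real (r + t - 1)) a \<in> ?Z"
    proof -
      have "ser V (of_real (r + t - 1)) (-2) a (vac V) \<in> ?Z"
        by (rule self.O_OFil[OF self.ser_circ_mem[OF rt awt]])
      moreover have "ser V (of_real (r + t - 1)) (-2) a (vac V)
          = mode V a (-2) (vac V) + scl V (of_real (r + t - 1)) a"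
        unfolding self.ser_eq_leading
        by (subst Sum_any_single[of 0]) (simp_all add: creation creation_nonneg)
      moreover have "mode V u (-1) v - scl V e (mode V v (-1) u)
          = mode V a (-2) (vac V) + skew_tail u v (-1)"
        using commutator_vac[OF u(2) v(2), of "-1"] by (simp add: creation e_def a_def)
      ultimately have "mode V u (-1) v - scl V e (mode V v (-1) u) + scl V (of_real (r + t - 1)) a
          = ser V (of_real (r + t - 1)) (-2) a (vac V)
            + skew_tail u v (-1)"
        by simp
      then show ?thesis
        using V.subspace_add[OF Z \<open>ser V _ _ _ _ \<in> _\<close> tail[of "-1"]] by simp
    qed
    have 2: "mode V v 0 u + scl V e a \<in> ?Z"
      using V.subspace_scale[OF Z tail[of 0], of "- e"] skew_bracket[OF u(2) v(2)]
      by (simp add: e_def a_def)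
    have 3: "star_l V V u v - mode V u (-1) v - scl V (of_real r) a \<in> ?Z"
      using self.Fil_OFil[OF self.ser_second[OF u(2) v(2), of "of_real r" "-1"]]
      by (simp add: self.star_l_eq self.wser_homogeneous[OF r u(1)] a_def)
    have 4: "star_l V V v u - mode V v (-1) u - scl V (of_real t) (mode V v 0 u) \<in> ?Z"
      using self.Fil_OFil[OF self.ser_second[OF v(2) u(2), of "of_real t" "-1"]]
      by (simp add: self.star_l_eq self.wser_homogeneous[OF t v(1)] add.commute)
    have "D u v = (star_l V V u v - mode V u (-1) v - scl V (of_real r) a)
        - scl V e (star_l V V v u - mode V v (-1) u - scl V (of_real t) (mode V v 0 u))
        + (mode V u (-1) v - scl V e (mode V v (-1) u) + scl V (of_real (r + t - 1)) a)
        - scl V (of_real t * e) (mode V v 0 u + scl V e a)"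
      using ee by (simp add: D_def a_def V.scale_right_distrib V.scale_right_diff_distrib
          V.scale_left_distrib V.scale_left_diff_distrib algebra_simps)
    then show ?thesis
      using V.subspace_diff[OF Z V.subspace_add[OF Z V.subspace_diff[OF Z 3
          V.subspace_scale[OF Z 4]] 1] V.subspace_scale[OF Z 2]] by simp
  qed
  have *: "D u v \<in> ?Z" if r: "r \<in> half_ints" and u: "u \<in> wt_space V r" "u \<in> deg V p" for r u
  proof -
    have "v \<in> {v. D u v \<in> ?Z}"
    proof (rule wt_induct[OF _ v])
      show "V.subspace {v. D u v \<in> ?Z}"
        by (rule self.VM_vimage[OF Z])
          (simp_all add: D_def self.star_l_eq self.wser_add_left self.wser_add_right
            self.wser_scale_left self.wser_scale_right self.mode_add_right self.mode_scale_right
            V.scale_right_distrib V.scale_right_diff_distrib mult.commute)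
    qed (use hom[OF r u] in blast)
    then show ?thesis by simp
  qed
  have "u \<in> {u. D u v \<in> ?Z}"
  proof (rule wt_induct[OF _ u])
    show "V.subspace {u. D u v \<in> ?Z}"
      by (rule self.VM_vimage[OF Z])
        (simp_all add: D_def self.star_l_eq self.wser_add_left self.wser_add_right
          self.wser_scale_left self.wser_scale_right self.mode_add_left self.mode_scale_left
          V.scale_right_distrib V.scale_right_diff_distrib mult.commute)
  qed (use * in blast)
  then show ?thesis by (simp add: D_def e_def)
qed

end


section \<open>Kernels of the class maps\<close>

context dgvoa_module
begin

lemma mode_deg_action: "u \<in> deg V p \<Longrightarrow> m \<in> deg M q \<Longrightarrow> mode M u (-1) m \<in> deg M (p + q)"
  and mode_deg_bracket: "u \<in> deg V p \<Longrightarrow> m \<in> deg M q \<Longrightarrow> mode M u 0 m \<in> deg M (p + q - 2)"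
  using mode_deg[of u p m q "-1"] mode_deg[of u p m q 0] by (simp_all add: algebra_simps)

text \<open>The vectors of degree \<open>p\<close> whose class in \<open>gr A(M)\<close> vanishes.\<close>

definition "gr_kernel p = deg M p \<inter> OFil (p - 1)"

lemma gr_kernel_subspace: "M.subspace (gr_kernel p)"
  unfolding gr_kernel_def by (rule M.subspace_inter[OF deg_subspace OFil_subspace])

lemma mode_sub_wser_OFil:
  assumes "u \<in> deg V p" "m \<in> deg M q"
  shows "wser e k u m - mode M u k m \<in> OFil (p + q - 2 * k - 3)"
  using Fil_OFil[OF wser_leading[OF assms, of e k]] OFil_mono[of "p + q - 2 * k - 4" "p + q - 2 * k - 3"]
  by auto

lemma dif_gr_kernel: "m \<in> gr_kernel p \<Longrightarrow> dif M m \<in> gr_kernel (p + 1)"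
  unfolding gr_kernel_def using dif_deg dif_OFil[of m "p - 1"] by simp

text \<open>The generator \<open>u \<circ> m\<close> of \<open>O(M)\<close> has the leading term \<open>u\<^sub>-\<^sub>2 m\<close>.  Elements of \<open>C\<^sub>2(M)\<close> are sums of vectors of
various degrees, so the induction is on the statement for all degree components.\<close>

lemma C2_gr_kernel:
  assumes x: "x \<in> C2 M" "x \<in> deg M p"
  shows "x \<in> gr_kernel p"
proof -
  have "x \<in> (\<Inter>p. {x. deg_part M p x \<in> OFil (p - 1)})"
  proof (rule C2_induct[OF _ _ x(1)])
    have "M.subspace {x. deg_part M p x \<in> OFil (p - 1)}" for p
      by (rule MM_vimage[OF OFil_subspace])
        (simp_all add: deg_part_def M.component_add[OF deg_sum] M.component_scale[OF deg_sum])
    then show "M.subspace (\<Inter>p. {x. deg_part M p x \<in> OFil (p - 1)})"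
      by (intro M.subspace_Inter) auto
    fix p q u m assume u: "u \<in> deg V p" and m: "m \<in> deg M q"
    have d: "mode M u (-2) m \<in> deg M (p + q + 2)"
      using mode_deg[OF u m, of "-2"] by (simp add: algebra_simps)
    have "u \<in> {u. mode M u (-2) m \<in> OFil (p + q + 1)}"
    proof (rule wt_induct[OF VM_vimage[OF OFil_subspace mode_add_left mode_scale_left] u])
      fix r assume r: "r \<in> half_ints"
      show "wt_space V r \<inter> deg V p \<subseteq> {u. mode M u (-2) m \<in> OFil (p + q + 1)}"
      proof safe
        fix u assume u: "u \<in> wt_space V r" "u \<in> deg V p"
        have "ser M (of_real r) (-2) u m - (ser M (of_real r) (-2) u m - mode M u (-2) m)
            \<in> OFil (p + q + 1)"
        proof (rule M.subspace_diff[OF OFil_subspace])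
          show "ser M (of_real r) (-2) u m \<in> OFil (p + q + 1)"
            by (rule O_OFil[OF ser_circ_mem[OF r u(1)]])
          show "ser M (of_real r) (-2) u m - mode M u (-2) m \<in> OFil (p + q + 1)"
            using Fil_OFil[OF ser_leading[OF u(2) m, of "of_real r" "-2"]]
              OFil_mono[of "p + q" "p + q + 1"] by auto
        qed
        then show "mode M u (-2) m \<in> OFil (p + q + 1)" by simp
      qed
    qed
    then show "mode M u (-2) m \<in> (\<Inter>p. {x. deg_part M p x \<in> OFil (p - 1)})"
      using M.component_homogeneous[OF deg_sum _ d] M.subspace_0[OF OFil_subspace]
      by (simp add: deg_part_def algebra_simps)
  qed
  then have "deg_part M p x \<in> OFil (p - 1)"
    by blast
  then show ?thesis
    using x(2) M.component_homogeneous[OF deg_sum _ x(2), of p] by (simp add: gr_kernel_def deg_part_def)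
qed

end

context dgvoa_module
begin

text \<open>Write \<open>u\<close> as an element of \<open>O(V)\<close> plus lower terms.  The Zhu product and commutator of the first summand
with \<open>m\<close> lie in \<open>O(M)\<close>, those of the second have lower degree, and those of \<open>u\<close> agree with \<open>u\<^sub>-\<^sub>1 m\<close> and
\<open>u\<^sub>0 m\<close> up to lower terms.\<close>

lemma mode_gr_kernel_left:
  assumes "u \<in> self.gr_kernel p" "m \<in> deg M q"
  shows "mode M u (-1) m \<in> gr_kernel (p + q)" and "mode M u 0 m \<in> gr_kernel (p + q - 2)"
proof -
  have u: "u \<in> deg V p" "u \<in> self.OFil (p - 1)"
    using assms(1) by (auto simp: self.gr_kernel_def)
  have "mode M u k m \<in> OFil (p + q - 2 * k - 3)" if "e = 0 \<and> k = -1 \<or> e = -1 \<and> k = 0"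
    for e :: complex and k
    using M.subspace_diff[OF OFil_subspace wser_OFil_left[OF that u(2) assms(2)], of "wser e k u m - mode M u k m"]
      mode_sub_wser_OFil[OF u(1) assms(2), of e k] by (simp add: algebra_simps)
  from this[of 0 "-1"] this[of "-1" 0]
  show "mode M u (-1) m \<in> gr_kernel (p + q)" and "mode M u 0 m \<in> gr_kernel (p + q - 2)"
    using mode_deg_action[OF u(1) assms(2)] mode_deg_bracket[OF u(1) assms(2)]
    by (simp_all add: gr_kernel_def algebra_simps)
qed

lemma mode_gr_kernel_right:
  assumes u: "u \<in> deg V p" and "m \<in> gr_kernel q"
  shows "mode M u (-1) m \<in> gr_kernel (p + q)" and "mode M u 0 m \<in> gr_kernel (p + q - 2)"
proof -
  have m: "m \<in> deg M q" "m \<in> OFil (q - 1)"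
    using assms(2) by (auto simp: gr_kernel_def)
  have "mode M u k m \<in> OFil (p + q - 2 * k - 3)" if "e = 0 \<and> k = -1 \<or> e = -1 \<and> k = 0"
    for e :: complex and k
    using M.subspace_diff[OF OFil_subspace wser_OFil_right[OF that u m(2)], of "wser e k u m - mode M u k m"]
      mode_sub_wser_OFil[OF u m(1), of e k] by (simp add: algebra_simps)
  from this[of 0 "-1"] this[of "-1" 0]
  show "mode M u (-1) m \<in> gr_kernel (p + q)" and "mode M u 0 m \<in> gr_kernel (p + q - 2)"
    using mode_deg_action[OF u m(1)] mode_deg_bracket[OF u m(1)]
    by (simp_all add: gr_kernel_def algebra_simps)
qed

text \<open>The vectors of degree \<open>p\<close> whose class in \<open>R(M)\<close> lies in \<open>(Ker \<eta>) R(M)\<close>.\<close>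

abbreviation "eta_kernel_gen p \<equiv> {mode M u (-1) m | q u m. u \<in> self.gr_kernel q \<and> m \<in> deg M (p - q)}"

definition "eta_kernel p = {x + y | x y. x \<in> M.span (eta_kernel_gen p) \<and> y \<in> C2 M \<inter> deg M p}"

lemma C2_deg_subspace: "M.subspace (C2 M \<inter> deg M p)"
  by (rule M.subspace_inter[OF C2_subspace deg_subspace])

lemma eta_kernel_subspace: "M.subspace (eta_kernel p)"
  unfolding eta_kernel_def by (rule M.subspace_sums[OF M.subspace_span C2_deg_subspace])

lemma C2_eta_kernel: "C2 M \<inter> deg M p \<subseteq> eta_kernel p"
  unfolding eta_kernel_def using M.span_zero by force

lemma action_eta_kernel: "u \<in> self.gr_kernel p \<Longrightarrow> m \<in> deg M q \<Longrightarrow> mode M u (-1) m \<in> eta_kernel (p + q)"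
proof -
  assume um: "u \<in> self.gr_kernel p" "m \<in> deg M q"
  then have "mode M u (-1) m \<in> M.span (eta_kernel_gen (p + q))"
    by (intro M.span_base CollectI exI[of _ p] exI[of _ u] exI[of _ m]) simp
  then show ?thesis
    unfolding eta_kernel_def using M.subspace_0[OF C2_deg_subspace] by force
qed

lemma eta_kernel_minimal:
  assumes U: "M.subspace U" and "C2 M \<inter> deg M p \<subseteq> U"
    and gen: "\<And>q u m. u \<in> self.gr_kernel q \<Longrightarrow> m \<in> deg M (p - q) \<Longrightarrow> mode M u (-1) m \<in> U"
  shows "eta_kernel p \<subseteq> U"
proof -
  have "M.span (eta_kernel_gen p) \<subseteq> U"
    by (rule M.span_minimal[OF _ U]) (use gen in auto)
  then show ?thesis
    unfolding eta_kernel_def using assms(2) M.subspace_add[OF U] by blast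
qed

lemma eta_kernel_gr_kernel: "eta_kernel p \<subseteq> gr_kernel p"
proof (rule eta_kernel_minimal[OF gr_kernel_subspace])
  show "mode M u (-1) m \<in> gr_kernel p" if "u \<in> self.gr_kernel q" "m \<in> deg M (p - q)" for q u m
    using mode_gr_kernel_left(1)[OF that] by simp
qed (use C2_gr_kernel in blast)

lemma eta_kernel_deg: "eta_kernel p \<subseteq> deg M p"
  using eta_kernel_gr_kernel by (auto simp: gr_kernel_def)

lemma dif_eta_kernel: "m \<in> eta_kernel p \<Longrightarrow> dif M m \<in> eta_kernel (p + 1)"
proof -
  assume m: "m \<in> eta_kernel p"
  have "eta_kernel p \<subseteq> {m. dif M m \<in> eta_kernel (p + 1)}"
  proof (rule eta_kernel_minimal[OF MM_vimage[OF eta_kernel_subspace dif_add dif_scale]])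
    show "C2 M \<inter> deg M p \<subseteq> {m. dif M m \<in> eta_kernel (p + 1)}"
      using dif_C2 dif_deg C2_eta_kernel[of "p + 1"] by blast
    fix q u m assume u: "u \<in> self.gr_kernel q" and m: "m \<in> deg M (p - q)"
    have "mode M (dif V u) (-1) m \<in> eta_kernel (p + 1)" "mode M u (-1) (dif M m) \<in> eta_kernel (p + 1)"
      using action_eta_kernel[OF self.dif_gr_kernel[OF u] m] action_eta_kernel[OF u dif_deg[OF m]]
      by (simp_all add: algebra_simps)
    moreover have "u \<in> deg V q"
      using u by (simp add: self.gr_kernel_def)
    ultimately show "mode M u (-1) m \<in> {m. dif M m \<in> eta_kernel (p + 1)}"
      by (simp add: dif_mode M.subspace_add[OF eta_kernel_subspace] M.subspace_scale[OF eta_kernel_subspace])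
  qed
  with m show ?thesis by blast
qed

end

context dgvoa_module
begin

lemma iterate_bracket_mod_C2:
  assumes "u \<in> deg V p" "v \<in> deg V q"
  shows "mode M (mode V u (-1) v) 0 m
    - (mode M u (-1) (mode M v 0 m) + scl M ((-1) powi (p * q)) (mode M v (-1) (mode M u 0 m)))
    \<in> C2 M"
  using iterate_mod_C2[OF assms, of 0 m] by simp

lemma iterate_action_mod_C2:
  assumes "u \<in> deg V p" "v \<in> deg V q"
  shows "mode M (mode V u (-1) v) (-1) m - mode M u (-1) (mode M v (-1) m) \<in> C2 M"
proof -
  have "scl M ((-1) powi (p * q)) (mode M v (-2) (mode M u 0 m)) \<in> C2 M"
    by (intro M.subspace_scale[OF C2_subspace] mode_mem_C2') simp
  from M.subspace_add[OF C2_subspace iterate_mod_C2[OF assms, of "-1" m] this]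
  show ?thesis by (simp add: algebra_simps)
qed

text \<open>The commutator of \<open>v\<^sub>-\<^sub>1\<close> and \<open>u\<^sub>-\<^sub>1\<close> consists of modes of index \<open>-2 - i\<close>.\<close>

lemma action_swap_mod_C2:
  assumes u: "u \<in> deg V p" and v: "v \<in> deg V q"
  shows "mode M v (-1) (mode M u (-1) m)
    - scl M ((-1) powi (q * p)) (mode M u (-1) (mode M v (-1) m)) \<in> C2 M"
proof -
  have "mode M v (-1) (mode M u (-1) m)
      - scl M ((-1) powi (q * p)) (mode M u (-1) (mode M v (-1) m))
    = Sum_any (\<lambda>i::nat. scl M ((of_int (-1) :: complex) gchoose i)
          (mode M (mode V v (int i) u) (-1 + -1 - int i) m))"
    by (rule commutator[OF v u])
  also have "\<dots> \<in> C2 M"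
    by (intro Sum_any_mem_C2 M.subspace_scale[OF C2_subspace] mode_mem_C2') simp
  finally show ?thesis .
qed

text \<open>On a generator \<open>u\<^sub>-\<^sub>1 m\<close> with \<open>u\<close> in the kernel of \<open>\<eta>\<close>, the operators \<open>v\<^sub>-\<^sub>1\<close> and \<open>v\<^sub>0\<close> can be moved past
\<open>u\<^sub>-\<^sub>1\<close>, at the cost of an element of \<open>C\<^sub>2(M)\<close> and of the term \<open>(v\<^sub>0 u)\<^sub>-\<^sub>1 m\<close>; here \<open>v\<^sub>0 u\<close> is again in the
kernel.\<close>

lemma mode_eta_kernel:
  assumes v: "v \<in> deg V q"
  shows "m \<in> eta_kernel p \<Longrightarrow> mode M v (-1) m \<in> eta_kernel (q + p)"
    and "m \<in> eta_kernel p \<Longrightarrow> mode M v 0 m \<in> eta_kernel (q + p - 2)"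
proof -
  note sub = MM_vimage[OF eta_kernel_subspace, of "mode M v k" for k, OF mode_add_right mode_scale_right]
  have "eta_kernel p \<subseteq> {m. mode M v (-1) m \<in> eta_kernel (q + p)}"
  proof (rule eta_kernel_minimal[OF sub])
    show "C2 M \<inter> deg M p \<subseteq> {m. mode M v (-1) m \<in> eta_kernel (q + p)}"
      using mode_C2_right[OF _ v, of "-1"] mode_deg_action[OF v] C2_eta_kernel[of "q + p"] by auto
    fix q' u m assume u: "u \<in> self.gr_kernel q'" and m: "m \<in> deg M (p - q')"
    have ud: "u \<in> deg V q'"
      using u by (simp add: self.gr_kernel_def)
    have "mode M u (-1) (mode M v (-1) m) \<in> eta_kernel (q + p)"
      using action_eta_kernel[OF u mode_deg_action[OF v m]] by (simp add: algebra_simps)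
    then have 1: "scl M ((-1) powi (q * q')) (mode M u (-1) (mode M v (-1) m)) \<in> eta_kernel (q + p)"
      by (rule M.subspace_scale[OF eta_kernel_subspace])
    have d: "mode M v (-1) (mode M u (-1) m) \<in> deg M (q + p)"
      using mode_deg_action[OF v mode_deg_action[OF ud m]] by simp
    have "mode M v (-1) (mode M u (-1) m)
        - scl M ((-1) powi (q * q')) (mode M u (-1) (mode M v (-1) m)) \<in> C2 M \<inter> deg M (q + p)"
      using action_swap_mod_C2[OF ud v] M.subspace_diff[OF deg_subspace d] 1 eta_kernel_deg by blast
    then have "mode M v (-1) (mode M u (-1) m)
        - scl M ((-1) powi (q * q')) (mode M u (-1) (mode M v (-1) m)) \<in> eta_kernel (q + p)"
      using C2_eta_kernel by blast
    from M.subspace_add[OF eta_kernel_subspace this 1]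
    show "mode M u (-1) m \<in> {m. mode M v (-1) m \<in> eta_kernel (q + p)}" by simp
  qed
  then show "m \<in> eta_kernel p \<Longrightarrow> mode M v (-1) m \<in> eta_kernel (q + p)" by blast
  have "eta_kernel p \<subseteq> {m. mode M v 0 m \<in> eta_kernel (q + p - 2)}"
  proof (rule eta_kernel_minimal[OF sub])
    show "C2 M \<inter> deg M p \<subseteq> {m. mode M v 0 m \<in> eta_kernel (q + p - 2)}"
      using mode_C2_right[OF _ v, of 0] mode_deg_bracket[OF v] C2_eta_kernel[of "q + p - 2"] by auto
    fix q' u m assume u: "u \<in> self.gr_kernel q'" and m: "m \<in> deg M (p - q')"
    have ud: "u \<in> deg V q'"
      using u by (simp add: self.gr_kernel_def)
    have "mode M (mode V v 0 u) (-1) m \<in> eta_kernel (q + p - 2)"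
      using action_eta_kernel[OF self.mode_gr_kernel_right(2)[OF v u] m] by (simp add: algebra_simps)
    moreover have "mode M u (-1) (mode M v 0 m) \<in> eta_kernel (q + p - 2)"
      using action_eta_kernel[OF u mode_deg_bracket[OF v m]] by (simp add: algebra_simps)
    ultimately show "mode M u (-1) m \<in> {m. mode M v 0 m \<in> eta_kernel (q + p - 2)}"
      by (simp add: commutator_zero_mode[OF v ud] M.subspace_add[OF eta_kernel_subspace]
          M.subspace_scale[OF eta_kernel_subspace])
  qed
  then show "m \<in> eta_kernel p \<Longrightarrow> mode M v 0 m \<in> eta_kernel (q + p - 2)" by blast
qed

end


section \<open>Dg Poisson modules presented by vectors\<close>

text \<open>The three predicates say that \<open>W\<close> consists of the classes \<open>c p m\<close> of vectors \<open>m\<close> of \<open>M\<^sup>p\<close> and that its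
operations are induced by \<open>d\<close>, \<open>u\<^sub>-\<^sub>1 m\<close> and \<open>u\<^sub>0 m\<close>.  The classes \<open>cV\<close> of \<open>V\<close> are a separate argument, since
the same \<open>W\<close> can be a module over \<open>R(V)\<close> and over \<open>gr A(V)\<close>.  Compatibility of the operations with the
kernels is implied.\<close>

definition realizes ::
    "('v, 'm::ab_group_add, 'z) vmod_scheme \<Rightarrow> (int \<Rightarrow> 'm set) \<Rightarrow> (int \<Rightarrow> 'm \<Rightarrow> 'x) \<Rightarrow>
      ('a, 'x, 'w) pmod_scheme \<Rightarrow> bool"
  where "realizes M K c W \<longleftrightarrow>
    (\<forall>p. presents (scl M) (deg M p) (K p) (gcomp W p) (c p) \<and> C2 M \<inter> deg M p \<subseteq> K p) \<and>
    (\<forall>p. \<forall>m\<in>deg M p. gdiff W p (c p m) = c (p + 1) (dif M m))"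

definition acts ::
    "('v::ab_group_add) voa \<Rightarrow> ('v, 'm::ab_group_add, 'z) vmod_scheme \<Rightarrow> (int \<Rightarrow> 'v \<Rightarrow> 'a) \<Rightarrow>
      (int \<Rightarrow> 'm \<Rightarrow> 'x) \<Rightarrow> ('a, 'x, 'w) pmod_scheme \<Rightarrow> bool"
  where "acts V M cV c W \<longleftrightarrow>
    (\<forall>p q. \<forall>u\<in>deg V p. \<forall>m\<in>deg M q. gact W p q (cV p u) (c q m) = c (p + q) (mode M u (-1) m))"

definition brackets ::
    "('v::ab_group_add) voa \<Rightarrow> ('v, 'm::ab_group_add, 'z) vmod_scheme \<Rightarrow> (int \<Rightarrow> 'v \<Rightarrow> 'a) \<Rightarrow>
      (int \<Rightarrow> 'm \<Rightarrow> 'x) \<Rightarrow> ('a, 'x, 'w) pmod_scheme \<Rightarrow> bool"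
  where "brackets V M cV c W \<longleftrightarrow>
    (\<forall>p q. \<forall>u\<in>deg V p. \<forall>m\<in>deg M q. gbrk W p q (cV p u) (c q m) = c (p + q - 2) (mode M u 0 m))"

lemma presents_lin_map:
  assumes "presents s U K X c" "presents s' U' K' X' c'"
    and "\<And>x. x \<in> U \<Longrightarrow> f x \<in> U'" "\<And>x y. f (x + y) = f x + f y" "\<And>a x. f (s a x) = s' a (f x)"
    and "\<And>x. x \<in> U \<Longrightarrow> h (c x) = c' (f x)"
  shows "lin_map X X' h"
proof -
  interpret s: vector_space s using assms(1) by (simp add: presents_def)
  have U: "s.subspace U" using assms(1) by (simp add: presents_def)
  show ?thesis
    unfolding lin_map_def presents_carrier[OF assms(1)] presents_carrier[OF assms(2)]
    by (auto simp: assms(3-6) presents_add[OF assms(1)] presents_add[OF assms(2)]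
        presents_scale[OF assms(1)] presents_scale[OF assms(2)]
        s.subspace_add[OF U] s.subspace_scale[OF U])
qed

text \<open>A module without a bracket is included, because in general the bracket on \<open>R(M) / (Ker \<eta>) R(M)\<close> does not
descend to \<open>gr A(V)\<close>.\<close>

locale realization = dgvoa_module V M
  for V :: "('v::ab_group_add) voa" and M :: "('v, 'm::ab_group_add, 'z) vmod_scheme" +
  fixes KV :: "int \<Rightarrow> 'v set" and cV :: "int \<Rightarrow> 'v \<Rightarrow> 'a" and A :: "'a palg"
    and K :: "int \<Rightarrow> 'm set" and c :: "int \<Rightarrow> 'm \<Rightarrow> 'x" and W :: "('a, 'x, 'w) pmod_scheme"
  assumes algebra: "realizes V KV cV A" "acts V V cV cV A" "gunit A = cV 0 (vac V)"
    and module: "realizes M K c W" "acts V M cV c W"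
begin

lemma realization_self: "realization V V KV cV A KV cV A"
  by unfold_locales (rule algebra)+

lemma presents_A: "presents (scl V) (deg V p) (KV p) (gcomp A p) (cV p)"
  using algebra(1) by (simp add: realizes_def)

lemma presents_W: "presents (scl M) (deg M p) (K p) (gcomp W p) (c p)"
  using module(1) by (simp add: realizes_def)

lemma action_A:
  "u \<in> deg V p \<Longrightarrow> v \<in> deg V q \<Longrightarrow> r = p + q \<Longrightarrow> gact A p q (cV p u) (cV q v) = cV r (mode V u (-1) v)"
  using algebra(2) by (simp add: acts_def)

lemma action_W:
  "u \<in> deg V p \<Longrightarrow> m \<in> deg M q \<Longrightarrow> r = p + q \<Longrightarrow> gact W p q (cV p u) (c q m) = c r (mode M u (-1) m)"
  using module(2) by (simp add: acts_def)

lemma differential_A: "u \<in> deg V p \<Longrightarrow> r = p + 1 \<Longrightarrow> gdiff A p (cV p u) = cV r (dif V u)"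
  using algebra(1) by (simp add: realizes_def)

lemma differential_W: "m \<in> deg M p \<Longrightarrow> r = p + 1 \<Longrightarrow> gdiff W p (c p m) = c r (dif M m)"
  using module(1) by (simp add: realizes_def)

text \<open>All congruences modulo \<open>C\<^sub>2(M)\<close> become equalities of classes.\<close>

lemma class_cong: "x \<in> deg M p \<Longrightarrow> y \<in> deg M p \<Longrightarrow> x - y \<in> C2 M \<Longrightarrow> c p x = c p y"
  using module(1) M.subspace_diff[OF deg_subspace] presents_eq[OF presents_W]
  by (fastforce simp: realizes_def)

lemma class_add: "x \<in> deg M p \<Longrightarrow> y \<in> deg M p \<Longrightarrow> c p x \<oplus>\<^bsub>gcomp W p\<^esub> c p y = c p (x + y)"
  by (rule presents_add[OF presents_W])

lemma class_minus: "x \<in> deg M p \<Longrightarrow> y \<in> deg M p \<Longrightarrow> c p x \<ominus>\<^bsub>gcomp W p\<^esub> c p y = c p (x - y)"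
  by (rule presents_minus[OF presents_W])

lemma class_scale: "x \<in> deg M p \<Longrightarrow> a \<odot>\<^bsub>gcomp W p\<^esub> c p x = c p (scl M a x)"
  by (rule presents_scale[OF presents_W])

lemma scale_deg: "x \<in> deg M p \<Longrightarrow> scl M a x \<in> deg M p"
  by (rule M.subspace_scale[OF deg_subspace])

lemma add_deg: "x \<in> deg M p \<Longrightarrow> y \<in> deg M p \<Longrightarrow> x + y \<in> deg M p"
  by (rule M.subspace_add[OF deg_subspace])

lemma deg_cong: "x \<in> deg M p \<Longrightarrow> p = q \<Longrightarrow> x \<in> deg M q"
  by simp

lemma graded_module_axioms: "graded_module_axioms A W"
  unfolding graded_module_axioms_def bilin_map_def presents_carrier[OF presents_A]
    presents_carrier[OF presents_W] ball_simps
proof (intro conjI allI ballI)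
  show "Module.module CC (gcomp W p)" for p
    by (rule presents_module[OF presents_W])
  show "lin_map (gcomp W q) (gcomp W (p + q)) (gact W p q (cV p u))" if "u \<in> deg V p" for p q u
    by (rule presents_lin_map[where f = "mode M u (-1)", OF presents_W presents_W])
      (use that in \<open>auto simp: mode_deg_action mode_add_right mode_scale_right action_W\<close>)
  show "lin_map (gcomp A p) (gcomp W (p + q)) (\<lambda>a. gact W p q a (c q m))"
    if "m \<in> deg M q" for p q m
    by (rule presents_lin_map[where f = "\<lambda>u. mode M u (-1) m", OF presents_A presents_W])
      (use that in \<open>auto simp: mode_deg_action mode_add_left mode_scale_left action_W\<close>)
  show "gact W 0 p (gunit A) (c p m) = c p m" if "m \<in> deg M p" for p m
    unfolding algebra(3) using that by (simp add: action_W[OF vac_deg] vac_mode)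
  show "gact W (p + q) r (gact A p q (cV p u) (cV q v)) (c r m)
      = gact W p (q + r) (cV p u) (gact W q r (cV q v) (c r m))"
    if u: "u \<in> deg V p" and v: "v \<in> deg V q" and m: "m \<in> deg M r" for p q r u v m
  proof -
    have "gact W (p + q) r (gact A p q (cV p u) (cV q v)) (c r m)
        = c (p + q + r) (mode M (mode V u (-1) v) (-1) m)"
      by (simp add: action_A[OF u v] action_W[OF self.mode_deg_action[OF u v] m])
    also have "\<dots> = c (p + q + r) (mode M u (-1) (mode M v (-1) m))"
    proof (rule class_cong)
      show "mode M (mode V u (-1) v) (-1) m \<in> deg M (p + q + r)"
        by (rule mode_deg_action[OF self.mode_deg_action[OF u v] m])
      show "mode M u (-1) (mode M v (-1) m) \<in> deg M (p + q + r)"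
        using mode_deg_action[OF u mode_deg_action[OF v m]] by (simp add: add.assoc)
    qed (rule iterate_action_mod_C2[OF u v])
    also have "\<dots> = gact W p (q + r) (cV p u) (gact W q r (cV q v) (c r m))"
      by (simp add: action_W[OF v m] action_W[OF u mode_deg_action[OF v m]] add.assoc)
    finally show ?thesis .
  qed
qed

lemma dg_axioms: "dg_axioms A W"
  unfolding dg_axioms_def presents_carrier[OF presents_A] presents_carrier[OF presents_W] ball_simps
proof (intro conjI allI ballI)
  show "lin_map (gcomp W p) (gcomp W (p + 1)) (gdiff W p)" for p
    by (rule presents_lin_map[where f = "dif M", OF presents_W presents_W])
      (auto simp: dif_deg dif_add dif_scale differential_W)
  show "gdiff W (p + 1) (gdiff W p (c p m)) = \<zero>\<^bsub>gcomp W (p + 2)\<^esub>" if m: "m \<in> deg M p" for p m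
  proof -
    have "gdiff W (p + 1) (gdiff W p (c p m)) = c (p + 2) (dif M (dif M m))"
      unfolding differential_W[OF m refl] by (rule differential_W[OF dif_deg[OF m]]) simp
    then show ?thesis
      by (simp add: dif_dif presents_zero[OF presents_W])
  qed
  show "gdiff W (p + q) (gact W p q (cV p u) (c q m))
      = gact W (p + 1) q (gdiff A p (cV p u)) (c q m)
        \<oplus>\<^bsub>gcomp W (p + q + 1)\<^esub>
        ((-1) powi p) \<odot>\<^bsub>gcomp W (p + q + 1)\<^esub> gact W p (q + 1) (cV p u) (gdiff W q (c q m))"
    if u: "u \<in> deg V p" and m: "m \<in> deg M q" for p q u m
  proof -
    have d: "mode M (dif V u) (-1) m \<in> deg M (p + q + 1)" "mode M u (-1) (dif M m) \<in> deg M (p + q + 1)"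
      using mode_deg_action[OF self.dif_deg[OF u] m] mode_deg_action[OF u dif_deg[OF m]]
      by (simp_all add: add_ac)
    have "gdiff W (p + q) (gact W p q (cV p u) (c q m)) = c (p + q + 1) (dif M (mode M u (-1) m))"
      by (simp add: action_W[OF u m] differential_W[OF mode_deg_action[OF u m]])
    moreover have "gact W (p + 1) q (gdiff A p (cV p u)) (c q m)
        = c (p + q + 1) (mode M (dif V u) (-1) m)"
      unfolding differential_A[OF u refl] by (rule action_W[OF self.dif_deg[OF u] m]) simp
    moreover have "gact W p (q + 1) (cV p u) (gdiff W q (c q m))
        = c (p + q + 1) (mode M u (-1) (dif M m))"
      unfolding differential_W[OF m refl] by (rule action_W[OF u dif_deg[OF m]]) simp
    ultimately show ?thesis
      by (simp add: class_scale[OF d(2)] class_add[OF d(1) scale_deg[OF d(2)]] dif_mode[OF u])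
  qed
qed

end

locale poisson_realization = realization V M KV cV A K c W
  for V :: "('v::ab_group_add) voa" and M :: "('v, 'm::ab_group_add, 'z) vmod_scheme"
    and KV :: "int \<Rightarrow> 'v set" and cV :: "int \<Rightarrow> 'v \<Rightarrow> 'a" and A :: "'a palg"
    and K :: "int \<Rightarrow> 'm set" and c :: "int \<Rightarrow> 'm \<Rightarrow> 'x" and W :: "('a, 'x, 'w) pmod_scheme" +
  assumes brackets: "brackets V V cV cV A" "brackets V M cV c W"
begin

lemma poisson_realization_self: "poisson_realization V V KV cV A KV cV A"
  by (intro poisson_realization.intro poisson_realization_axioms.intro realization_self brackets)

lemma bracket_A:
  "u \<in> deg V p \<Longrightarrow> v \<in> deg V q \<Longrightarrow> r = p + q - 2 \<Longrightarrow> gbrk A p q (cV p u) (cV q v) = cV r (mode V u 0 v)"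
  using brackets(1) by (simp add: brackets_def)

lemma bracket_W:
  "u \<in> deg V p \<Longrightarrow> m \<in> deg M q \<Longrightarrow> r = p + q - 2 \<Longrightarrow> gbrk W p q (cV p u) (c q m) = c r (mode M u 0 m)"
  using brackets(2) by (simp add: brackets_def)

lemma poisson_axioms: "poisson_axioms A W"
  unfolding poisson_axioms_def bilin_map_def presents_carrier[OF presents_A]
    presents_carrier[OF presents_W] ball_simps
proof (intro conjI allI ballI)
  show "lin_map (gcomp W q) (gcomp W (p + q - 2)) (gbrk W p q (cV p u))" if "u \<in> deg V p" for p q u
    by (rule presents_lin_map[where f = "mode M u 0", OF presents_W presents_W])
      (use that in \<open>auto simp: mode_deg_bracket mode_add_right mode_scale_right bracket_W\<close>)
  show "lin_map (gcomp A p) (gcomp W (p + q - 2)) (\<lambda>a. gbrk W p q a (c q m))"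
    if "m \<in> deg M q" for p q m
    by (rule presents_lin_map[where f = "\<lambda>u. mode M u 0 m", OF presents_A presents_W])
      (use that in \<open>auto simp: mode_deg_bracket mode_add_left mode_scale_left bracket_W\<close>)
next
  fix p q r u v m assume u: "u \<in> deg V p" and v: "v \<in> deg V q" and m: "m \<in> deg M r"
  let ?e = "(-1) powi (p * q) :: complex"
  note um = mode_deg_bracket[OF u m] and vm = mode_deg_bracket[OF v m]
    and uv = self.mode_deg_bracket[OF u v]
  \<comment> \<open>The composites of brackets (\<open>bb\<close>), of an action after a bracket (\<open>ab\<close>) and of a bracket after an
    action (\<open>ba\<close>), as classes of vectors in the degrees in which the axioms compare them.\<close>
  have bb: "gbrk W p (q + r - 2) (cV p u) (gbrk W q r (cV q v) (c r m))
      = c (p + q + r - 4) (mode M u 0 (mode M v 0 m))"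
    "gbrk W q (p + r - 2) (cV q v) (gbrk W p r (cV p u) (c r m))
      = c (p + q + r - 4) (mode M v 0 (mode M u 0 m))"
    "gbrk W (p + q - 2) r (gbrk A p q (cV p u) (cV q v)) (c r m)
      = c (p + q + r - 4) (mode M (mode V u 0 v) 0 m)"
    unfolding bracket_W[OF v m refl] bracket_W[OF u m refl] bracket_A[OF u v refl]
    by (rule bracket_W[OF u vm] bracket_W[OF v um] bracket_W[OF uv m], simp)+
  have db: "mode M u 0 (mode M v 0 m) \<in> deg M (p + q + r - 4)"
    "mode M v 0 (mode M u 0 m) \<in> deg M (p + q + r - 4)"
    by (rule deg_cong[OF mode_deg_bracket[OF u vm]] deg_cong[OF mode_deg_bracket[OF v um]], simp)+
  show "gbrk W (p + q - 2) r (gbrk A p q (cV p u) (cV q v)) (c r m)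
      = gbrk W p (q + r - 2) (cV p u) (gbrk W q r (cV q v) (c r m))
        \<ominus>\<^bsub>gcomp W (p + q + r - 4)\<^esub> ?e \<odot>\<^bsub>gcomp W (p + q + r - 4)\<^esub>
          gbrk W q (p + r - 2) (cV q v) (gbrk W p r (cV p u) (c r m))"
    unfolding bb class_scale[OF db(2)] class_minus[OF db(1) scale_deg[OF db(2)]]
    by (simp add: commutator_zero_mode[OF u v])
  have ab: "gact W (p + q - 2) r (gbrk A p q (cV p u) (cV q v)) (c r m)
      = c (p + q + r - 2) (mode M (mode V u 0 v) (-1) m)"
    "gact W q (p + r - 2) (cV q v) (gbrk W p r (cV p u) (c r m))
      = c (p + q + r - 2) (mode M v (-1) (mode M u 0 m))"
    "gact W p (q + r - 2) (cV p u) (gbrk W q r (cV q v) (c r m))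
      = c (p + q + r - 2) (mode M u (-1) (mode M v 0 m))"
    unfolding bracket_W[OF v m refl] bracket_W[OF u m refl] bracket_A[OF u v refl]
    by (rule action_W[OF uv m] action_W[OF v um] action_W[OF u vm], simp)+
  have ba: "gbrk W p (q + r) (cV p u) (gact W q r (cV q v) (c r m))
      = c (p + q + r - 2) (mode M u 0 (mode M v (-1) m))"
    "gbrk W (p + q) r (gact A p q (cV p u) (cV q v)) (c r m)
      = c (p + q + r - 2) (mode M (mode V u (-1) v) 0 m)"
    unfolding action_W[OF v m refl] action_A[OF u v refl]
    by (rule bracket_W[OF u mode_deg_action[OF v m]] bracket_W[OF self.mode_deg_action[OF u v] m],
        simp)+
  have da: "mode M (mode V u 0 v) (-1) m \<in> deg M (p + q + r - 2)"
    "mode M v (-1) (mode M u 0 m) \<in> deg M (p + q + r - 2)"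
    "mode M u (-1) (mode M v 0 m) \<in> deg M (p + q + r - 2)"
    "mode M (mode V u (-1) v) 0 m \<in> deg M (p + q + r - 2)"
    by (rule deg_cong[OF mode_deg_action[OF uv m]] deg_cong[OF mode_deg_action[OF v um]]
        deg_cong[OF mode_deg_action[OF u vm]]
        deg_cong[OF mode_deg_bracket[OF self.mode_deg_action[OF u v] m]], simp)+
  show "gbrk W p (q + r) (cV p u) (gact W q r (cV q v) (c r m))
      = gact W (p + q - 2) r (gbrk A p q (cV p u) (cV q v)) (c r m)
        \<oplus>\<^bsub>gcomp W (p + q + r - 2)\<^esub> ?e \<odot>\<^bsub>gcomp W (p + q + r - 2)\<^esub>
          gact W q (p + r - 2) (cV q v) (gbrk W p r (cV p u) (c r m))"
    unfolding ab ba class_scale[OF da(2)] class_add[OF da(1) scale_deg[OF da(2)]]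
    by (simp add: commutator_zero_mode[OF u v])
  show "gbrk W (p + q) r (gact A p q (cV p u) (cV q v)) (c r m)
      = gact W p (q + r - 2) (cV p u) (gbrk W q r (cV q v) (c r m))
        \<oplus>\<^bsub>gcomp W (p + q + r - 2)\<^esub> ?e \<odot>\<^bsub>gcomp W (p + q + r - 2)\<^esub>
          gact W q (p + r - 2) (cV q v) (gbrk W p r (cV p u) (c r m))"
    unfolding ab ba class_scale[OF da(2)] class_add[OF da(3) scale_deg[OF da(2)]]
    by (rule class_cong[OF da(4) add_deg[OF da(3) scale_deg[OF da(2)]] iterate_bracket_mod_C2[OF u v]])
next
  fix p q u m assume u: "u \<in> deg V p" and m: "m \<in> deg M q"
  have e: "gdiff W (p + q - 2) (gbrk W p q (cV p u) (c q m)) = c (p + q - 1) (dif M (mode M u 0 m))"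
    "gbrk W (p + 1) q (gdiff A p (cV p u)) (c q m) = c (p + q - 1) (mode M (dif V u) 0 m)"
    "gbrk W p (q + 1) (cV p u) (gdiff W q (c q m)) = c (p + q - 1) (mode M u 0 (dif M m))"
    unfolding bracket_W[OF u m refl] differential_W[OF m refl] differential_A[OF u refl]
    by (rule differential_W[OF mode_deg_bracket[OF u m]] bracket_W[OF self.dif_deg[OF u] m]
        bracket_W[OF u dif_deg[OF m]], simp)+
  have d: "mode M (dif V u) 0 m \<in> deg M (p + q - 1)" "mode M u 0 (dif M m) \<in> deg M (p + q - 1)"
    by (rule deg_cong[OF mode_deg_bracket[OF self.dif_deg[OF u] m]]
        deg_cong[OF mode_deg_bracket[OF u dif_deg[OF m]]], simp)+
  show "gdiff W (p + q - 2) (gbrk W p q (cV p u) (c q m))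
      = gbrk W (p + 1) q (gdiff A p (cV p u)) (c q m)
        \<oplus>\<^bsub>gcomp W (p + q - 1)\<^esub> ((-1) powi p) \<odot>\<^bsub>gcomp W (p + q - 1)\<^esub>
          gbrk W p (q + 1) (cV p u) (gdiff W q (c q m))"
    unfolding e class_scale[OF d(2)] class_add[OF d(1) scale_deg[OF d(2)]]
    by (simp add: dif_mode[OF u])
qed

end

context realization
begin

lemma graded_comm_algebra: "graded_comm_algebra A"
proof -
  interpret alg: realization V V KV cV A KV cV A by (rule realization_self)
  have comm: "gact A p q (cV p u) (cV q v)
      = ((-1) powi (p * q)) \<odot>\<^bsub>gcomp A (p + q)\<^esub> gact A q p (cV q v) (cV p u)"
    if u: "u \<in> deg V p" and v: "v \<in> deg V q" for p q u v
  proof -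
    have d: "mode V u (-1) v \<in> deg V (p + q)" "mode V v (-1) u \<in> deg V (p + q)"
      using self.mode_deg_action[OF u v] self.mode_deg_action[OF v u] by (simp_all add: add.commute)
    show ?thesis
      unfolding action_A[OF u v refl] action_A[OF v u add.commute] alg.class_scale[OF d(2)]
      by (rule alg.class_cong[OF d(1) alg.scale_deg[OF d(2)] skew_C2(1)[OF u v]])
  qed
  show ?thesis
    unfolding graded_comm_algebra_def presents_carrier[OF presents_A] ball_simps
    using comm alg.graded_module_axioms vac_deg by (intro conjI) (simp add: algebra(3), blast+)
qed

end

context poisson_realization
begin

lemma dg_poisson_algebra: "dg_poisson_algebra A"
proof -
  interpret alg: poisson_realization V V KV cV A KV cV A by (rule poisson_realization_self)
  have skew: "gbrk A p q (cV p u) (cV q v)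
      = (- ((-1) powi (p * q))) \<odot>\<^bsub>gcomp A (p + q - 2)\<^esub> gbrk A q p (cV q v) (cV p u)"
    if u: "u \<in> deg V p" and v: "v \<in> deg V q" for p q u v
  proof -
    have d: "mode V u 0 v \<in> deg V (p + q - 2)" "mode V v 0 u \<in> deg V (p + q - 2)"
      using self.mode_deg_bracket[OF u v] self.mode_deg_bracket[OF v u] by (simp_all add: add.commute)
    have i: "p + q - 2 = q + p - 2" by simp
    show ?thesis
      unfolding bracket_A[OF u v refl] bracket_A[OF v u i] alg.class_scale[OF d(2)]
      by (rule alg.class_cong[OF d(1) alg.scale_deg[OF d(2)]])
        (use skew_C2(2)[OF v u] in \<open>simp add: mult.commute\<close>)
  qed
  show ?thesis
    unfolding dg_poisson_algebra_def presents_carrier[OF presents_A] ball_simps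
    using skew graded_comm_algebra alg.dg_axioms alg.poisson_axioms by (intro conjI) blast+
qed

end

lemma realization_hom:
  assumes "realization V M KV cV A K c W" "realization V N KV cV A L d X"
    and f: "weak_dg_module_hom M N f" and \<phi>: "\<And>p m. m \<in> deg M p \<Longrightarrow> \<phi> p (c p m) = d p (f m)"
  shows "dg_module_hom A W X \<phi>"
proof -
  interpret M: realization V M KV cV A K c W by fact
  interpret N: realization V N KV cV A L d X by fact
  have f': "f (x + y) = f x + f y" "f (scl M a x) = scl N a (f x)" "m \<in> deg M p \<Longrightarrow> f m \<in> deg N p"
    "f (dif M m) = dif N (f m)" "f (mode M v n m) = mode N v n (f m)" for x y a m p v n
    using f by (simp_all add: weak_dg_module_hom_def Vector_Spaces.linear_iff)
  show ?thesis
    unfolding dg_module_hom_def graded_module_hom_def presents_carrier[OF M.presents_A]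
      presents_carrier[OF M.presents_W] ball_simps
  proof (intro conjI allI ballI)
    show "lin_map (gcomp W p) (gcomp X p) (\<phi> p)" for p
      by (rule presents_lin_map[where f = f, OF M.presents_W N.presents_W]) (auto simp: f' \<phi>)
    show "\<phi> (p + q) (gact W p q (cV p u) (c q m)) = gact X p q (cV p u) (\<phi> q (c q m))"
      if "u \<in> deg V p" "m \<in> deg M q" for p q u m
      using that by (simp add: M.action_W N.action_W \<phi> f' M.mode_deg_action)
    show "\<phi> (p + 1) (gdiff W p (c p m)) = gdiff X p (\<phi> p (c p m))" if "m \<in> deg M p" for p m
      using that by (simp add: M.differential_W N.differential_W \<phi> f' M.dif_deg)
  qed
qed

lemma poisson_realization_hom:
  assumes "poisson_realization V M KV cV A K c W" "poisson_realization V N KV cV A L d X"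
    and f: "weak_dg_module_hom M N f" and \<phi>: "\<And>p m. m \<in> deg M p \<Longrightarrow> \<phi> p (c p m) = d p (f m)"
  shows "dg_poisson_module_hom A W X \<phi>"
proof -
  interpret M: poisson_realization V M KV cV A K c W by fact
  interpret N: poisson_realization V N KV cV A L d X by fact
  have "dg_module_hom A W X \<phi>"
    by (rule realization_hom[OF M.realization_axioms N.realization_axioms f \<phi>])
  moreover have br: "\<phi> (p + q - 2) (gbrk W p q (cV p u) (c q m)) = gbrk X p q (cV p u) (\<phi> q (c q m))"
    if "u \<in> deg V p" "m \<in> deg M q" for p q u m
    using that f by (simp add: M.bracket_W N.bracket_W \<phi> weak_dg_module_hom_def M.mode_deg_bracket)
  ultimately show ?thesis
    unfolding dg_poisson_module_hom_def presents_carrier[OF M.presents_A]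
      presents_carrier[OF M.presents_W] ball_simps by blast
qed


section \<open>Class maps of \<open>R(M)\<close>, \<open>gr A(M)\<close> and \<open>R(M) / (Ker \<eta>) R(M)\<close>\<close>

lemma presents_submodule_image:
  assumes P: "presents s U K X c" and L: "module.subspace s L" "L \<subseteq> U"
  shows "submodule (c ` L) CC X"
proof -
  interpret vs: vector_space s using P by (simp add: presents_def)
  interpret M: module CC X by (rule presents_module[OF P])
  show ?thesis
  proof (rule M.submoduleI)
    show "c ` L \<subseteq> carrier X"
      using L(2) presents_carrier[OF P] by blast
    show "\<zero>\<^bsub>X\<^esub> \<in> c ` L"
      using presents_zero[OF P] vs.subspace_0[OF L(1)] by (metis image_eqI)
    show "\<ominus>\<^bsub>X\<^esub> a \<in> c ` L" if "a \<in> c ` L" for a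
    proof -
      from that obtain x where x: "x \<in> L" "a = c x" by blast
      have "\<zero>\<^bsub>X\<^esub> \<ominus>\<^bsub>X\<^esub> c x = c (0 - x)"
        using presents_minus[OF P, of 0 x] x L vs.subspace_0 presents_zero[OF P] by auto
      moreover have "\<zero>\<^bsub>X\<^esub> \<ominus>\<^bsub>X\<^esub> c x = \<ominus>\<^bsub>X\<^esub> c x"
      proof -
        have "c x \<in> carrier X"
          using x L(2) presents_carrier[OF P] by auto
        then show ?thesis
          by (simp add: a_minus_def)
      qed
      ultimately show ?thesis
        using x vs.subspace_neg[OF L(1)] by auto
    qed
    show "a \<oplus>\<^bsub>X\<^esub> b \<in> c ` L" if "a \<in> c ` L" "b \<in> c ` L" for a b
      using that presents_add[OF P] vs.subspace_add[OF L(1)] L(2) by (auto simp: subset_iff)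
    show "a \<odot>\<^bsub>X\<^esub> x \<in> c ` L" if "x \<in> c ` L" for a x
      using that presents_scale[OF P] vs.subspace_scale[OF L(1)] L(2) by (auto simp: subset_iff)
  qed
qed

lemma presents_submodule_vimage:
  assumes P: "presents s U K X c" and H: "submodule H CC X"
  shows "module.subspace s {x \<in> U. c x \<in> H}"
proof -
  interpret vs: vector_space s using P by (simp add: presents_def)
  interpret M: module CC X by (rule presents_module[OF P])
  interpret H: submodule H CC X by (rule H)
  have U: "vs.subspace U" using P by (simp add: presents_def)
  show ?thesis
  proof (rule vs.subspaceI)
    show "0 \<in> {x \<in> U. c x \<in> H}"
      using vs.subspace_0[OF U] presents_zero[OF P] H.one_closed by simp
    show "x + y \<in> {x \<in> U. c x \<in> H}" if "x \<in> {x \<in> U. c x \<in> H}" "y \<in> {x \<in> U. c x \<in> H}" for x y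
      using that M.submoduleE(5)[OF H, of "c x" "c y"] vs.subspace_add[OF U]
      by (simp add: presents_add[OF P])
    show "s a x \<in> {x \<in> U. c x \<in> H}" if "x \<in> {x \<in> U. c x \<in> H}" for a x
      using that M.submoduleE(4)[OF H, of a "c x"] vs.subspace_scale[OF U]
      by (simp add: presents_scale[OF P] CC_def)
  qed
qed

text \<open>The submodule generated by the classes of \<open>g\<close>, seen on representatives.\<close>

lemma presents_mod_span:
  assumes P: "presents s U K X c" and g: "g \<subseteq> U"
  shows "mod_span X (c ` g) = c ` {x + y | x y. x \<in> module.span s g \<and> y \<in> K}"
proof -
  interpret vs: vector_space s using P by (simp add: presents_def)
  have U: "vs.subspace U" and KU: "K \<subseteq> U" using P by (auto simp: presents_def)
  have K: "vs.subspace K" by (rule presents_kernel_subspace[OF P])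
  let ?L = "{x + y | x y. x \<in> vs.span g \<and> y \<in> K}"
  have L: "vs.subspace ?L" by (rule vs.subspace_sums[OF vs.subspace_span K])
  have gU: "vs.span g \<subseteq> U" by (rule vs.span_minimal[OF g U])
  have LU: "?L \<subseteq> U"
    using gU KU vs.subspace_add[OF U] by blast
  have "g \<subseteq> ?L"
    using vs.span_base[of _ g] vs.subspace_0[OF K] by force
  then have "c ` ?L \<in> {H. submodule H CC X \<and> c ` g \<subseteq> H}"
    using presents_submodule_image[OF P L LU] image_mono by auto
  then have "mod_span X (c ` g) \<subseteq> c ` ?L"
    unfolding mod_span_def by (rule Inter_lower)
  moreover have "c ` ?L \<subseteq> H" if H: "submodule H CC X" "c ` g \<subseteq> H" for H
  proof -
    note sub = presents_submodule_vimage[OF P H(1)]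
    have "vs.span g \<subseteq> {x \<in> U. c x \<in> H}"
      by (rule vs.span_minimal[OF _ sub]) (use g H(2) in auto)
    moreover have "K \<subseteq> {x \<in> U. c x \<in> H}"
    proof
      fix x assume "x \<in> K"
      then have "c x = c 0" "x \<in> U"
        using KU presents_ker[OF P] presents_zero[OF P] by auto
      then show "x \<in> {x \<in> U. c x \<in> H}"
        using vs.subspace_0[OF sub] by simp
    qed
    ultimately have "?L \<subseteq> {x \<in> U. c x \<in> H}"
      using vs.subspace_add[OF sub] by blast
    then show ?thesis by blast
  qed
  then have "c ` ?L \<subseteq> mod_span X (c ` g)"
    unfolding mod_span_def by (intro Inter_greatest) auto
  ultimately show ?thesis
    by (rule equalityI)
qed

lemma descend_presents:
  assumes "presents s U K X c" "presents s' U' K' X' c'"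
    and "\<And>x. x \<in> U \<Longrightarrow> f x \<in> U'" "\<And>x y. f (x - y) = f x - f y" "\<And>x. x \<in> K \<Longrightarrow> f x \<in> K'"
    and "\<And>x. x \<in> U \<Longrightarrow> g x = c' (f x)" and x: "x \<in> U"
  shows "descend U c g (c x) = c' (f x)"
proof -
  have "g y = g x" if "y \<in> U" "c y = c x" for y
  proof -
    have "y - x \<in> K"
      using presents_eq[OF assms(1) that(1) x] that(2) by simp
    then have "f y - f x \<in> K'"
      using assms(4,5) by metis
    then show ?thesis
      using assms(6) that(1) x presents_eq[OF assms(2) assms(3) assms(3)] by simp
  qed
  then have "descend U c g (c x) = g x"
    by (rule descend_eq[OF x])
  then show ?thesis
    using assms(6) x by simp
qed

text \<open>For iterated quotients, where the representatives are themselves classes.\<close>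

lemma descend_image:
  assumes "x \<in> U" "\<And>y. y \<in> U \<Longrightarrow> d (c y) = d (c x) \<Longrightarrow> h (c y) = h (c x)"
  shows "descend (c ` U) d h (d (c x)) = h (c x)"
  by (rule descend_eq) (use assms in blast)+

context dgvoa_module
begin

text \<open>The maps \<open>g\<close> allow for operations, such as the Zhu product, that agree with a single mode only at the
level of classes.\<close>

lemma descend2_mode:
  assumes PV: "presents (scl V) (deg V p) KV X cV" and PM: "presents (scl M) (deg M q) K Y c"
    and PS: "presents (scl M) (deg M s) L Z c'"
    and d: "\<And>u m. u \<in> deg V p \<Longrightarrow> m \<in> deg M q \<Longrightarrow> mode M u k m \<in> deg M s"
    and l: "\<And>u m. u \<in> KV \<Longrightarrow> m \<in> deg M q \<Longrightarrow> mode M u k m \<in> L"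
    and r: "\<And>u m. u \<in> deg V p \<Longrightarrow> m \<in> K \<Longrightarrow> mode M u k m \<in> L"
    and g: "\<And>u m. u \<in> deg V p \<Longrightarrow> m \<in> deg M q \<Longrightarrow> g u m = c' (mode M u k m)"
    and um: "u \<in> deg V p" "m \<in> deg M q"
  shows "descend2 (deg V p) cV (deg M q) c g (cV u) (c m) = c' (mode M u k m)"
proof -
  have "g u' m' = g u m" if u': "u' \<in> deg V p" "m' \<in> deg M q" "cV u' = cV u" "c m' = c m" for u' m'
  proof -
    have "u' - u \<in> KV" "m' - m \<in> K"
      using presents_eq[OF PV u'(1) um(1)] presents_eq[OF PM u'(2) um(2)] u' by simp_all
    then have "mode M (u' - u) k m' + mode M u k (m' - m) \<in> L"
      using M.subspace_add[OF presents_kernel_subspace[OF PS] l[OF _ u'(2)] r[OF um(1)]] by blast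
    then have "mode M u' k m' - mode M u k m \<in> L"
      by (simp add: mode_diff_left mode_diff_right)
    then show ?thesis
      using presents_eq[OF PS d[OF u'(1,2)] d[OF um]] g[OF u'(1,2)] g[OF um] by simp
  qed
  then have "descend2 (deg V p) cV (deg M q) c g (cV u) (c m) = g u m"
    by (rule descend2_eq[OF um])
  then show ?thesis
    using g[OF um] by simp
qed

lemma dif_diff: "dif M (x - y) = dif M x - dif M y"
  using dif_add[of "x - y" y] by (simp add: algebra_simps)

lemma presents_R: "presents (scl M) (deg M p) (C2 M \<inter> deg M p) (R_comp M p) (R_class M p)"
  unfolding R_comp_def R_class_def
  by (rule presents_quot[OF presents_subspace[OF M.vector_space_axioms deg_subspace] C2_deg_subspace])
    (use M.subspace_0[OF C2_deg_subspace] in auto)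

end

context dgvoa_module
begin

lemma realizes_R: "realizes M (\<lambda>p. C2 M \<inter> deg M p) (R_class M) (R_mod V M)"
proof -
  have "gdiff (R_mod V M) p (R_class M p m) = R_class M (p + 1) (dif M m)" if "m \<in> deg M p" for p m
    unfolding R_mod_def pmod.simps
    by (rule descend_presents[where f = "dif M", OF presents_R presents_R])
      (use that dif_deg dif_C2 in \<open>auto simp: dif_diff\<close>)
  then show ?thesis
    unfolding realizes_def using presents_R by (simp add: R_mod_def)
qed

lemma acts_R: "acts V M (R_class V) (R_class M) (R_mod V M)"
  unfolding acts_def R_mod_def pmod.simps
  by (intro allI ballI descend2_mode[OF self.presents_R presents_R presents_R])
    (auto simp: mode_deg_action intro: mode_C2_left mode_C2_right)

lemma brackets_R: "brackets V M (R_class V) (R_class M) (R_mod V M)"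
  unfolding brackets_def R_mod_def pmod.simps
  by (intro allI ballI descend2_mode[OF self.presents_R presents_R presents_R])
    (auto simp: mode_deg_bracket intro: mode_C2_left mode_C2_right)

lemma presents_zhu: "presents (scl M) UNIV OM (zhu_A V M) (zhu_class V M)"
  unfolding zhu_A_def zhu_class_def
  by (rule presents_quot[OF presents_subspace[OF M.vector_space_axioms M.subspace_UNIV] O_subspace])
    (use M.subspace_0[OF O_subspace] in auto)

lemma zhu_F_eq: "zhu_F V M p = zhu_class V M ` OFil p"
proof
  show "zhu_F V M p \<subseteq> zhu_class V M ` OFil p"
    unfolding zhu_F_def using Fil_OFil by blast
  show "zhu_class V M ` OFil p \<subseteq> zhu_F V M p"
  proof safe
    fix x assume "x \<in> OFil p"
    then obtain y z where yz: "x = y + z" "y \<in> OM" "z \<in> Fil p"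
      unfolding OFil_def by blast
    then have "zhu_class V M x = zhu_class V M z"
      using presents_eq[OF presents_zhu, of x z] by simp
    with yz show "zhu_class V M x \<in> zhu_F V M p"
      unfolding zhu_F_def by blast
  qed
qed

text \<open>This holds for all vectors, not only for those of degree \<open>p\<close>: the commutator of Zhu products has its
class in \<open>F\<^sup>p\<close>, but it need not itself be a sum of vectors of degree at most \<open>p\<close>.\<close>

lemma gr_class_eq: "gr_class V M p x = gr_class V M p y \<longleftrightarrow> x - y \<in> OFil (p - 1)"
  using presents_eq[OF presents_quot[OF presents_zhu OFil_subspace, of "p - 1", OF _ _ zhu_F_eq], of x y]
    O_OFil by (auto simp: gr_class_def)

lemma presents_gr_Fil:
  "presents (scl M) (Fil p) (OFil (p - 1) \<inter> Fil p) (gr_comp V M p) (gr_class V M p)"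
proof -
  have coset: "S +>\<^bsub>(zhu_A V M)\<lparr>carrier := F\<rparr>\<^esub> x = S +>\<^bsub>zhu_A V M\<^esub> x" for S F x
    by (simp add: a_r_coset_def r_coset_def)
  have "zhu_F V M (p - 1) = zhu_class V M ` (OFil (p - 1) \<inter> Fil p)"
  proof
    show "zhu_F V M (p - 1) \<subseteq> zhu_class V M ` (OFil (p - 1) \<inter> Fil p)"
      unfolding zhu_F_def using Fil_OFil Fil_mono[of "p - 1" p] by auto
    show "zhu_class V M ` (OFil (p - 1) \<inter> Fil p) \<subseteq> zhu_F V M (p - 1)"
      unfolding zhu_F_eq by blast
  qed
  from presents_quot[OF presents_subspace_of_carrier[OF presents_zhu M.subspace_span]
      M.subspace_inter[OF OFil_subspace M.subspace_span] _ _ this]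
  show ?thesis
    unfolding gr_comp_def gr_class_def zhu_F_def[of V M p] coset using O_OFil by auto
qed

lemma presents_gr: "presents (scl M) (deg M p) (gr_kernel p) (gr_comp V M p) (gr_class V M p)"
proof -
  have sub: "deg M p \<subseteq> Fil p"
    using deg_Fil by blast
  have "\<exists>y\<in>deg M p. x - y \<in> OFil (p - 1) \<inter> Fil p" if "x \<in> Fil p" for x
  proof -
    have "Fil p \<subseteq> {y + z | y z. y \<in> deg M p \<and> z \<in> Fil (p - 1)}"
    proof (rule Fil_minimal)
      show "M.subspace {y + z | y z. y \<in> deg M p \<and> z \<in> Fil (p - 1)}"
        by (rule M.subspace_sums[OF deg_subspace M.subspace_span])
      show "deg M q \<subseteq> {y + z | y z. y \<in> deg M p \<and> z \<in> Fil (p - 1)}" if "q \<le> p" for q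
      proof (cases "q = p")
        case True
        then show ?thesis using M.span_zero by force
      next
        case False
        then show ?thesis
          using that deg_Fil[of _ q "p - 1"] M.subspace_0[OF deg_subspace] by force
      qed
    qed
    with that obtain y z where "x = y + z" "y \<in> deg M p" "z \<in> Fil (p - 1)" by blast
    then show ?thesis
      using Fil_OFil Fil_mono[of "p - 1" p] by (intro bexI[of _ y]) auto
  qed
  from presents_fewer_representatives[OF presents_gr_Fil deg_subspace sub this]
  have "presents (scl M) (deg M p) (OFil (p - 1) \<inter> Fil p \<inter> deg M p) (gr_comp V M p) (gr_class V M p)" .
  moreover have "OFil (p - 1) \<inter> Fil p \<inter> deg M p = gr_kernel p"
    using sub by (auto simp: gr_kernel_def)
  ultimately show ?thesis by simp
qed

lemma gr_class_star_l:
  assumes "u \<in> deg V p" "m \<in> deg M q"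
  shows "gr_class V M (p + q) (star_l V M u m) = gr_class V M (p + q) (mode M u (-1) m)"
  using mode_sub_wser_OFil[OF assms, of 0 "-1"] by (simp add: gr_class_eq star_l_eq)

lemma gr_class_commutator:
  assumes "u \<in> deg V p" "m \<in> deg M q"
  shows "gr_class V M (p + q - 2)
      (star_l V M u m - scl M ((-1) powi (p * q)) (star_r V M m u))
    = gr_class V M (p + q - 2) (mode M u 0 m)"
  using mode_sub_wser_OFil[OF assms, of "-1" 0] by (simp add: gr_class_eq star_commutator[OF assms])

lemma gr_diff:
  assumes "m \<in> deg M p"
  shows "descend (deg M p) (gr_class V M p) (\<lambda>m. gr_class V M (p + 1) (dif M m)) (gr_class V M p m)
    = gr_class V M (p + 1) (dif M m)"
  by (rule descend_presents[where f = "dif M", OF presents_gr presents_gr])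
    (use assms dif_deg dif_gr_kernel in \<open>auto simp: dif_diff\<close>)

end

context dgvoa_module
begin

lemma gr_act:
  assumes "u \<in> deg V p" "m \<in> deg M q"
  shows "descend2 (deg V p) (gr_class V V p) (deg M q) (gr_class V M q)
      (\<lambda>u m. gr_class V M (p + q) (star_l V M u m)) (gr_class V V p u) (gr_class V M q m)
    = gr_class V M (p + q) (mode M u (-1) m)"
  by (rule descend2_mode[OF self.presents_gr presents_gr presents_gr])
    (use assms in \<open>auto simp: mode_deg_action gr_class_star_l intro: mode_gr_kernel_left mode_gr_kernel_right\<close>)

lemma gr_brk:
  assumes "\<And>u m. u \<in> deg V p \<Longrightarrow> m \<in> deg M q \<Longrightarrow>
      gr_class V M (p + q - 2) (h u m) = gr_class V M (p + q - 2) (mode M u 0 m)"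
    and "u \<in> deg V p" "m \<in> deg M q"
  shows "descend2 (deg V p) (gr_class V V p) (deg M q) (gr_class V M q)
      (\<lambda>u m. gr_class V M (p + q - 2) (h u m)) (gr_class V V p u) (gr_class V M q m)
    = gr_class V M (p + q - 2) (mode M u 0 m)"
  by (rule descend2_mode[OF self.presents_gr presents_gr presents_gr])
    (use assms in \<open>auto simp: mode_deg_bracket intro: mode_gr_kernel_left mode_gr_kernel_right\<close>)

end

context dgvoa
begin

lemma R_alg_sel: "gcomp (R_alg V) = gcomp (R_mod V V)" "gdiff (R_alg V) = gdiff (R_mod V V)"
    "gact (R_alg V) = gact (R_mod V V)" "gbrk (R_alg V) = gbrk (R_mod V V)"
    "gunit (R_alg V) = R_class V 0 (vac V)"
  by (simp_all add: R_alg_def pmod.extend_def palg.fields_def)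

lemma R_alg: "realizes V (\<lambda>p. C2 V \<inter> deg V p) (R_class V) (R_alg V)"
    "acts V V (R_class V) (R_class V) (R_alg V)" "brackets V V (R_class V) (R_class V) (R_alg V)"
  using self.realizes_R self.acts_R self.brackets_R
  by (simp_all add: realizes_def acts_def brackets_def R_alg_sel)

lemma gr_alg: "realizes V self.gr_kernel (gr_class V V) (gr_alg V)"
    "acts V V (gr_class V V) (gr_class V V) (gr_alg V)"
    "brackets V V (gr_class V V) (gr_class V V) (gr_alg V)"
proof -
  show "realizes V self.gr_kernel (gr_class V V) (gr_alg V)"
    using self.presents_gr self.C2_gr_kernel by (auto simp: realizes_def gr_alg_def self.gr_diff)
  show "acts V V (gr_class V V) (gr_class V V) (gr_alg V)"
    by (simp add: acts_def gr_alg_def self.gr_act)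
  have "gr_class V V (p + q - 2) (star_l V V u v - scl V ((-1) powi (p * q)) (star_l V V v u))
      = gr_class V V (p + q - 2) (mode V u 0 v)"
    if "u \<in> deg V p" "v \<in> deg V q" for p q u v
    using star_l_commutator[OF that] self.OFil_mono[of "p + q - 4" "p + q - 3"]
    by (auto simp: self.gr_class_eq)
  then show "brackets V V (gr_class V V) (gr_class V V) (gr_alg V)"
    by (simp add: brackets_def gr_alg_def self.gr_brk)
qed

lemma eta_R_class:
  assumes "u \<in> deg V p"
  shows "eta V p (R_class V p u) = gr_class V V p u"
  unfolding eta_def
  by (rule descend_presents[where f = "\<lambda>u. u", OF self.presents_R self.presents_gr])
    (use assms self.C2_gr_kernel in auto)

lemma ker_eta_eq: "ker_eta V p = R_class V p ` self.gr_kernel p"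
proof -
  have "eta V p (R_class V p u) = \<zero>\<^bsub>gr_comp V V p\<^esub> \<longleftrightarrow> u \<in> self.gr_kernel p" if "u \<in> deg V p" for u
    using presents_ker[OF self.presents_gr that] by (simp add: eta_R_class[OF that])
  then show ?thesis
    unfolding ker_eta_def presents_carrier[OF self.presents_R] by (auto simp: self.gr_kernel_def)
qed

end

locale dgvoa_vmod = dgvoa_module V M
  for V :: "('v::ab_group_add) voa" and M :: "('v, 'm::ab_group_add) vmod"
begin

lemma gr_mod: "realizes M gr_kernel (gr_class V M) (gr_mod V M)"
    "acts V M (gr_class V V) (gr_class V M) (gr_mod V M)"
    "brackets V M (gr_class V V) (gr_class V M) (gr_mod V M)"
proof -
  show "realizes M gr_kernel (gr_class V M) (gr_mod V M)"
    using presents_gr C2_gr_kernel by (auto simp: realizes_def gr_mod_def gr_diff)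
  show "acts V M (gr_class V V) (gr_class V M) (gr_mod V M)"
    by (simp add: acts_def gr_mod_def gr_act)
  show "brackets V M (gr_class V V) (gr_class V M) (gr_mod V M)"
    by (simp add: brackets_def gr_mod_def gr_brk gr_class_commutator)
qed

lemma restrict_gr_mod: "realizes M gr_kernel (gr_class V M) (restrict_eta V (gr_mod V M))"
    "acts V M (R_class V) (gr_class V M) (restrict_eta V (gr_mod V M))"
    "brackets V M (R_class V) (gr_class V M) (restrict_eta V (gr_mod V M))"
  using gr_mod by (simp_all add: realizes_def acts_def brackets_def restrict_eta_def eta_R_class)

text \<open>Since \<open>\<eta>\<close> sends the class of \<open>u\<close> to the class of \<open>u\<close>, its kernel consists of the classes of \<open>gr_kernel\<close>, and
the multiples of these are the classes of the vectors \<open>u\<^sub>-\<^sub>1 m\<close>.\<close>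

lemma ker_eta_mult_eq: "ker_eta_mult V (R_mod V M) p = R_class M p ` eta_kernel p"
proof -
  let ?G = "\<lambda>A W. {gact (R_mod V M) q (p - q) a w | q a w. a \<in> A q \<and> w \<in> W (p - q)}"
  have "?G (ker_eta V) (\<lambda>q. carrier (gcomp (R_mod V M) q)) = R_class M p ` eta_kernel_gen p"
  proof -
    have act: "gact (R_mod V M) q (p - q) (R_class V q u) (R_class M (p - q) m)
        = R_class M p (mode M u (-1) m)" if "u \<in> deg V q" "m \<in> deg M (p - q)" for q u m
      using acts_R that by (simp add: acts_def)
    have car: "carrier (gcomp (R_mod V M) q) = R_class M q ` deg M q" for q
      using presents_carrier[OF presents_R] by (simp add: R_mod_def)
    show ?thesis
      unfolding ker_eta_eq car
    proof (intro equalityI subsetI)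
      fix x assume "x \<in> ?G (\<lambda>q. R_class V q ` self.gr_kernel q) (\<lambda>q. R_class M q ` deg M q)"
      then obtain q u m where "x = gact (R_mod V M) q (p - q) (R_class V q u) (R_class M (p - q) m)"
          "u \<in> self.gr_kernel q" "m \<in> deg M (p - q)"
        by blast
      then show "x \<in> R_class M p ` eta_kernel_gen p"
        using act by (auto simp: self.gr_kernel_def intro!: image_eqI)
    next
      fix x assume "x \<in> R_class M p ` eta_kernel_gen p"
      then obtain q u m where "x = R_class M p (mode M u (-1) m)" "u \<in> self.gr_kernel q" "m \<in> deg M (p - q)"
        by blast
      moreover from this have "x = gact (R_mod V M) q (p - q) (R_class V q u) (R_class M (p - q) m)"
        using act by (simp add: self.gr_kernel_def)
      ultimately show "x \<in> ?G (\<lambda>q. R_class V q ` self.gr_kernel q) (\<lambda>q. R_class M q ` deg M q)"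
        by blast
    qed
  qed
  moreover have "eta_kernel_gen p \<subseteq> deg M p"
  proof safe
    fix q u m assume "u \<in> self.gr_kernel q" "m \<in> deg M (p - q)"
    then show "mode M u (-1) m \<in> deg M p"
      using mode_deg_action[of u q m "p - q"] by (simp add: self.gr_kernel_def)
  qed
  ultimately show ?thesis
    unfolding ker_eta_mult_def eta_kernel_def using presents_mod_span[OF presents_R]
    by (simp add: R_mod_def)
qed

lemma presents_eta:
  "presents (scl M) (deg M p) (eta_kernel p) (gcomp (eta_quot V (R_mod V M)) p) (etaR_class V M p)"
proof -
  have "gcomp (R_mod V M) p = R_comp M p"
    by (simp add: R_mod_def)
  then show ?thesis
    unfolding etaR_class_def eta_class_def eta_quot_def pmod.simps
    using presents_quot[OF presents_R eta_kernel_subspace C2_eta_kernel eta_kernel_deg ker_eta_mult_eq] by simp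
qed

lemma etaR_class_eq:
  "x \<in> deg M p \<Longrightarrow> y \<in> deg M p \<Longrightarrow> etaR_class V M p x = etaR_class V M p y \<longleftrightarrow> x - y \<in> eta_kernel p"
  by (rule presents_eq[OF presents_eta])

lemma etaR_class_unfold: "eta_class V (R_mod V M) p (R_class M p m) = etaR_class V M p m"
  by (simp add: etaR_class_def)

lemma descend_eta:
  assumes h: "\<And>m. m \<in> deg M p \<Longrightarrow> h (R_class M p m) = c (f m)"
    and P: "presents s (deg N q) L X c" and f: "\<And>m. m \<in> deg M p \<Longrightarrow> f m \<in> deg N q"
    "\<And>x y. f (x - y) = f x - f y" "\<And>m. m \<in> eta_kernel p \<Longrightarrow> f m \<in> L" and m: "m \<in> deg M p"
  shows "descend (carrier (gcomp (R_mod V M) p)) (eta_class V (R_mod V M) p) h (etaR_class V M p m) = c (f m)"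
proof -
  have car: "carrier (gcomp (R_mod V M) p) = R_class M p ` deg M p"
    using presents_carrier[OF presents_R] by (simp add: R_mod_def)
  have *: "h (R_class M p y) = h (R_class M p m)"
    if "y \<in> deg M p" "etaR_class V M p y = etaR_class V M p m" for y
  proof -
    have "f y - f m \<in> L"
      using f(2,3) etaR_class_eq[OF that(1) m] that(2) by metis
    then show ?thesis
      using presents_eq[OF P f(1)[OF that(1)] f(1)[OF m]] h that(1) m by simp
  qed
  have "descend (R_class M p ` deg M p) (eta_class V (R_mod V M) p) h
      (eta_class V (R_mod V M) p (R_class M p m)) = h (R_class M p m)"
    by (rule descend_image[OF m]) (rule *, simp_all add: etaR_class_unfold)
  then show ?thesis
    unfolding car etaR_class_unfold h[OF m] .
qed

lemma eta_quot: "realizes M eta_kernel (etaR_class V M) (eta_quot V (R_mod V M))"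
    "acts V M (R_class V) (etaR_class V M) (eta_quot V (R_mod V M))"
    "brackets V M (R_class V) (etaR_class V M) (eta_quot V (R_mod V M))"
proof -
  have "gdiff (eta_quot V (R_mod V M)) p (etaR_class V M p m) = etaR_class V M (p + 1) (dif M m)"
    if "m \<in> deg M p" for p m
    unfolding eta_quot_def pmod.simps
    by (rule descend_eta[OF _ presents_eta])
      (use that realizes_R in \<open>auto simp: realizes_def etaR_class_unfold dif_deg dif_diff dif_eta_kernel\<close>)
  then show "realizes M eta_kernel (etaR_class V M) (eta_quot V (R_mod V M))"
    using presents_eta C2_eta_kernel by (simp add: realizes_def)
  show "acts V M (R_class V) (etaR_class V M) (eta_quot V (R_mod V M))"
    unfolding acts_def
  proof (intro allI ballI)
    fix p q u m assume um: "u \<in> deg V p" "m \<in> deg M q"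
    show "gact (eta_quot V (R_mod V M)) p q (R_class V p u) (etaR_class V M q m)
      = etaR_class V M (p + q) (mode M u (-1) m)"
      unfolding eta_quot_def pmod.simps
      by (rule descend_eta[OF _ presents_eta])
        (use um acts_R in \<open>auto simp: acts_def etaR_class_unfold mode_deg_action mode_diff_right mode_eta_kernel\<close>)
  qed
  show "brackets V M (R_class V) (etaR_class V M) (eta_quot V (R_mod V M))"
    unfolding brackets_def
  proof (intro allI ballI)
    fix p q u m assume um: "u \<in> deg V p" "m \<in> deg M q"
    show "gbrk (eta_quot V (R_mod V M)) p q (R_class V p u) (etaR_class V M q m)
      = etaR_class V M (p + q - 2) (mode M u 0 m)"
      unfolding eta_quot_def pmod.simps
      by (rule descend_eta[OF _ presents_eta])
        (use um brackets_R in \<open>auto simp: brackets_def etaR_class_unfold mode_deg_bracket mode_diff_right mode_eta_kernel\<close>)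
  qed
qed

text \<open>Descending along \<open>\<eta>\<close> is possible for the mode \<open>k\<close> if it maps the kernel of \<open>\<eta>\<close> into \<open>eta_kernel\<close>.  For
\<open>k = -1\<close> this holds by construction, for \<open>k = 0\<close> it is the condition \<open>bracket_descends\<close>.\<close>

lemma descend_along_eta:
  assumes h: "\<And>u. u \<in> deg V p \<Longrightarrow> h (R_class V p u) = etaR_class V M q (mode M u k m)"
    and d: "\<And>u. u \<in> deg V p \<Longrightarrow> mode M u k m \<in> deg M q"
    and K: "\<And>u. u \<in> self.gr_kernel p \<Longrightarrow> mode M u k m \<in> eta_kernel q" and u: "u \<in> deg V p"
  shows "descend (carrier (R_comp V p)) (eta V p) h (gr_class V V p u) = etaR_class V M q (mode M u k m)"
proof -
  have *: "h (R_class V p v) = h (R_class V p u)"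
    if v: "v \<in> deg V p" "eta V p (R_class V p v) = eta V p (R_class V p u)" for v
  proof -
    have "v - u \<in> self.gr_kernel p"
      using v u presents_eq[OF self.presents_gr v(1) u] by (simp add: eta_R_class)
    then have "mode M v k m - mode M u k m \<in> eta_kernel q"
      using K[of "v - u"] by (simp add: mode_diff_left)
    then show ?thesis
      using h v u d by (simp add: etaR_class_eq)
  qed
  have "descend (R_class V p ` deg V p) (eta V p) h (eta V p (R_class V p u)) = h (R_class V p u)"
    by (rule descend_image[OF u]) (rule *)
  then show ?thesis
    unfolding presents_carrier[OF self.presents_R] eta_R_class[OF u] h[OF u] .
qed

lemma etaR: "realizes M eta_kernel (etaR_class V M) (etaR V M)"
    "acts V M (gr_class V V) (etaR_class V M) (etaR V M)"
proof -
  show "realizes M eta_kernel (etaR_class V M) (etaR V M)"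
    using eta_quot(1) by (simp add: realizes_def etaR_def eta_fun_def)
  show "acts V M (gr_class V V) (etaR_class V M) (etaR V M)"
    unfolding acts_def etaR_def eta_fun_def pmod.simps
    by (intro allI ballI descend_along_eta)
      (use eta_quot(2) in \<open>auto simp: acts_def mode_deg_action action_eta_kernel\<close>)
qed

lemma etaR_brackets:
  assumes "bracket_descends V (R_mod V M)"
  shows "brackets V M (gr_class V V) (etaR_class V M) (etaR V M)"
proof -
  have "mode M u 0 m \<in> eta_kernel (p + q - 2)" if u: "u \<in> self.gr_kernel p" and m: "m \<in> deg M q" for p q u m
  proof -
    have ud: "u \<in> deg V p"
      using u by (simp add: self.gr_kernel_def)
    have "etaR_class V M q m \<in> carrier (gcomp (eta_quot V (R_mod V M)) q)"
      using presents_carrier[OF presents_eta] m by simp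
    then have "gbrk (eta_quot V (R_mod V M)) p q (R_class V p u) (etaR_class V M q m)
        = \<zero>\<^bsub>gcomp (eta_quot V (R_mod V M)) (p + q - 2)\<^esub>"
      using assms u by (simp add: bracket_descends_def ker_eta_eq)
    then show ?thesis
      using eta_quot(3) ud m presents_ker[OF presents_eta mode_deg_bracket[OF ud m]]
      by (simp add: brackets_def)
  qed
  then show ?thesis
    unfolding brackets_def etaR_def eta_fun_def pmod.simps
    by (intro allI ballI descend_along_eta)
      (use eta_quot(3) in \<open>auto simp: brackets_def mode_deg_bracket\<close>)
qed

lemma psi_class: "m \<in> deg M p \<Longrightarrow> psi V M p (etaR_class V M p m) = gr_class V M p m"
  unfolding psi_def
  by (rule descend_presents[where f = "\<lambda>x. x", OF presents_eta presents_gr]) (use eta_kernel_gr_kernel in auto)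

lemma poisson_realizations:
  shows "poisson_realization V M self.gr_kernel (gr_class V V) (gr_alg V) gr_kernel (gr_class V M) (gr_mod V M)"
    and "realization V M self.gr_kernel (gr_class V V) (gr_alg V) eta_kernel (etaR_class V M) (etaR V M)"
    and "poisson_realization V M (\<lambda>p. C2 V \<inter> deg V p) (R_class V) (R_alg V)
      eta_kernel (etaR_class V M) (eta_quot V (R_mod V M))"
    and "poisson_realization V M (\<lambda>p. C2 V \<inter> deg V p) (R_class V) (R_alg V)
      gr_kernel (gr_class V M) (restrict_eta V (gr_mod V M))"
    and "bracket_descends V (R_mod V M) \<Longrightarrow>
      poisson_realization V M self.gr_kernel (gr_class V V) (gr_alg V) eta_kernel (etaR_class V M) (etaR V M)"
  by unfold_locales
    (simp_all add: gr_alg R_alg gr_mod etaR eta_quot restrict_gr_mod etaR_brackets R_alg_sel(5), simp_all add: gr_alg_def)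

end

section \<open>Functoriality and the natural transformation\<close>

text \<open>A morphism of weak modules commutes with all modes and preserves degrees, so it respects every subspace
that was defined from these; the functors and \<open>\<psi>\<close> are then given on representatives by \<open>f\<close> and by the
identity.\<close>

locale dgvoa_vmod_hom = M: dgvoa_vmod V M + N: dgvoa_vmod V N
  for V :: "('v::ab_group_add) voa" and M :: "('v, 'm::ab_group_add) vmod"
    and N :: "('v, 'n::ab_group_add) vmod" +
  fixes f :: "'m \<Rightarrow> 'n"
  assumes hom: "weak_dg_module_hom M N f"
begin

lemma hom_add: "f (x + y) = f x + f y" and hom_scale: "f (scl M a x) = scl N a (f x)"
  and hom_deg: "m \<in> deg M p \<Longrightarrow> f m \<in> deg N p" and hom_mode: "f (mode M v n m) = mode N v n (f m)"
  using hom by (simp_all add: weak_dg_module_hom_def Vector_Spaces.linear_iff)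

lemma hom_zero [simp]: "f 0 = 0"
  using hom_add[of 0 0] by simp

lemma hom_diff: "f (x - y) = f x - f y"
  using hom_add[of "x - y" y] by (simp add: algebra_simps)

lemma hom_vimage: "module.subspace (scl N) U \<Longrightarrow> module.subspace (scl M) {x. f x \<in> U}"
  using subspace_vimage_additive[of "scl M" "scl N" U f] hom_add hom_scale
    M.M.vector_space_axioms N.M.vector_space_axioms by blast

lemma hom_ser: "f (ser M s k u m) = ser N s k u (f m)"
  unfolding ser_def
  by (subst Sum_any_additive[of f, OF hom_zero hom_add M.ser_support]) (simp add: hom_scale hom_mode)

lemma hom_O: "x \<in> zhu_O V M \<Longrightarrow> f x \<in> zhu_O V N"
  using M.O_induct[OF hom_vimage[OF N.O_subspace]] N.ser_circ_mem by (auto simp: hom_ser)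

lemma hom_Fil: "x \<in> M.Fil p \<Longrightarrow> f x \<in> N.Fil p"
  using M.Fil_minimal[OF hom_vimage[OF N.M.subspace_span], of p] hom_deg N.deg_Fil by blast

lemma hom_gr_kernel: "x \<in> M.gr_kernel p \<Longrightarrow> f x \<in> N.gr_kernel p"
  using hom_deg hom_O hom_Fil
  by (fastforce simp: M.gr_kernel_def N.gr_kernel_def M.OFil_def hom_add intro: N.OFil_add)

lemma hom_C2: "x \<in> C2 M \<Longrightarrow> f x \<in> C2 N"
  using M.C2_induct[OF hom_vimage[OF N.C2_subspace]] N.mode_mem_C2' by (auto simp: hom_mode)

lemma hom_eta_kernel: "x \<in> M.eta_kernel p \<Longrightarrow> f x \<in> N.eta_kernel p"
proof -
  assume x: "x \<in> M.eta_kernel p"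
  have "M.eta_kernel p \<subseteq> {x. f x \<in> N.eta_kernel p}"
  proof (rule M.eta_kernel_minimal[OF hom_vimage[OF N.eta_kernel_subspace]])
    show "C2 M \<inter> deg M p \<subseteq> {x. f x \<in> N.eta_kernel p}"
      using hom_C2 hom_deg N.C2_eta_kernel by blast
    show "mode M u (-1) m \<in> {x. f x \<in> N.eta_kernel p}" if "u \<in> M.self.gr_kernel q" "m \<in> deg M (p - q)" for q u m
      using N.action_eta_kernel[OF that(1) hom_deg[OF that(2)]] by (simp add: hom_mode)
  qed
  with x show ?thesis by blast
qed

lemma R_map_class: "m \<in> deg M p \<Longrightarrow> R_map M N f p (R_class M p m) = R_class N p (f m)"
  unfolding R_map_def
  by (rule descend_presents[where f = f, OF M.presents_R N.presents_R])
    (auto simp: hom_deg hom_diff hom_C2)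

lemma etaR_map_class: "m \<in> deg M p \<Longrightarrow> etaR_map V M N f p (etaR_class V M p m) = etaR_class V N p (f m)"
  unfolding etaR_map_def eta_fun_map_def
  by (rule M.descend_eta[OF _ N.presents_eta])
    (auto simp: R_map_class N.etaR_class_unfold hom_deg hom_diff hom_eta_kernel)

lemma gr_map_class: "m \<in> deg M p \<Longrightarrow> gr_map V M N f p (gr_class V M p m) = gr_class V N p (f m)"
  unfolding gr_map_def
  by (rule descend_presents[where f = f, OF M.presents_gr N.presents_gr])
    (auto simp: hom_deg hom_diff hom_gr_kernel)

lemma graded_hom_etaR: "graded_module_hom (gr_alg V) (etaR V M) (etaR V N) (etaR_map V M N f)"
  using realization_hom[OF M.poisson_realizations(2) N.poisson_realizations(2) hom etaR_map_class]
  by (simp add: dg_module_hom_def)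

lemma graded_hom_gr: "graded_module_hom (gr_alg V) (gr_mod V M) (gr_mod V N) (gr_map V M N f)"
  using realization_hom[OF poisson_realization.axioms(1)[OF M.poisson_realizations(1)]
      poisson_realization.axioms(1)[OF N.poisson_realizations(1)] hom gr_map_class]
  by (simp add: dg_module_hom_def)

end

lemma weak_dg_module_hom_id:
  assumes "weak_dg_module V M"
  shows "weak_dg_module_hom M M id"
  using assms
  by (simp add: weak_dg_module_hom_def weak_dg_module_def is_complex_def Vector_Spaces.linear_iff)

lemma weak_dg_module_hom_comp:
  "weak_dg_module_hom M N f \<Longrightarrow> weak_dg_module_hom N P g \<Longrightarrow> weak_dg_module_hom M P (g \<circ> f)"
  by (simp add: weak_dg_module_hom_def Vector_Spaces.linear_iff)

theorem proposition8p2: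
  fixes V :: "('v::ab_group_add) voa"
  assumes "dg_vertex_operator_algebra V"
  shows
    "(\<forall>M :: ('v, 'm::ab_group_add) vmod. weak_dg_module V M \<longrightarrow>
        graded_module (gr_alg V) (etaR V M) \<and> graded_module (gr_alg V) (gr_mod V M) \<and>
        (\<forall>p. \<forall>x\<in>carrier (gcomp (etaR V M) p). etaR_map V M M id p x = x) \<and>
        (\<forall>p. \<forall>x\<in>carrier (gcomp (gr_mod V M) p). gr_map V M M id p x = x)) \<and>
     (\<forall>(M :: ('v, 'm) vmod) (N :: ('v, 'n::ab_group_add) vmod) f.
        weak_dg_module V M \<longrightarrow> weak_dg_module V N \<longrightarrow> weak_dg_module_hom M N f \<longrightarrow>
        graded_module_hom (gr_alg V) (etaR V M) (etaR V N) (etaR_map V M N f) \<and>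
        graded_module_hom (gr_alg V) (gr_mod V M) (gr_mod V N) (gr_map V M N f) \<and>
        (\<forall>p. \<forall>x\<in>carrier (gcomp (etaR V M) p).
          psi V N p (etaR_map V M N f p x) = gr_map V M N f p (psi V M p x))) \<and>
     (\<forall>(M :: ('v, 'm) vmod) (N :: ('v, 'n) vmod) (P :: ('v, 'k::ab_group_add) vmod) f g.
        weak_dg_module V M \<longrightarrow> weak_dg_module V N \<longrightarrow> weak_dg_module V P \<longrightarrow>
        weak_dg_module_hom M N f \<longrightarrow> weak_dg_module_hom N P g \<longrightarrow>
        (\<forall>p. \<forall>x\<in>carrier (gcomp (etaR V M) p).
          etaR_map V M P (g \<circ> f) p x = etaR_map V N P g p (etaR_map V M N f p x)) \<and>
        (\<forall>p. \<forall>x\<in>carrier (gcomp (gr_mod V M) p).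
          gr_map V M P (g \<circ> f) p x = gr_map V N P g p (gr_map V M N f p x))) \<and>
     (\<forall>M :: ('v, 'm) vmod. weak_dg_module V M \<longrightarrow>
        (\<forall>p. \<forall>m\<in>deg M p. psi V M p (etaR_class V M p m) = gr_class V M p m) \<and>
        graded_surjective (etaR V M) (gr_mod V M) (psi V M) \<and>
        dg_poisson_module (gr_alg V) (gr_mod V M) \<and>
        dg_module (gr_alg V) (etaR V M) \<and>
        dg_module_hom (gr_alg V) (etaR V M) (gr_mod V M) (psi V M) \<and>
        dg_poisson_module (R_alg V) (eta_quot V (R_mod V M)) \<and>
        dg_poisson_module_hom (R_alg V) (eta_quot V (R_mod V M))
          (restrict_eta V (gr_mod V M)) (psi V M) \<and>
        (bracket_descends V (R_mod V M) \<longrightarrow>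
          dg_poisson_module (gr_alg V) (etaR V M) \<and>
          dg_poisson_module_hom (gr_alg V) (etaR V M) (gr_mod V M) (psi V M)))"
proof -
  interpret V: dgvoa V
    by (rule dgvoa.intro[OF assms])
  have vmod: "dgvoa_vmod V M" if "weak_dg_module V M" for M :: "('v, 'x::ab_group_add) vmod"
    by (intro dgvoa_vmod.intro dgvoa_module.intro V.dgvoa_axioms dgvoa_module_axioms.intro that)
  have vhom: "dgvoa_vmod_hom V M N f"
    if "weak_dg_module V M" "weak_dg_module V N" "weak_dg_module_hom M N f"
    for M :: "('v, 'x::ab_group_add) vmod" and N :: "('v, 'y::ab_group_add) vmod" and f
    by (intro dgvoa_vmod_hom.intro dgvoa_vmod_hom_axioms.intro vmod that)
  have objects: "graded_module (gr_alg V) (etaR V M) \<and> graded_module (gr_alg V) (gr_mod V M) \<and>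
      (\<forall>p. \<forall>x\<in>carrier (gcomp (etaR V M) p). etaR_map V M M id p x = x) \<and>
      (\<forall>p. \<forall>x\<in>carrier (gcomp (gr_mod V M) p). gr_map V M M id p x = x)"
    if wM: "weak_dg_module V M" for M :: "('v, 'x::ab_group_add) vmod"
  proof -
    interpret M: dgvoa_vmod V M by (rule vmod[OF wM])
    interpret I: dgvoa_vmod_hom V M M id
      by (rule vhom[OF wM wM weak_dg_module_hom_id[OF wM]])
    interpret G: poisson_realization V M V.self.gr_kernel "gr_class V V" "gr_alg V" M.gr_kernel "gr_class V M"
        "gr_mod V M"
      by (rule M.poisson_realizations)
    interpret E: realization V M V.self.gr_kernel "gr_class V V" "gr_alg V" M.eta_kernel "etaR_class V M" "etaR V M"
      by (rule M.poisson_realizations)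
    show ?thesis
      using G.graded_comm_algebra G.graded_module_axioms E.graded_module_axioms
      by (auto simp: graded_module_def presents_carrier[OF G.presents_W]
          presents_carrier[OF E.presents_W] I.etaR_map_class I.gr_map_class)
  qed
  have naturality: "graded_module_hom (gr_alg V) (etaR V M) (etaR V N) (etaR_map V M N f) \<and>
      graded_module_hom (gr_alg V) (gr_mod V M) (gr_mod V N) (gr_map V M N f) \<and>
      (\<forall>p. \<forall>x\<in>carrier (gcomp (etaR V M) p).
        psi V N p (etaR_map V M N f p x) = gr_map V M N f p (psi V M p x))"
    if w: "weak_dg_module V M" "weak_dg_module V N" "weak_dg_module_hom M N f"
    for M :: "('v, 'x::ab_group_add) vmod" and N :: "('v, 'y::ab_group_add) vmod" and f
  proof -
    interpret f: dgvoa_vmod_hom V M N f by (rule vhom[OF w])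
    show ?thesis
      using f.graded_hom_etaR f.graded_hom_gr
      by (auto simp: presents_carrier[OF realization.presents_W[OF f.M.poisson_realizations(2)]]
          f.etaR_map_class f.gr_map_class f.M.psi_class f.N.psi_class f.hom_deg)
  qed
  have composition: "(\<forall>p. \<forall>x\<in>carrier (gcomp (etaR V M) p).
        etaR_map V M P (g \<circ> f) p x = etaR_map V N P g p (etaR_map V M N f p x)) \<and>
      (\<forall>p. \<forall>x\<in>carrier (gcomp (gr_mod V M) p).
        gr_map V M P (g \<circ> f) p x = gr_map V N P g p (gr_map V M N f p x))"
    if w: "weak_dg_module V M" "weak_dg_module V N" "weak_dg_module V P"
      "weak_dg_module_hom M N f" "weak_dg_module_hom N P g"
    for M :: "('v, 'x::ab_group_add) vmod" and N :: "('v, 'y::ab_group_add) vmod"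
      and P :: "('v, 'z::ab_group_add) vmod" and f g
  proof -
    interpret f: dgvoa_vmod_hom V M N f by (rule vhom[OF w(1,2,4)])
    interpret g: dgvoa_vmod_hom V N P g by (rule vhom[OF w(2,3,5)])
    interpret gf: dgvoa_vmod_hom V M P "g \<circ> f"
      by (rule vhom[OF w(1,3) weak_dg_module_hom_comp[OF w(4,5)]])
    show ?thesis
      by (auto simp: presents_carrier[OF realization.presents_W[OF f.M.poisson_realizations(2)]]
          presents_carrier[OF realization.presents_W[OF poisson_realization.axioms(1)[OF
            f.M.poisson_realizations(1)]]]
          f.etaR_map_class f.gr_map_class g.etaR_map_class g.gr_map_class
          gf.etaR_map_class gf.gr_map_class f.hom_deg)
  qed
  have poisson: "(\<forall>p. \<forall>m\<in>deg M p. psi V M p (etaR_class V M p m) = gr_class V M p m) \<and>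
      graded_surjective (etaR V M) (gr_mod V M) (psi V M) \<and>
      dg_poisson_module (gr_alg V) (gr_mod V M) \<and>
      dg_module (gr_alg V) (etaR V M) \<and>
      dg_module_hom (gr_alg V) (etaR V M) (gr_mod V M) (psi V M) \<and>
      dg_poisson_module (R_alg V) (eta_quot V (R_mod V M)) \<and>
      dg_poisson_module_hom (R_alg V) (eta_quot V (R_mod V M))
        (restrict_eta V (gr_mod V M)) (psi V M) \<and>
      (bracket_descends V (R_mod V M) \<longrightarrow>
        dg_poisson_module (gr_alg V) (etaR V M) \<and>
        dg_poisson_module_hom (gr_alg V) (etaR V M) (gr_mod V M) (psi V M))"
    if wM: "weak_dg_module V M" for M :: "('v, 'x::ab_group_add) vmod"
  proof -
    interpret M: dgvoa_vmod V M by (rule vmod[OF wM])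
    interpret G: poisson_realization V M V.self.gr_kernel "gr_class V V" "gr_alg V" M.gr_kernel "gr_class V M"
        "gr_mod V M"
      by (rule M.poisson_realizations)
    interpret E: realization V M V.self.gr_kernel "gr_class V V" "gr_alg V" M.eta_kernel "etaR_class V M" "etaR V M"
      by (rule M.poisson_realizations)
    interpret Q: poisson_realization V M "\<lambda>p. C2 V \<inter> deg V p" "R_class V" "R_alg V" M.eta_kernel
        "etaR_class V M" "eta_quot V (R_mod V M)"
      by (rule M.poisson_realizations)
    interpret A: poisson_realization V V V.self.gr_kernel "gr_class V V" "gr_alg V" V.self.gr_kernel "gr_class V V"
        "gr_alg V"
      by (rule G.poisson_realization_self)
    interpret B: poisson_realization V V "\<lambda>p. C2 V \<inter> deg V p" "R_class V" "R_alg V"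
        "\<lambda>p. C2 V \<inter> deg V p" "R_class V" "R_alg V"
      by (rule Q.poisson_realization_self)
    note id = weak_dg_module_hom_id[OF wM]
    have psi: "psi V M p (etaR_class V M p m) = gr_class V M p (id m)" if "m \<in> deg M p" for p m
      using M.psi_class[OF that] by simp
    have "graded_surjective (etaR V M) (gr_mod V M) (psi V M)"
      by (auto simp: graded_surjective_def presents_carrier[OF G.presents_W]
          presents_carrier[OF E.presents_W] M.psi_class image_iff)
    moreover have "dg_module_hom (gr_alg V) (etaR V M) (gr_mod V M) (psi V M)"
      by (rule realization_hom[OF E.realization_axioms G.realization_axioms id psi])
    moreover have "dg_poisson_module_hom (R_alg V) (eta_quot V (R_mod V M))
        (restrict_eta V (gr_mod V M)) (psi V M)"
      by (rule poisson_realization_hom[OF Q.poisson_realization_axioms M.poisson_realizations(4) id psi])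
    moreover have "dg_poisson_module (gr_alg V) (etaR V M) \<and>
        dg_poisson_module_hom (gr_alg V) (etaR V M) (gr_mod V M) (psi V M)"
      if b: "bracket_descends V (R_mod V M)"
    proof -
      interpret F: poisson_realization V M V.self.gr_kernel "gr_class V V" "gr_alg V" M.eta_kernel
          "etaR_class V M" "etaR V M"
        by (rule M.poisson_realizations(5)[OF b])
      have "dg_poisson_module_hom (gr_alg V) (etaR V M) (gr_mod V M) (psi V M)"
        by (rule poisson_realization_hom[OF F.poisson_realization_axioms
              G.poisson_realization_axioms id psi])
      then show ?thesis
        by (simp add: dg_poisson_module_def dg_module_def graded_module_def G.dg_poisson_algebra
            G.graded_comm_algebra E.graded_module_axioms A.dg_axioms E.dg_axioms F.poisson_axioms)
    qed
    ultimately show ?thesis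
      by (simp add: M.psi_class dg_poisson_module_def dg_module_def graded_module_def
          G.dg_poisson_algebra G.graded_comm_algebra G.graded_module_axioms G.dg_axioms
          G.poisson_axioms A.dg_axioms E.graded_module_axioms E.dg_axioms Q.dg_poisson_algebra
          Q.graded_comm_algebra Q.graded_module_axioms Q.dg_axioms Q.poisson_axioms B.dg_axioms)
  qed
  show ?thesis
    using objects naturality composition poisson by blast
qed

end
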